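(* Let $A$ be a unital associative ring and $B \subseteq A$ a subring with $1_B = 1_A$. Let $T = (A \otimes_B A)^B$ and $Q = (A \otimes_B A \otimes_B A)^B$. Then the ring extension $A \supseteq B$ has H-depth $3$ if and only if the right $T$-module $Q_T$ is finitely generated projective and the mapping $$Q \otimes_T (A \otimes_B A) \longrightarrow A \otimes_B A \otimes_B A, \qquad q \otimes_T (a \otimes a') \longmapsto aqa'$$ is an isomorphism of $A$-$A$-bimodules.
   Context: $A \supseteq B$ has H-depth $3$ if for some positive integer $m$, $A \otimes_B A \otimes_B A$ is isomorphic as an $A$-$A$-bimodule to a direct summand of $(A \otimes_B A)^m$ (bimodule structures by multiplication on the outer factors). For a $B$-$B$-bimodule $X$, $X^B = \{x \in X : bx = xb \ \forall b \in B\}$. Write $t = t^1 \otimes t^2$ (suppressing a possible summation) for $t \in T \subseteq A \otimes_B A$. $T$ is a ring with multiplication $st = t^1 s^1 \otimes s^2 t^2$ and identity $1_T = 1 \otimes 1$ (isomorphic to $\mathrm{End}({}_A A \otimes_B A_A)$ via $t \mapsto (a \otimes a' \mapsto ata')$). $A \otimes_B A$ is a left $T$-module via $t \cdot (a \otimes a') = ata'$, commuting with its $A$-$A$-bimodule structure. $Q$ is a right $T$-module via $q \cdot t = t^1 q t^2$. *)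

theory Defs
  imports "HOL-Algebra.Subrings" "HOL-Algebra.Free_Abelian_Groups"
begin

text \<open>
  Modules over a possibly noncommutative ring. As for the library record \<^type>\<open>module\<close>, the
  underlying additive group is a \<^type>\<open>ring\<close> record whose fields \<^const>\<open>mult\<close> and \<^const>\<open>one\<close>
  carry no meaning. Left modules are represented by the library record \<^type>\<open>module\<close>
  (not by the locale of that name, which requires a commutative ring of scalars).
\<close>

record ('s, 'm) right_module = "'m ring" +
  rsmult :: "'m \<Rightarrow> 's \<Rightarrow> 'm" (infixl \<open>\<triangleleft>\<index>\<close> 70)

record ('r, 's, 'm) bimodule = "('s, 'm) right_module" +
  lsmult :: "'r \<Rightarrow> 'm \<Rightarrow> 'm" (infixr \<open>\<triangleright>\<index>\<close> 75)

locale right_module = S?: ring S + M?: abelian_group M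
  for S :: "('s, 'x) ring_scheme" (structure)
    and M :: "('s, 'm, 'y) right_module_scheme" (structure) +
  assumes rsmult_closed: "\<lbrakk>x \<in> carrier M; s \<in> carrier S\<rbrakk> \<Longrightarrow> x \<triangleleft>\<^bsub>M\<^esub> s \<in> carrier M"
    and rsmult_l_distr: "\<lbrakk>x \<in> carrier M; y \<in> carrier M; s \<in> carrier S\<rbrakk>
      \<Longrightarrow> (x \<oplus>\<^bsub>M\<^esub> y) \<triangleleft>\<^bsub>M\<^esub> s = (x \<triangleleft>\<^bsub>M\<^esub> s) \<oplus>\<^bsub>M\<^esub> (y \<triangleleft>\<^bsub>M\<^esub> s)"
    and rsmult_r_distr: "\<lbrakk>x \<in> carrier M; s \<in> carrier S; t \<in> carrier S\<rbrakk>
      \<Longrightarrow> x \<triangleleft>\<^bsub>M\<^esub> (s \<oplus>\<^bsub>S\<^esub> t) = (x \<triangleleft>\<^bsub>M\<^esub> s) \<oplus>\<^bsub>M\<^esub> (x \<triangleleft>\<^bsub>M\<^esub> t)"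
    and rsmult_assoc: "\<lbrakk>x \<in> carrier M; s \<in> carrier S; t \<in> carrier S\<rbrakk>
      \<Longrightarrow> x \<triangleleft>\<^bsub>M\<^esub> (s \<otimes>\<^bsub>S\<^esub> t) = (x \<triangleleft>\<^bsub>M\<^esub> s) \<triangleleft>\<^bsub>M\<^esub> t"
    and rsmult_one: "x \<in> carrier M \<Longrightarrow> x \<triangleleft>\<^bsub>M\<^esub> \<one>\<^bsub>S\<^esub> = x"

locale bimodule = right_module S M + R?: ring R
  for R :: "('r, 'z) ring_scheme" (structure)
    and S :: "('s, 'x) ring_scheme" (structure)
    and M :: "('r, 's, 'm, 'y) bimodule_scheme" (structure) +
  assumes lsmult_closed: "\<lbrakk>r \<in> carrier R; x \<in> carrier M\<rbrakk> \<Longrightarrow> r \<triangleright>\<^bsub>M\<^esub> x \<in> carrier M"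
    and lsmult_r_distr: "\<lbrakk>r \<in> carrier R; x \<in> carrier M; y \<in> carrier M\<rbrakk>
      \<Longrightarrow> r \<triangleright>\<^bsub>M\<^esub> (x \<oplus>\<^bsub>M\<^esub> y) = (r \<triangleright>\<^bsub>M\<^esub> x) \<oplus>\<^bsub>M\<^esub> (r \<triangleright>\<^bsub>M\<^esub> y)"
    and lsmult_l_distr: "\<lbrakk>q \<in> carrier R; r \<in> carrier R; x \<in> carrier M\<rbrakk>
      \<Longrightarrow> (q \<oplus>\<^bsub>R\<^esub> r) \<triangleright>\<^bsub>M\<^esub> x = (q \<triangleright>\<^bsub>M\<^esub> x) \<oplus>\<^bsub>M\<^esub> (r \<triangleright>\<^bsub>M\<^esub> x)"
    and lsmult_assoc: "\<lbrakk>q \<in> carrier R; r \<in> carrier R; x \<in> carrier M\<rbrakk>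
      \<Longrightarrow> (q \<otimes>\<^bsub>R\<^esub> r) \<triangleright>\<^bsub>M\<^esub> x = q \<triangleright>\<^bsub>M\<^esub> (r \<triangleright>\<^bsub>M\<^esub> x)"
    and lsmult_one: "x \<in> carrier M \<Longrightarrow> \<one>\<^bsub>R\<^esub> \<triangleright>\<^bsub>M\<^esub> x = x"
    and lsmult_rsmult: "\<lbrakk>r \<in> carrier R; x \<in> carrier M; s \<in> carrier S\<rbrakk>
      \<Longrightarrow> (r \<triangleright>\<^bsub>M\<^esub> x) \<triangleleft>\<^bsub>M\<^esub> s = r \<triangleright>\<^bsub>M\<^esub> (x \<triangleleft>\<^bsub>M\<^esub> s)"

definition left_part :: "('r, 's, 'm, 'x) bimodule_scheme \<Rightarrow> ('r, 'm) module" where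
  "left_part M = \<lparr>carrier = carrier M, mult = undefined, one = undefined,
     ring.zero = \<zero>\<^bsub>M\<^esub>, add = add M, smult = lsmult M\<rparr>"

definition regular_bimodule :: "('a, 'x) ring_scheme \<Rightarrow> ('a, 'a, 'a) bimodule" where
  "regular_bimodule A = \<lparr>carrier = carrier A, mult = mult A, one = \<one>\<^bsub>A\<^esub>,
     ring.zero = \<zero>\<^bsub>A\<^esub>, add = add A, rsmult = mult A, lsmult = mult A\<rparr>"


section \<open>Homomorphisms, direct summands, projectivity\<close>

definition right_module_hom where
  "right_module_hom S M N = {h \<in> hom (add_monoid M) (add_monoid N).
     \<forall>x\<in>carrier M. \<forall>s\<in>carrier S. h (x \<triangleleft>\<^bsub>M\<^esub> s) = h x \<triangleleft>\<^bsub>N\<^esub> s}"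

definition right_module_iso where
  "right_module_iso S M N = {h \<in> right_module_hom S M N. bij_betw h (carrier M) (carrier N)}"

definition bimodule_hom where
  "bimodule_hom R S M N = {h \<in> right_module_hom S M N.
     \<forall>r\<in>carrier R. \<forall>x\<in>carrier M. h (r \<triangleright>\<^bsub>M\<^esub> x) = r \<triangleright>\<^bsub>N\<^esub> h x}"

definition bimodule_iso where
  "bimodule_iso R S M N = {h \<in> bimodule_hom R S M N. bij_betw h (carrier M) (carrier N)}"

definition right_submodule where
  "right_submodule S N M \<longleftrightarrow> subgroup N (add_monoid M) \<and>
     (\<forall>x\<in>N. \<forall>s\<in>carrier S. x \<triangleleft>\<^bsub>M\<^esub> s \<in> N)"

definition sub_bimodule where
  "sub_bimodule R S N M \<longleftrightarrow> right_submodule S N M \<and> (\<forall>r\<in>carrier R. \<forall>x\<in>N. r \<triangleright>\<^bsub>M\<^esub> x \<in> N)"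

definition internal_direct_sum where
  "internal_direct_sum M N N' \<longleftrightarrow> N <+>\<^bsub>M\<^esub> N' = carrier M \<and> N \<inter> N' = {\<zero>\<^bsub>M\<^esub>}"

definition iso_to_right_direct_summand where
  "iso_to_right_direct_summand S X M \<longleftrightarrow>
     (\<exists>N N'. right_submodule S N M \<and> right_submodule S N' M \<and> internal_direct_sum M N N' \<and>
       right_module_iso S X (M\<lparr>carrier := N\<rparr>) \<noteq> {})"

definition iso_to_bimodule_direct_summand where
  "iso_to_bimodule_direct_summand R S X M \<longleftrightarrow>
     (\<exists>N N'. sub_bimodule R S N M \<and> sub_bimodule R S N' M \<and> internal_direct_sum M N N' \<and>
       bimodule_iso R S X (M\<lparr>carrier := N\<rparr>) \<noteq> {})"

definition bimodule_power :: "('r, 's, 'm, 'x) bimodule_scheme \<Rightarrow> nat \<Rightarrow> ('r, 's, nat \<Rightarrow> 'm) bimodule" where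
  "bimodule_power M n = \<lparr>carrier = {..<n} \<rightarrow>\<^sub>E carrier M, mult = undefined, one = undefined,
     ring.zero = (\<lambda>i\<in>{..<n}. \<zero>\<^bsub>M\<^esub>), add = (\<lambda>x y. \<lambda>i\<in>{..<n}. x i \<oplus>\<^bsub>M\<^esub> y i),
     rsmult = (\<lambda>x s. \<lambda>i\<in>{..<n}. x i \<triangleleft>\<^bsub>M\<^esub> s),
     lsmult = (\<lambda>r x. \<lambda>i\<in>{..<n}. r \<triangleright>\<^bsub>M\<^esub> x i)\<rparr>"

definition free_right_module :: "('s, 'x) ring_scheme \<Rightarrow> 'i set \<Rightarrow> ('s, 'i \<Rightarrow> 's) right_module" where
  "free_right_module S I = \<lparr>carrier = {x \<in> I \<rightarrow>\<^sub>E carrier S. finite {i \<in> I. x i \<noteq> \<zero>\<^bsub>S\<^esub>}},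
     mult = undefined, one = undefined,
     ring.zero = (\<lambda>i\<in>I. \<zero>\<^bsub>S\<^esub>), add = (\<lambda>x y. \<lambda>i\<in>I. x i \<oplus>\<^bsub>S\<^esub> y i),
     rsmult = (\<lambda>x s. \<lambda>i\<in>I. x i \<otimes>\<^bsub>S\<^esub> s)\<rparr>"

definition fin_gen_right_module where
  "fin_gen_right_module S M \<longleftrightarrow>
     (\<exists>G. finite G \<and> G \<subseteq> carrier M \<and>
       (\<forall>x\<in>carrier M. \<exists>c\<in>G \<rightarrow> carrier S. x = (\<Oplus>\<^bsub>M\<^esub>g\<in>G. g \<triangleleft>\<^bsub>M\<^esub> c g)))"

text \<open>
  A module is projective if it is isomorphic to a direct summand of a free module. The basis may be
  taken inside the type of elements of \<open>M\<close>: as every module \<open>M\<close> is a quotient of the free module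
  on the set \<open>carrier M\<close>, allowing larger index types gives nothing new.
\<close>

definition projective_right_module ::
  "('s, 'x) ring_scheme \<Rightarrow> ('s, 'm, 'y) right_module_scheme \<Rightarrow> bool" where
  "projective_right_module S M \<longleftrightarrow>
     (\<exists>I :: 'm set. iso_to_right_direct_summand S M (free_right_module S I))"


section \<open>Tensor products over a noncommutative ring\<close>

text \<open>
  \<open>M \<otimes>\<^sub>R N\<close> is the free abelian group on \<open>carrier M \<times> carrier N\<close> modulo the subgroup generated by
  the usual relators. Only the set \<open>R\<close> of scalars is needed.
\<close>

definition tensor_relators ::
  "'r set \<Rightarrow> ('r, 'm, 'x) right_module_scheme \<Rightarrow> ('r, 'n, 'y) module_scheme \<Rightarrow> ('m \<times> 'n \<Rightarrow>\<^sub>0 int) set" where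
  "tensor_relators R M N =
     {frag_of (x \<oplus>\<^bsub>M\<^esub> x', y) - frag_of (x, y) - frag_of (x', y) | x x' y.
        x \<in> carrier M \<and> x' \<in> carrier M \<and> y \<in> carrier N} \<union>
     {frag_of (x, y \<oplus>\<^bsub>N\<^esub> y') - frag_of (x, y) - frag_of (x, y') | x y y'.
        x \<in> carrier M \<and> y \<in> carrier N \<and> y' \<in> carrier N} \<union>
     {frag_of (x \<triangleleft>\<^bsub>M\<^esub> r, y) - frag_of (x, r \<odot>\<^bsub>N\<^esub> y) | x r y.
        x \<in> carrier M \<and> r \<in> R \<and> y \<in> carrier N}"

definition tensor_null ::
  "'r set \<Rightarrow> ('r, 'm, 'x) right_module_scheme \<Rightarrow> ('r, 'n, 'y) module_scheme \<Rightarrow> ('m \<times> 'n \<Rightarrow>\<^sub>0 int) set" where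
  "tensor_null R M N =
     generate (free_Abelian_group (carrier M \<times> carrier N)) (tensor_relators R M N)"

definition tensor_group ::
  "'r set \<Rightarrow> ('r, 'm, 'x) right_module_scheme \<Rightarrow> ('r, 'n, 'y) module_scheme
     \<Rightarrow> ('m \<times> 'n \<Rightarrow>\<^sub>0 int) set ring" where
  "tensor_group R M N =
     (let G = free_Abelian_group (carrier M \<times> carrier N) Mod tensor_null R M N
      in \<lparr>carrier = carrier G, mult = undefined, one = undefined, ring.zero = \<one>\<^bsub>G\<^esub>, add = mult G\<rparr>)"

definition pure_tensor ::
  "'r set \<Rightarrow> ('r, 'm, 'x) right_module_scheme \<Rightarrow> ('r, 'n, 'y) module_scheme
     \<Rightarrow> 'm \<Rightarrow> 'n \<Rightarrow> ('m \<times> 'n \<Rightarrow>\<^sub>0 int) set" where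
  "pure_tensor R M N x y =
     tensor_null R M N #>\<^bsub>free_Abelian_group (carrier M \<times> carrier N)\<^esub> frag_of (x, y)"

text \<open>
  \<open>tensor_lift X f\<close> is the additive map with values in \<open>X\<close> induced by the biadditive balanced map
  \<open>f\<close> on a tensor product, i.e. \<open>x \<otimes> y \<mapsto> f x y\<close>; see \<open>tensor_lift_hom\<close> and \<open>tensor_lift_pure\<close> below.
\<close>

definition frag_eval :: "('z, 'x) ring_scheme \<Rightarrow> ('i \<Rightarrow> 'z) \<Rightarrow> ('i \<Rightarrow>\<^sub>0 int) \<Rightarrow> 'z" where
  "frag_eval X f c = (\<Oplus>\<^bsub>X\<^esub>i\<in>Poly_Mapping.keys c. [Poly_Mapping.lookup c i] \<cdot>\<^bsub>X\<^esub> f i)"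

definition tensor_lift ::
  "('z, 'x) ring_scheme \<Rightarrow> ('m \<Rightarrow> 'n \<Rightarrow> 'z) \<Rightarrow> ('m \<times> 'n \<Rightarrow>\<^sub>0 int) set \<Rightarrow> 'z" where
  "tensor_lift X f C = frag_eval X (case_prod f) (SOME c. c \<in> C)"

definition balanced ::
  "'r set \<Rightarrow> ('r, 'm, 'x) right_module_scheme \<Rightarrow> ('r, 'n, 'y) module_scheme
     \<Rightarrow> ('z, 'w) ring_scheme \<Rightarrow> ('m \<Rightarrow> 'n \<Rightarrow> 'z) \<Rightarrow> bool" where
  "balanced R M N X f \<longleftrightarrow>
     (\<forall>x\<in>carrier M. \<forall>y\<in>carrier N. f x y \<in> carrier X) \<and>
     (\<forall>x\<in>carrier M. \<forall>x'\<in>carrier M. \<forall>y\<in>carrier N. f (x \<oplus>\<^bsub>M\<^esub> x') y = f x y \<oplus>\<^bsub>X\<^esub> f x' y) \<and>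
     (\<forall>x\<in>carrier M. \<forall>y\<in>carrier N. \<forall>y'\<in>carrier N. f x (y \<oplus>\<^bsub>N\<^esub> y') = f x y \<oplus>\<^bsub>X\<^esub> f x y') \<and>
     (\<forall>x\<in>carrier M. \<forall>r\<in>R. \<forall>y\<in>carrier N. f (x \<triangleleft>\<^bsub>M\<^esub> r) y = f x (r \<odot>\<^bsub>N\<^esub> y))"

text \<open>Outer bimodule structure on \<open>M \<otimes>\<^sub>R N\<close> for bimodules \<open>M\<close> and \<open>N\<close>.\<close>

definition bimodule_tensor ::
  "'r set \<Rightarrow> ('p, 'r, 'm, 'x) bimodule_scheme \<Rightarrow> ('r, 's, 'n, 'y) bimodule_scheme
     \<Rightarrow> ('p, 's, ('m \<times> 'n \<Rightarrow>\<^sub>0 int) set) bimodule" where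
  "bimodule_tensor R M N =
     (let G = tensor_group R M (left_part N); p = pure_tensor R M (left_part N)
      in \<lparr>carrier = carrier G, mult = undefined, one = undefined, ring.zero = \<zero>\<^bsub>G\<^esub>, add = add G,
          rsmult = (\<lambda>u s. tensor_lift G (\<lambda>x y. p x (y \<triangleleft>\<^bsub>N\<^esub> s)) u),
          lsmult = (\<lambda>a u. tensor_lift G (\<lambda>x y. p (a \<triangleright>\<^bsub>M\<^esub> x) y) u)\<rparr>)"


section \<open>The ring extension \<open>A \<supseteq> B\<close>\<close>

type_synonym 'a tensor2 = "('a \<times> 'a \<Rightarrow>\<^sub>0 int) set"
type_synonym 'a tensor3 = "('a tensor2 \<times> 'a \<Rightarrow>\<^sub>0 int) set"

definition AA :: "('a, 'x) ring_scheme \<Rightarrow> 'a set \<Rightarrow> ('a, 'a, 'a tensor2) bimodule" where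
  "AA A B = bimodule_tensor B (regular_bimodule A) (regular_bimodule A)"

definition AAA :: "('a, 'x) ring_scheme \<Rightarrow> 'a set \<Rightarrow> ('a, 'a, 'a tensor3) bimodule" where
  "AAA A B = bimodule_tensor B (AA A B) (regular_bimodule A)"

definition pure2 :: "('a, 'x) ring_scheme \<Rightarrow> 'a set \<Rightarrow> 'a \<Rightarrow> 'a \<Rightarrow> 'a tensor2" where
  "pure2 A B = pure_tensor B (regular_bimodule A) (left_part (regular_bimodule A))"

definition H_depth_3 :: "('a, 'x) ring_scheme \<Rightarrow> 'a set \<Rightarrow> bool" where
  "H_depth_3 A B \<longleftrightarrow> (\<exists>m>0. iso_to_bimodule_direct_summand A A (AAA A B) (bimodule_power (AA A B) m))"

definition centralizer_in :: "('a, 'a, 'm, 'x) bimodule_scheme \<Rightarrow> 'a set \<Rightarrow> 'm set" where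
  "centralizer_in X B = {x \<in> carrier X. \<forall>b\<in>B. b \<triangleright>\<^bsub>X\<^esub> x = x \<triangleleft>\<^bsub>X\<^esub> b}"

text \<open>
  For \<open>x \<in> X\<^sup>B\<close>, \<open>sandwich X x\<close> is the map \<open>A \<otimes>\<^sub>B A \<rightarrow> X\<close>, \<open>a \<otimes> a' \<mapsto> a x a'\<close>; the multiplication
  \<open>st = t\<^sup>1 s t\<^sup>2\<close> of \<open>T\<close>, the left action \<open>t \<cdot> (a \<otimes> a') = a t a'\<close> of \<open>T\<close> on \<open>A \<otimes>\<^sub>B A\<close> and the right
  action \<open>q \<cdot> t = t\<^sup>1 q t\<^sup>2\<close> of \<open>T\<close> on \<open>Q\<close> are all of this form.
\<close>

definition sandwich :: "('a, 'a, 'm, 'x) bimodule_scheme \<Rightarrow> 'm \<Rightarrow> 'a tensor2 \<Rightarrow> 'm" where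
  "sandwich X x = tensor_lift X (\<lambda>a a'. (a \<triangleright>\<^bsub>X\<^esub> x) \<triangleleft>\<^bsub>X\<^esub> a')"

definition T_ring :: "('a, 'x) ring_scheme \<Rightarrow> 'a set \<Rightarrow> 'a tensor2 ring" where
  "T_ring A B = \<lparr>carrier = centralizer_in (AA A B) B, mult = (\<lambda>s t. sandwich (AA A B) s t),
     one = pure2 A B \<one>\<^bsub>A\<^esub> \<one>\<^bsub>A\<^esub>, ring.zero = \<zero>\<^bsub>AA A B\<^esub>, add = add (AA A B)\<rparr>"

definition AA_left_T :: "('a, 'x) ring_scheme \<Rightarrow> 'a set \<Rightarrow> ('a tensor2, 'a tensor2) module" where
  "AA_left_T A B = \<lparr>carrier = carrier (AA A B), mult = undefined, one = undefined,
     ring.zero = \<zero>\<^bsub>AA A B\<^esub>, add = add (AA A B), smult = (\<lambda>t u. sandwich (AA A B) t u)\<rparr>"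

definition Q_module :: "('a, 'x) ring_scheme \<Rightarrow> 'a set \<Rightarrow> ('a tensor2, 'a tensor3) right_module" where
  "Q_module A B = \<lparr>carrier = centralizer_in (AAA A B) B, mult = undefined, one = undefined,
     ring.zero = \<zero>\<^bsub>AAA A B\<^esub>, add = add (AAA A B), rsmult = (\<lambda>q t. sandwich (AAA A B) q t)\<rparr>"

text \<open>
  \<open>Q \<otimes>\<^sub>T (A \<otimes>\<^sub>B A)\<close> as an \<open>A\<close>-\<open>A\<close>-bimodule, both actions being those of the factor \<open>A \<otimes>\<^sub>B A\<close>.
\<close>

definition Q_tensor_AA ::
  "('a, 'x) ring_scheme \<Rightarrow> 'a set \<Rightarrow> ('a, 'a, ('a tensor3 \<times> 'a tensor2 \<Rightarrow>\<^sub>0 int) set) bimodule" where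
  "Q_tensor_AA A B =
     (let T = carrier (T_ring A B);
          G = tensor_group T (Q_module A B) (AA_left_T A B);
          p = pure_tensor T (Q_module A B) (AA_left_T A B)
      in \<lparr>carrier = carrier G, mult = undefined, one = undefined, ring.zero = \<zero>\<^bsub>G\<^esub>, add = add G,
          rsmult = (\<lambda>w a. tensor_lift G (\<lambda>q u. p q (u \<triangleleft>\<^bsub>AA A B\<^esub> a)) w),
          lsmult = (\<lambda>a w. tensor_lift G (\<lambda>q u. p q (a \<triangleright>\<^bsub>AA A B\<^esub> u)) w)\<rparr>)"

text \<open>The map \<open>q \<otimes> (a \<otimes> a') \<mapsto> a q a'\<close>.\<close>

definition canonical_map ::
  "('a, 'x) ring_scheme \<Rightarrow> 'a set \<Rightarrow> ('a tensor3 \<times> 'a tensor2 \<Rightarrow>\<^sub>0 int) set \<Rightarrow> 'a tensor3" where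
  "canonical_map A B = tensor_lift (AAA A B) (\<lambda>q u. sandwich (AAA A B) q u)"



section \<open>The universal property of the tensor product\<close>

lemma (in abelian_group) frag_eval_superset:
  assumes "f \<in> S \<rightarrow> carrier G" "Poly_Mapping.keys c \<subseteq> K" "K \<subseteq> S" "finite K"
  shows "frag_eval G f c = (\<Oplus>i\<in>K. [Poly_Mapping.lookup c i] \<cdot> f i)"
  unfolding frag_eval_def
proof (rule add.finprod_mono_neutral_cong_left)
  show "[Poly_Mapping.lookup c i] \<cdot> f i = \<zero>" if "i \<in> K - Poly_Mapping.keys c" for i
    using that by (simp add: in_keys_iff add_pow_def)
  show "(\<lambda>i. [Poly_Mapping.lookup c i] \<cdot> f i) \<in> K \<rightarrow> carrier G"
    using assms by (auto intro!: add.int_pow_closed)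
qed (use assms in auto)

lemma (in abelian_group) frag_eval_hom:
  assumes f: "f \<in> S \<rightarrow> carrier G"
  shows "frag_eval G f \<in> hom (free_Abelian_group S) (add_monoid G)"
proof (rule homI)
  fix c assume c: "c \<in> carrier (free_Abelian_group S)"
  then have "\<forall>i\<in>Poly_Mapping.keys c. f i \<in> carrier G" using f by auto
  then show "frag_eval G f c \<in> carrier (add_monoid G)"
    unfolding frag_eval_def by (auto intro!: finsum_closed add.int_pow_closed)
next
  fix c d assume c: "c \<in> carrier (free_Abelian_group S)" and d: "d \<in> carrier (free_Abelian_group S)"
  define K where "K = Poly_Mapping.keys c \<union> Poly_Mapping.keys d"
  have K: "K \<subseteq> S" "finite K" using c d by (auto simp: K_def)
  have fK: "f i \<in> carrier G" if "i \<in> K" for i using that K f by auto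
  have "Poly_Mapping.keys (c + d) \<subseteq> K" unfolding K_def by (rule Poly_Mapping.keys_add)
  then have "frag_eval G f (c + d) = (\<Oplus>i\<in>K. [Poly_Mapping.lookup (c+d) i] \<cdot> f i)"
    by (rule frag_eval_superset[OF f _ K])
  also have "\<dots> = (\<Oplus>i\<in>K. [Poly_Mapping.lookup c i] \<cdot> f i \<oplus> [Poly_Mapping.lookup d i] \<cdot> f i)"
    by (rule add.finprod_cong') (auto simp: fK Poly_Mapping.lookup_add add.int_pow_mult intro!: add.int_pow_closed)
  also have "\<dots> = (\<Oplus>i\<in>K. [Poly_Mapping.lookup c i] \<cdot> f i) \<oplus> (\<Oplus>i\<in>K. [Poly_Mapping.lookup d i] \<cdot> f i)"
    by (rule add.finprod_multf) (auto simp: fK intro!: add.int_pow_closed)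
  also have "\<dots> = frag_eval G f c \<oplus> frag_eval G f d"
    using frag_eval_superset[OF f _ K, of c] frag_eval_superset[OF f _ K, of d] by (simp add: K_def)
  finally show "frag_eval G f (c \<otimes>\<^bsub>free_Abelian_group S\<^esub> d) = frag_eval G f c \<otimes>\<^bsub>add_monoid G\<^esub> frag_eval G f d"
    by simp
qed

lemma (in abelian_group) frag_eval_of:
  assumes "f i \<in> carrier G"
  shows "frag_eval G f (frag_of i) = f i"
proof -
  have "frag_eval G f (frag_of i) = (\<Oplus>j\<in>{i}. f j)"
    unfolding frag_eval_def keys_frag_of using assms
    by (intro add.finprod_cong') (auto simp: add_pow_def group.int_pow_1[OF a_group, simplified])
  then show ?thesis using assms by simp
qed

locale tensor_setting = M?: abelian_group M + N?: abelian_group N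
  for M :: "('r, 'm, 'x) right_module_scheme" (structure)
    and N :: "('r, 'n, 'y) module_scheme" (structure) +
  fixes R :: "'r set"
  assumes act_right: "\<lbrakk>x \<in> carrier M; r \<in> R\<rbrakk> \<Longrightarrow> x \<triangleleft>\<^bsub>M\<^esub> r \<in> carrier M"
    and act_left: "\<lbrakk>r \<in> R; y \<in> carrier N\<rbrakk> \<Longrightarrow> r \<odot>\<^bsub>N\<^esub> y \<in> carrier N"
begin

abbreviation "F \<equiv> free_Abelian_group (carrier M \<times> carrier N)"

lemma keys_frag_diff: "Poly_Mapping.keys (frag_of a - frag_of b) \<subseteq> {a, b}"
  using keys_diff[of "frag_of a" "frag_of b"] by (simp add: keys_frag_of insert_commute)

lemma relators_in_F: "tensor_relators R M N \<subseteq> carrier F"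
proof -
  have "frag_of a - frag_of b - frag_of c \<in> carrier F" if "{a,b,c} \<subseteq> carrier M \<times> carrier N" for a b c
    using that keys_diff[of "frag_of a - frag_of b" "frag_of c"] keys_frag_diff[of a b]
    by (fastforce simp: keys_frag_of)
  moreover have "frag_of a - frag_of b \<in> carrier F" if "{a,b} \<subseteq> carrier M \<times> carrier N" for a b
    using that keys_frag_diff[of a b] by fastforce
  ultimately show ?thesis
    unfolding tensor_relators_def using act_left act_right by (auto simp del: carrier_free_Abelian_group_iff)
qed

lemma null_normal: "tensor_null R M N \<lhd> F"
  unfolding tensor_null_def
  by (rule comm_group.subgroup_imp_normal[OF abelian_free_Abelian_group])
     (rule group.generate_is_subgroup[OF group_free_Abelian_group relators_in_F])

lemma tensor_abelian_group: "abelian_group (tensor_group R M N)"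
proof -
  interpret normal "tensor_null R M N" F by (rule null_normal)
  have "comm_group (F Mod tensor_null R M N)"
    by (rule comm_group.abelian_FactGroup[OF abelian_free_Abelian_group]) (rule is_subgroup)
  then have "comm_group (add_monoid (tensor_group R M N))"
    by (auto simp: tensor_group_def Let_def comm_group_def comm_monoid_def comm_monoid_axioms_def
        group_def group_axioms_def monoid_def Units_def)
  then show ?thesis
    by (rule_tac comm_group_abelian_groupI)
qed

lemma pure_closed: "\<lbrakk>x \<in> carrier M; y \<in> carrier N\<rbrakk> \<Longrightarrow> pure_tensor R M N x y \<in> carrier (tensor_group R M N)"
  by (simp add: pure_tensor_def tensor_group_def Let_def carrier_FactGroup)

end

lemma lift_coset:
  assumes "tensor_setting M N R" "abelian_group X" "balanced R M N X f"
    and c: "c \<in> carrier (free_Abelian_group (carrier M \<times> carrier N))"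
  shows "tensor_lift X f (tensor_null R M N #>\<^bsub>free_Abelian_group (carrier M \<times> carrier N)\<^esub> c) =
         frag_eval X (case_prod f) c"
proof -
  interpret tensor_setting M N R by fact
  interpret X: abelian_group X by fact
  interpret nn: normal "tensor_null R M N" F by (rule null_normal)
  let ?g = "frag_eval X (case_prod f)"
  have f: "case_prod f \<in> carrier M \<times> carrier N \<rightarrow> carrier X"
    using assms(3) by (auto simp: balanced_def)
  interpret g: group_hom F "add_monoid X" ?g
    by (intro group_hom.intro group_hom_axioms.intro X.frag_eval_hom[OF f] group_free_Abelian_group X.a_group)
  have of': "?g (frag_of (x,y)) = f x y" if "x \<in> carrier M" "y \<in> carrier N" for x y
    using X.frag_eval_of[of "case_prod f" "(x,y)"] funcset_mem[OF f, of "(x,y)"] that by simp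
  have minus: "?g (a - b) = ?g a \<ominus>\<^bsub>X\<^esub> ?g b" if "a \<in> carrier F" "b \<in> carrier F" for a b
    using g.hom_mult[of a "inv\<^bsub>F\<^esub> b"] g.hom_inv[of b] that
    by (simp add: a_minus_def a_inv_def)
  have "tensor_relators R M N \<subseteq> kernel F (add_monoid X) ?g"
  proof
    fix c assume c: "c \<in> tensor_relators R M N"
    then have cF: "c \<in> carrier F" using relators_in_F by blast
    have dF: "frag_of a - frag_of b \<in> carrier F" if "a \<in> carrier M \<times> carrier N" "b \<in> carrier M \<times> carrier N" for a b
      using that keys_frag_diff[of a b] by fastforce
    have oF: "frag_of a \<in> carrier F" if "a \<in> carrier M \<times> carrier N" for a
      using that by (simp add: keys_frag_of)
    have fc: "f x y \<in> carrier X" if "x \<in> carrier M" "y \<in> carrier N" for x y using funcset_mem[OF f, of "(x,y)"] that by simp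
    have az: "(u \<oplus>\<^bsub>X\<^esub> v) \<ominus>\<^bsub>X\<^esub> u \<ominus>\<^bsub>X\<^esub> v = \<zero>\<^bsub>X\<^esub>" if "u \<in> carrier X" "v \<in> carrier X" for u v
      using that X.r_neg[of "u \<oplus>\<^bsub>X\<^esub> v"] by (simp add: a_minus_def X.minus_add X.a_assoc)
    have "?g c = \<zero>\<^bsub>X\<^esub>"
      using c assms(3) unfolding tensor_relators_def balanced_def
      by (auto simp: minus dF oF of' fc az act_left act_right X.r_neg a_minus_def simp del: carrier_free_Abelian_group_iff)
         (auto simp: az[unfolded a_minus_def] fc)
    then show "c \<in> kernel F (add_monoid X) ?g" using cF by (simp add: kernel_def)
  qed
  then have null: "tensor_null R M N \<subseteq> kernel F (add_monoid X) ?g"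
    unfolding tensor_null_def by (rule group.generate_subgroup_incl[OF group_free_Abelian_group]) (rule g.subgroup_kernel)
  let ?C = "tensor_null R M N #>\<^bsub>F\<^esub> c"
  have "c \<in> ?C" by (rule group.rcos_self[OF group_free_Abelian_group c nn.is_subgroup])
  then have "(SOME d. d \<in> ?C) \<in> ?C" by (rule someI)
  then obtain k where k: "k \<in> tensor_null R M N" "(SOME d. d \<in> ?C) = k + c"
    by (auto simp: r_coset_def)
  have "?g (k + c) = ?g c"
    using g.hom_mult[of k c] g.hom_closed[OF c] c null k(1) by (auto simp: kernel_def)
  with k show ?thesis by (simp add: tensor_lift_def)
qed

lemma tensor_lift_hom:
  assumes "tensor_setting M N R" "abelian_group X" "balanced R M N X f"
  shows "tensor_lift X f \<in> hom (add_monoid (tensor_group R M N)) (add_monoid X)"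
proof -
  interpret tensor_setting M N R by fact
  interpret X: abelian_group X by fact
  interpret nn: normal "tensor_null R M N" F by (rule null_normal)
  have f: "case_prod f \<in> carrier M \<times> carrier N \<rightarrow> carrier X"
    using assms(3) by (auto simp: balanced_def)
  note h = X.frag_eval_hom[OF f]
  show ?thesis
  proof (rule homI)
    fix u assume "u \<in> carrier (add_monoid (tensor_group R M N))"
    then obtain c where c: "c \<in> carrier F" "u = tensor_null R M N #>\<^bsub>F\<^esub> c"
      by (auto simp: tensor_group_def Let_def carrier_FactGroup)
    show "tensor_lift X f u \<in> carrier (add_monoid X)"
      unfolding c(2) lift_coset[OF assms c(1)] by (rule hom_in_carrier[OF h c(1)])
  next
    fix u v assume "u \<in> carrier (add_monoid (tensor_group R M N))" "v \<in> carrier (add_monoid (tensor_group R M N))"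
    then obtain c d where c: "c \<in> carrier F" "u = tensor_null R M N #>\<^bsub>F\<^esub> c"
       and d: "d \<in> carrier F" "v = tensor_null R M N #>\<^bsub>F\<^esub> d"
      by (auto simp: tensor_group_def Let_def carrier_FactGroup)
    have "u \<otimes>\<^bsub>add_monoid (tensor_group R M N)\<^esub> v = tensor_null R M N #>\<^bsub>F\<^esub> (c \<otimes>\<^bsub>F\<^esub> d)"
      unfolding c(2) d(2) using nn.rcos_sum[OF c(1) d(1)] by (simp add: tensor_group_def Let_def)
    moreover have "c \<otimes>\<^bsub>F\<^esub> d \<in> carrier F" using c d nn.m_closed by blast
    ultimately show "tensor_lift X f (u \<otimes>\<^bsub>add_monoid (tensor_group R M N)\<^esub> v)
       = tensor_lift X f u \<otimes>\<^bsub>add_monoid X\<^esub> tensor_lift X f v"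
      using c d by (simp only: lift_coset[OF assms] hom_mult[OF h])
  qed
qed

lemma tensor_lift_pure:
  assumes "tensor_setting M N R" "abelian_group X" "balanced R M N X f"
    and "x \<in> carrier M" "y \<in> carrier N"
  shows "tensor_lift X f (pure_tensor R M N x y) = f x y"
proof -
  interpret X: abelian_group X by fact
  have "f x y \<in> carrier X" using assms by (auto simp: balanced_def)
  then show ?thesis
    unfolding pure_tensor_def
    by (subst lift_coset[OF assms(1-3)]) (use assms X.frag_eval_of[of "case_prod f" "(x,y)"] in \<open>auto simp: keys_frag_of\<close>)
qed


lemma tensor_hom_eqI:
  assumes "tensor_setting M N R" "abelian_group X"
    and g: "g \<in> hom (add_monoid (tensor_group R M N)) (add_monoid X)"
    and h: "h \<in> hom (add_monoid (tensor_group R M N)) (add_monoid X)"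
    and eq: "\<And>x y. \<lbrakk>x \<in> carrier M; y \<in> carrier N\<rbrakk> \<Longrightarrow> g (pure_tensor R M N x y) = h (pure_tensor R M N x y)"
    and u: "u \<in> carrier (tensor_group R M N)"
  shows "g u = h u"
proof -
  interpret tensor_setting M N R by fact
  interpret X: abelian_group X by fact
  interpret nn: normal "tensor_null R M N" F by (rule null_normal)
  have T: "abelian_group (tensor_group R M N)" by (rule tensor_abelian_group)
  interpret T: abelian_group "tensor_group R M N" by (rule T)
  interpret g: abelian_group_hom "tensor_group R M N" X g
    by (intro abelian_group_homI T assms group_hom.intro group_hom_axioms.intro g T.a_group X.a_group)
  interpret h: abelian_group_hom "tensor_group R M N" X h
    by (intro abelian_group_homI T assms group_hom.intro group_hom_axioms.intro h T.a_group X.a_group)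
  define \<pi> where "\<pi> = (\<lambda>c. tensor_null R M N #>\<^bsub>F\<^esub> c)"
  have pc: "\<pi> c \<in> carrier (tensor_group R M N)" if "c \<in> carrier F" for c
    using that by (simp add: \<pi>_def tensor_group_def Let_def carrier_FactGroup)
  have padd: "\<pi> (c + d) = \<pi> c \<oplus>\<^bsub>tensor_group R M N\<^esub> \<pi> d" if "c \<in> carrier F" "d \<in> carrier F" for c d
    using nn.rcos_sum[OF that] by (simp add: \<pi>_def tensor_group_def Let_def)
  obtain c where c: "c \<in> carrier F" "u = \<pi> c"
    using u by (auto simp: \<pi>_def tensor_group_def Let_def carrier_FactGroup)
  have p0: "\<pi> 0 = \<zero>\<^bsub>tensor_group R M N\<^esub>"
    using padd[of 0 0] pc[of 0] T.add.l_cancel_one'[of "\<pi> 0" "\<pi> 0"] by simp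
  have pd: "\<pi> (a - b) = \<pi> a \<ominus>\<^bsub>tensor_group R M N\<^esub> \<pi> b" if ab: "a \<in> carrier F" "b \<in> carrier F" for a b
  proof -
    have d: "a - b \<in> carrier F" using ab keys_diff[of a b] by auto
    have "\<pi> (a - b) \<oplus>\<^bsub>tensor_group R M N\<^esub> \<pi> b = \<pi> a"
      using padd[OF d ab(2)] by simp
    then show ?thesis
      using pc[OF d] pc[OF ab(1)] pc[OF ab(2)]
      by (metis T.add.inv_solve_right a_minus_def)
  qed
  have "Poly_Mapping.keys c \<subseteq> carrier M \<times> carrier N" using c by simp
  then have "Poly_Mapping.keys c \<subseteq> carrier M \<times> carrier N \<and> g (\<pi> c) = h (\<pi> c)"
  proof (induction rule: frag_induction)
    case zero then show ?case by (simp add: p0)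
  next
    case (one z) then show ?case using eq by (cases z) (auto simp: \<pi>_def pure_tensor_def)
  next
    case (diff a b)
    then show ?case using keys_diff[of a b]
      by (auto simp: pd pc a_minus_def)
  qed
  then show ?thesis using c by simp
qed

lemma pure_balanced:
  assumes "tensor_setting M N R"
  shows "balanced R M N (tensor_group R M N) (pure_tensor R M N)"
proof -
  interpret tensor_setting M N R by fact
  interpret nn: normal "tensor_null R M N" F by (rule null_normal)
  interpret T: abelian_group "tensor_group R M N" by (rule tensor_abelian_group)
  have eq: "tensor_null R M N #>\<^bsub>F\<^esub> c = tensor_null R M N #>\<^bsub>F\<^esub> d"
    if "c \<in> carrier F" "d \<in> carrier F" "c - d \<in> tensor_relators R M N" for c d
  proof -
    have "c - d \<in> tensor_null R M N" unfolding tensor_null_def by (rule generate.incl) fact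
    then have "c \<in> tensor_null R M N #>\<^bsub>F\<^esub> d"
      unfolding r_coset_def by (auto intro!: bexI[of _ "c - d"])
    then show ?thesis
      by (metis group.repr_independence group_free_Abelian_group nn.is_subgroup that(2))
  qed
  have add: "pure_tensor R M N x y \<oplus>\<^bsub>tensor_group R M N\<^esub> pure_tensor R M N x' y'
     = tensor_null R M N #>\<^bsub>F\<^esub> (frag_of (x,y) + frag_of (x',y'))"
    if "x \<in> carrier M" "x' \<in> carrier M" "y \<in> carrier N" "y' \<in> carrier N" for x x' y y'
    using nn.rcos_sum[of "frag_of (x,y)" "frag_of (x',y')"] that
    by (simp add: pure_tensor_def tensor_group_def Let_def keys_frag_of)
  have inF: "frag_of (x,y) + frag_of (x',y') \<in> carrier F"
    if "x \<in> carrier M" "x' \<in> carrier M" "y \<in> carrier N" "y' \<in> carrier N" for x x' y y'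
    using that Poly_Mapping.keys_add[of "frag_of (x,y)" "frag_of (x',y')"]
    by (auto simp: keys_frag_of)
  show ?thesis
    unfolding balanced_def
  proof (intro conjI ballI)
    fix x x' y assume *: "x \<in> carrier M" "x' \<in> carrier M" "y \<in> carrier N"
    show "pure_tensor R M N (x \<oplus>\<^bsub>M\<^esub> x') y = pure_tensor R M N x y \<oplus>\<^bsub>tensor_group R M N\<^esub> pure_tensor R M N x' y"
      unfolding add[OF *(1,2,3,3)] unfolding pure_tensor_def
      by (rule eq) (use * inF[OF *(1,2,3,3)] in \<open>auto simp: keys_frag_of tensor_relators_def diff_diff_eq\<close>)
  next
    fix x y y' assume *: "x \<in> carrier M" "y \<in> carrier N" "y' \<in> carrier N"
    show "pure_tensor R M N x (y \<oplus>\<^bsub>N\<^esub> y') = pure_tensor R M N x y \<oplus>\<^bsub>tensor_group R M N\<^esub> pure_tensor R M N x y'"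
      unfolding add[OF *(1,1,2,3)] unfolding pure_tensor_def
      by (rule eq) (use * inF[OF *(1,1,2,3)] in \<open>auto simp: keys_frag_of tensor_relators_def diff_diff_eq\<close>)
  next
    fix x r y assume *: "x \<in> carrier M" "r \<in> R" "y \<in> carrier N"
    show "pure_tensor R M N (x \<triangleleft>\<^bsub>M\<^esub> r) y = pure_tensor R M N x (r \<odot>\<^bsub>N\<^esub> y)"
      unfolding pure_tensor_def
      by (rule eq) (use * act_left act_right in \<open>auto simp: keys_frag_of tensor_relators_def\<close>)
  qed (rule pure_closed)
qed


section \<open>Tensor products of bimodules are bimodules\<close>

lemma left_part_simps [simp]: "carrier (left_part N) = carrier N" "ring.zero (left_part N) = ring.zero N"
  "add (left_part N) = add N" "smult (left_part N) = lsmult N"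
  by (simp_all add: left_part_def)

lemma abelian_group_cong:
  assumes "abelian_group G" "carrier H = carrier G" "ring.zero H = ring.zero G" "add H = add G"
  shows "abelian_group H"
proof -
  interpret abelian_group G by fact
  show ?thesis
    by (rule abelian_groupI) (auto simp: assms a_assoc intro: a_comm a_closed l_neg add.inv_closed)
qed

lemma regular_bimodule_simps [simp]:
  "carrier (regular_bimodule A) = carrier A" "ring.zero (regular_bimodule A) = ring.zero A"
  "add (regular_bimodule A) = add A" "rsmult (regular_bimodule A) = mult A" "lsmult (regular_bimodule A) = mult A"
  by (simp_all add: regular_bimodule_def)

lemma regular_is_bimodule:
  assumes "ring A" shows "bimodule A A (regular_bimodule A)"
proof -
  interpret ring A by fact
  have "abelian_group (regular_bimodule A)"
    by (rule abelian_group_cong[OF is_abelian_group]) auto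
  then show ?thesis
    by (intro bimodule.intro right_module.intro right_module_axioms.intro bimodule_axioms.intro assms)
      (auto simp: l_distr r_distr m_assoc)
qed

lemma bimodule_tensor_setting:
  assumes "bimodule P S M" "bimodule S' S2 N" "R \<subseteq> carrier S" "R \<subseteq> carrier S'"
  shows "tensor_setting M (left_part N) R"
proof -
  interpret M: bimodule P S M by fact
  interpret N: bimodule S' S2 N by fact
  have "abelian_group (left_part N)" by (rule abelian_group_cong[OF N.M.abelian_group_axioms]) auto
  then show ?thesis
    by (intro tensor_setting.intro tensor_setting_axioms.intro M.M.abelian_group_axioms)
       (use assms M.rsmult_closed N.lsmult_closed in auto)
qed

lemma bimodule_tensor_simps [simp]:
  "carrier (bimodule_tensor R M N) = carrier (tensor_group R M (left_part N))"
  "ring.zero (bimodule_tensor R M N) = ring.zero (tensor_group R M (left_part N))"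
  "add (bimodule_tensor R M N) = add (tensor_group R M (left_part N))"
  by (simp_all add: bimodule_tensor_def Let_def)

context
  fixes P :: "('p,'x1) ring_scheme" and S :: "('s,'x2) ring_scheme" and S2 :: "('t,'x3) ring_scheme"
    and M :: "('p,'s,'m,'x4) bimodule_scheme" and N :: "('s,'t,'n,'x5) bimodule_scheme" and R
  assumes M: "bimodule P S M" and N: "bimodule S S2 N" and R: "R \<subseteq> carrier S"
begin

interpretation M: bimodule P S M by (rule M)
interpretation N: bimodule S S2 N by (rule N)
interpretation ts: tensor_setting M "left_part N" R
  by (rule bimodule_tensor_setting[OF M N R R])
interpretation T: abelian_group "tensor_group R M (left_part N)" by (rule ts.tensor_abelian_group)


lemmas pure_tensor_balanced = pure_balanced[OF ts.tensor_setting_axioms, unfolded balanced_def, simplified]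

lemma rsmult_tensor_balanced: assumes "s \<in> carrier S2" shows "balanced R M (left_part N) (tensor_group R M (left_part N)) (\<lambda>x y. pure_tensor R M (left_part N) x (y \<triangleleft>\<^bsub>N\<^esub> s))"
  using assms pure_tensor_balanced R
  by (auto simp: balanced_def N.rsmult_closed N.rsmult_l_distr subset_iff N.lsmult_rsmult)

lemma lsmult_tensor_balanced: assumes "a \<in> carrier P" shows "balanced R M (left_part N) (tensor_group R M (left_part N)) (\<lambda>x y. pure_tensor R M (left_part N) (a \<triangleright>\<^bsub>M\<^esub> x) y)"
  using assms pure_tensor_balanced R
  by (auto simp: balanced_def M.lsmult_closed M.lsmult_r_distr subset_iff simp flip: M.lsmult_rsmult)

lemma rsmult_tensor: "u \<triangleleft>\<^bsub>bimodule_tensor R M N\<^esub> s = tensor_lift (tensor_group R M (left_part N)) (\<lambda>x y. pure_tensor R M (left_part N) x (y \<triangleleft>\<^bsub>N\<^esub> s)) u"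
  by (simp add: bimodule_tensor_def Let_def)
lemma lsmult_tensor: "a \<triangleright>\<^bsub>bimodule_tensor R M N\<^esub> u = tensor_lift (tensor_group R M (left_part N)) (\<lambda>x y. pure_tensor R M (left_part N) (a \<triangleright>\<^bsub>M\<^esub> x) y) u"
  by (simp add: bimodule_tensor_def Let_def)

lemma rsmult_tensor_hom: "s \<in> carrier S2 \<Longrightarrow> (\<lambda>u. u \<triangleleft>\<^bsub>bimodule_tensor R M N\<^esub> s) \<in> hom (add_monoid (tensor_group R M (left_part N))) (add_monoid (tensor_group R M (left_part N)))"
  unfolding rsmult_tensor by (rule tensor_lift_hom[OF ts.tensor_setting_axioms T.abelian_group_axioms rsmult_tensor_balanced])
lemma lsmult_tensor_hom: "a \<in> carrier P \<Longrightarrow> (\<lambda>u. a \<triangleright>\<^bsub>bimodule_tensor R M N\<^esub> u) \<in> hom (add_monoid (tensor_group R M (left_part N))) (add_monoid (tensor_group R M (left_part N)))"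
  unfolding lsmult_tensor by (rule tensor_lift_hom[OF ts.tensor_setting_axioms T.abelian_group_axioms lsmult_tensor_balanced])

lemma rsmult_pure_tensor: "\<lbrakk>s \<in> carrier S2; x \<in> carrier M; y \<in> carrier N\<rbrakk> \<Longrightarrow> pure_tensor R M (left_part N) x y \<triangleleft>\<^bsub>bimodule_tensor R M N\<^esub> s = pure_tensor R M (left_part N) x (y \<triangleleft>\<^bsub>N\<^esub> s)"
  unfolding rsmult_tensor by (rule tensor_lift_pure[OF ts.tensor_setting_axioms T.abelian_group_axioms rsmult_tensor_balanced]) auto
lemma lsmult_pure_tensor: "\<lbrakk>a \<in> carrier P; x \<in> carrier M; y \<in> carrier N\<rbrakk> \<Longrightarrow> a \<triangleright>\<^bsub>bimodule_tensor R M N\<^esub> pure_tensor R M (left_part N) x y = pure_tensor R M (left_part N) (a \<triangleright>\<^bsub>M\<^esub> x) y"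
  unfolding lsmult_tensor by (rule tensor_lift_pure[OF ts.tensor_setting_axioms T.abelian_group_axioms lsmult_tensor_balanced]) auto

lemma tensor_id_hom: "(\<lambda>u. u) \<in> hom (add_monoid (tensor_group R M (left_part N))) (add_monoid (tensor_group R M (left_part N)))" by (auto simp: hom_def)

lemma tensor_add_hom: "f \<in> hom (add_monoid (tensor_group R M (left_part N))) (add_monoid (tensor_group R M (left_part N))) \<Longrightarrow> g \<in> hom (add_monoid (tensor_group R M (left_part N))) (add_monoid (tensor_group R M (left_part N))) \<Longrightarrow>
   (\<lambda>u. f u \<oplus>\<^bsub>tensor_group R M (left_part N)\<^esub> g u) \<in> hom (add_monoid (tensor_group R M (left_part N))) (add_monoid (tensor_group R M (left_part N)))"
  by (auto simp: hom_def Pi_def T.a_ac)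
lemma tensor_comp_hom: "f \<in> hom (add_monoid (tensor_group R M (left_part N))) (add_monoid (tensor_group R M (left_part N))) \<Longrightarrow> g \<in> hom (add_monoid (tensor_group R M (left_part N))) (add_monoid (tensor_group R M (left_part N))) \<Longrightarrow>
   (\<lambda>u. f (g u)) \<in> hom (add_monoid (tensor_group R M (left_part N))) (add_monoid (tensor_group R M (left_part N)))"
  by (auto simp: hom_def Pi_def)

lemmas tensor_endo_eqI = tensor_hom_eqI[OF ts.tensor_setting_axioms T.abelian_group_axioms]

lemma tensor_is_bimodule: "bimodule P S2 (bimodule_tensor R M N)"
proof -
  let ?B = "bimodule_tensor R M N"
  have ab: "abelian_group ?B" by (rule abelian_group_cong[OF T.abelian_group_axioms]) auto
  note ps = rsmult_pure_tensor lsmult_pure_tensor M.lsmult_closed N.rsmult_closed 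
  have cl: "x \<in> carrier M \<Longrightarrow> y \<in> carrier N \<Longrightarrow> pure_tensor R M (left_part N) x y \<in> carrier (tensor_group R M (left_part N))" for x y using pure_tensor_balanced by blast
  have 1: "u \<triangleleft>\<^bsub>?B\<^esub> (s \<oplus>\<^bsub>S2\<^esub> t) = (u \<triangleleft>\<^bsub>?B\<^esub> s) \<oplus>\<^bsub>tensor_group R M (left_part N)\<^esub> (u \<triangleleft>\<^bsub>?B\<^esub> t)" if "u \<in> carrier (tensor_group R M (left_part N))" "s \<in> carrier S2" "t \<in> carrier S2" for u s t
    by (insert that, rule tensor_endo_eqI[OF rsmult_tensor_hom tensor_add_hom[OF rsmult_tensor_hom rsmult_tensor_hom] _ that(1)], auto simp: ps N.rsmult_r_distr pure_tensor_balanced)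
  have 2: "u \<triangleleft>\<^bsub>?B\<^esub> (s \<otimes>\<^bsub>S2\<^esub> t) = (u \<triangleleft>\<^bsub>?B\<^esub> s) \<triangleleft>\<^bsub>?B\<^esub> t" if "u \<in> carrier (tensor_group R M (left_part N))" "s \<in> carrier S2" "t \<in> carrier S2" for u s t
    by (insert that, rule tensor_endo_eqI[OF rsmult_tensor_hom tensor_comp_hom[OF rsmult_tensor_hom rsmult_tensor_hom] _ that(1)], auto simp: ps N.rsmult_assoc pure_tensor_balanced)
  have 3: "u \<triangleleft>\<^bsub>?B\<^esub> \<one>\<^bsub>S2\<^esub> = u" if "u \<in> carrier (tensor_group R M (left_part N))" for u
    by (insert that, rule tensor_endo_eqI[OF rsmult_tensor_hom tensor_id_hom _ that(1)], auto simp: ps N.rsmult_one pure_tensor_balanced)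
  have 4: "(s \<oplus>\<^bsub>P\<^esub> t) \<triangleright>\<^bsub>?B\<^esub> u = (s \<triangleright>\<^bsub>?B\<^esub> u) \<oplus>\<^bsub>tensor_group R M (left_part N)\<^esub> (t \<triangleright>\<^bsub>?B\<^esub> u)" if "u \<in> carrier (tensor_group R M (left_part N))" "s \<in> carrier P" "t \<in> carrier P" for u s t
    by (insert that, rule tensor_endo_eqI[OF lsmult_tensor_hom tensor_add_hom[OF lsmult_tensor_hom lsmult_tensor_hom] _ that(1)], auto simp: ps M.lsmult_l_distr pure_tensor_balanced)
  have 5: "(s \<otimes>\<^bsub>P\<^esub> t) \<triangleright>\<^bsub>?B\<^esub> u = s \<triangleright>\<^bsub>?B\<^esub> t \<triangleright>\<^bsub>?B\<^esub> u" if "u \<in> carrier (tensor_group R M (left_part N))" "s \<in> carrier P" "t \<in> carrier P" for u s t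
    by (insert that, rule tensor_endo_eqI[OF lsmult_tensor_hom tensor_comp_hom[OF lsmult_tensor_hom lsmult_tensor_hom] _ that(1)], auto simp: ps M.lsmult_assoc pure_tensor_balanced)
  have 6: "\<one>\<^bsub>P\<^esub> \<triangleright>\<^bsub>?B\<^esub> u = u" if "u \<in> carrier (tensor_group R M (left_part N))" for u
    by (insert that, rule tensor_endo_eqI[OF lsmult_tensor_hom tensor_id_hom _ that(1)], auto simp: ps M.lsmult_one pure_tensor_balanced)
  have 7: "(r \<triangleright>\<^bsub>?B\<^esub> u) \<triangleleft>\<^bsub>?B\<^esub> s = r \<triangleright>\<^bsub>?B\<^esub> (u \<triangleleft>\<^bsub>?B\<^esub> s)" if "u \<in> carrier (tensor_group R M (left_part N))" "r \<in> carrier P" "s \<in> carrier S2" for u r s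
    by (insert that, rule tensor_endo_eqI[OF tensor_comp_hom[OF rsmult_tensor_hom lsmult_tensor_hom] tensor_comp_hom[OF lsmult_tensor_hom rsmult_tensor_hom] _ that(1)], auto simp: ps pure_tensor_balanced)
  have r: "u \<triangleleft>\<^bsub>?B\<^esub> s \<in> carrier (tensor_group R M (left_part N))" "(u \<oplus>\<^bsub>tensor_group R M (left_part N)\<^esub> v) \<triangleleft>\<^bsub>?B\<^esub> s = (u \<triangleleft>\<^bsub>?B\<^esub> s) \<oplus>\<^bsub>tensor_group R M (left_part N)\<^esub> (v \<triangleleft>\<^bsub>?B\<^esub> s)"
    if "u \<in> carrier (tensor_group R M (left_part N))" "v \<in> carrier (tensor_group R M (left_part N))" "s \<in> carrier S2" for u v s
    using rsmult_tensor_hom[OF that(3)] that by (auto simp: hom_def)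
  have l: "s \<triangleright>\<^bsub>?B\<^esub> u \<in> carrier (tensor_group R M (left_part N))" "s \<triangleright>\<^bsub>?B\<^esub> (u \<oplus>\<^bsub>tensor_group R M (left_part N)\<^esub> v) = (s \<triangleright>\<^bsub>?B\<^esub> u) \<oplus>\<^bsub>tensor_group R M (left_part N)\<^esub> (s \<triangleright>\<^bsub>?B\<^esub> v)"
    if "u \<in> carrier (tensor_group R M (left_part N))" "v \<in> carrier (tensor_group R M (left_part N))" "s \<in> carrier P" for u v s
    using lsmult_tensor_hom[OF that(3)] that by (auto simp: hom_def)
  show ?thesis
    by (intro bimodule.intro right_module.intro right_module_axioms.intro bimodule_axioms.intro ab
        M.R.ring_axioms N.S.ring_axioms) (auto simp: 1 2 3 4 5 6 7 r l)
qed

end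


section \<open>Well-definedness of \<open>T\<close>, \<open>Q\<close> and the canonical map\<close>

text \<open>
  The induced maps used in the definitions above satisfy the formulas they are meant to satisfy:
  \<open>sandwich_pure\<close>, \<open>T_is_ring\<close>, \<open>Q_is_right_module\<close>, \<open>Q_tensor_AA_actions\<close>, \<open>canonical_map_formula\<close>.
\<close>

locale ring_extension = A?: ring A for A :: "('a,'x) ring_scheme" (structure) +
  fixes B :: "'a set" assumes B: "subring B A"
begin
lemma B_subset: "B \<subseteq> carrier A" using subringE(1)[OF B] .
lemma regular: "bimodule A A (regular_bimodule A)" by (rule regular_is_bimodule[OF A.ring_axioms])
lemma AA_bimodule: "bimodule A A (AA A B)"
  unfolding AA_def by (rule tensor_is_bimodule[OF regular regular B_subset])
lemma AAA_bimodule: "bimodule A A (AAA A B)"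
  unfolding AAA_def by (rule tensor_is_bimodule[OF AA_bimodule regular B_subset])

sublocale AA: bimodule A A "AA A B" by (rule AA_bimodule)
sublocale AAA: bimodule A A "AAA A B" by (rule AAA_bimodule)

lemma tensor_setting_2: "tensor_setting (regular_bimodule A) (left_part (regular_bimodule A)) B"
  by (rule bimodule_tensor_setting[OF regular regular B_subset B_subset])
interpretation tensor_setting_2: tensor_setting "regular_bimodule A" "left_part (regular_bimodule A)" B by (rule tensor_setting_2)

lemma carrier_AA: "carrier (AA A B) = carrier (tensor_group B (regular_bimodule A) (left_part (regular_bimodule A)))"
  "add (AA A B) = add (tensor_group B (regular_bimodule A) (left_part (regular_bimodule A)))"
  "ring.zero (AA A B) = ring.zero (tensor_group B (regular_bimodule A) (left_part (regular_bimodule A)))"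
  by (simp_all add: AA_def)

lemma pure2_closed: "a \<in> carrier A \<Longrightarrow> a' \<in> carrier A \<Longrightarrow> pure2 A B a a' \<in> carrier (AA A B)"
  unfolding carrier_AA pure2_def using tensor_setting_2.pure_closed by simp

lemma pure2_l: "\<lbrakk>c \<in> carrier A; a \<in> carrier A; a' \<in> carrier A\<rbrakk> \<Longrightarrow> c \<triangleright>\<^bsub>AA A B\<^esub> pure2 A B a a' = pure2 A B (c \<otimes> a) a'"
  unfolding pure2_def AA_def using lsmult_pure_tensor[OF regular regular B_subset] by simp
lemma pure2_r: "\<lbrakk>c \<in> carrier A; a \<in> carrier A; a' \<in> carrier A\<rbrakk> \<Longrightarrow> pure2 A B a a' \<triangleleft>\<^bsub>AA A B\<^esub> c = pure2 A B a (a' \<otimes> c)"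
  unfolding pure2_def AA_def using rsmult_pure_tensor[OF regular regular B_subset] by simp

context
  fixes X :: "('a,'a,'m,'w) bimodule_scheme"
  assumes X: "bimodule A A X"
begin
interpretation X: bimodule A A X by (rule X)

lemma sandwich_balanced:
  assumes x: "x \<in> centralizer_in X B"
  shows "balanced B (regular_bimodule A) (left_part (regular_bimodule A)) X (\<lambda>a a'. (a \<triangleright>\<^bsub>X\<^esub> x) \<triangleleft>\<^bsub>X\<^esub> a')"
proof -
  have [simp]: "x \<in> carrier X" and c: "b \<in> B \<Longrightarrow> b \<triangleright>\<^bsub>X\<^esub> x = x \<triangleleft>\<^bsub>X\<^esub> b" for b
    using x by (auto simp: centralizer_in_def)
  have "((a \<otimes> b) \<triangleright>\<^bsub>X\<^esub> x) \<triangleleft>\<^bsub>X\<^esub> a' = (a \<triangleright>\<^bsub>X\<^esub> x) \<triangleleft>\<^bsub>X\<^esub> (b \<otimes> a')"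
    if "a \<in> carrier A" "b \<in> B" "a' \<in> carrier A" for a b a'
  proof -
    have b: "b \<in> carrier A" using that B_subset by auto
    have "(a \<otimes> b) \<triangleright>\<^bsub>X\<^esub> x = a \<triangleright>\<^bsub>X\<^esub> (x \<triangleleft>\<^bsub>X\<^esub> b)" using that b c by (simp add: X.lsmult_assoc)
    also have "\<dots> = (a \<triangleright>\<^bsub>X\<^esub> x) \<triangleleft>\<^bsub>X\<^esub> b" using that b by (simp add: X.lsmult_rsmult)
    finally show ?thesis using that b by (simp add: X.rsmult_assoc X.lsmult_closed)
  qed
  then show ?thesis
    by (auto simp: balanced_def X.lsmult_closed X.rsmult_closed X.lsmult_l_distr X.rsmult_l_distr X.rsmult_r_distr)
qed

lemma sandwich_pure: "\<lbrakk>x \<in> centralizer_in X B; a \<in> carrier A; a' \<in> carrier A\<rbrakk> \<Longrightarrow> sandwich X x (pure2 A B a a') = (a \<triangleright>\<^bsub>X\<^esub> x) \<triangleleft>\<^bsub>X\<^esub> a'"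
  unfolding sandwich_def pure2_def
  by (rule tensor_lift_pure[OF tensor_setting_2 X.M.abelian_group_axioms sandwich_balanced]) auto

lemma sandwich_hom: "x \<in> centralizer_in X B \<Longrightarrow> sandwich X x \<in> hom (add_monoid (AA A B)) (add_monoid X)"
  using tensor_lift_hom[OF tensor_setting_2 X.M.abelian_group_axioms sandwich_balanced]
  unfolding sandwich_def by (simp add: hom_def carrier_AA)

lemma AA_eqI:
  assumes "g \<in> hom (add_monoid (AA A B)) (add_monoid X)" "h \<in> hom (add_monoid (AA A B)) (add_monoid X)"
   "\<And>a a'. \<lbrakk>a \<in> carrier A; a' \<in> carrier A\<rbrakk> \<Longrightarrow> g (pure2 A B a a') = h (pure2 A B a a')"
   "u \<in> carrier (AA A B)"
  shows "g u = h u"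
  using tensor_hom_eqI[OF tensor_setting_2 X.M.abelian_group_axioms, of g h u] assms
  unfolding pure2_def by (simp add: hom_def carrier_AA)

end

lemma add_hom_compose: "g \<in> hom (add_monoid X) (add_monoid Y) \<Longrightarrow> f \<in> hom (add_monoid Y) (add_monoid Z) \<Longrightarrow>
   (\<lambda>u. f (g u)) \<in> hom (add_monoid X) (add_monoid Z)"
  by (auto simp: hom_def Pi_def)

lemma sandwich_l:
  assumes X: "bimodule A A X" and x: "x \<in> centralizer_in X B" and a: "a \<in> carrier A" and u: "u \<in> carrier (AA A B)"
  shows "sandwich X x (a \<triangleright>\<^bsub>AA A B\<^esub> u) = a \<triangleright>\<^bsub>X\<^esub> sandwich X x u"
proof -
  interpret X: bimodule A A X by fact
  have xc: "x \<in> carrier X" using x by (auto simp: centralizer_in_def)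
  show ?thesis
    by (rule AA_eqI[OF X add_hom_compose[OF _ sandwich_hom[OF X x]] add_hom_compose[OF sandwich_hom[OF X x]] _ u])
       (use a xc in \<open>auto simp: hom_def AA.lsmult_closed AA.lsmult_r_distr X.lsmult_closed X.lsmult_r_distr pure2_l sandwich_pure[OF X x] X.lsmult_assoc X.lsmult_rsmult\<close>)
qed

lemma sandwich_r:
  assumes X: "bimodule A A X" and x: "x \<in> centralizer_in X B" and a: "a \<in> carrier A" and u: "u \<in> carrier (AA A B)"
  shows "sandwich X x (u \<triangleleft>\<^bsub>AA A B\<^esub> a) = sandwich X x u \<triangleleft>\<^bsub>X\<^esub> a"
proof -
  interpret X: bimodule A A X by fact
  have xc: "x \<in> carrier X" using x by (auto simp: centralizer_in_def)
  show ?thesis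
    by (rule AA_eqI[OF X add_hom_compose[OF _ sandwich_hom[OF X x]] add_hom_compose[OF sandwich_hom[OF X x]] _ u])
       (use a xc in \<open>auto simp: hom_def AA.rsmult_closed AA.rsmult_l_distr X.rsmult_closed X.lsmult_closed X.rsmult_l_distr pure2_r sandwich_pure[OF X x] X.rsmult_assoc\<close>)
qed

lemma sandwich_central:
  assumes X: "bimodule A A X" and x: "x \<in> centralizer_in X B" and t: "t \<in> centralizer_in (AA A B) B"
  shows "sandwich X x t \<in> centralizer_in X B"
  unfolding centralizer_in_def
proof (intro CollectI conjI ballI)
  have tc: "t \<in> carrier (AA A B)" using t by (auto simp: centralizer_in_def)
  show "sandwich X x t \<in> carrier X" using hom_in_carrier[OF sandwich_hom[OF X x]] tc by simp
  fix b assume b: "b \<in> B" then have bA: "b \<in> carrier A" using B_subset by auto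
  have "b \<triangleright>\<^bsub>AA A B\<^esub> t = t \<triangleleft>\<^bsub>AA A B\<^esub> b" using t b by (auto simp: centralizer_in_def)
  then show "b \<triangleright>\<^bsub>X\<^esub> sandwich X x t = sandwich X x t \<triangleleft>\<^bsub>X\<^esub> b"
    using sandwich_l[OF X x bA tc] sandwich_r[OF X x bA tc] by simp
qed

lemma sandwich_assoc:
  assumes X: "bimodule A A X" and x: "x \<in> centralizer_in X B" and t: "t \<in> centralizer_in (AA A B) B"
    and u: "u \<in> carrier (AA A B)"
  shows "sandwich X (sandwich X x t) u = sandwich X x (sandwich (AA A B) t u)"
proof -
  have tc: "t \<in> carrier (AA A B)" using t by (auto simp: centralizer_in_def)
  show ?thesis
    by (rule AA_eqI[OF X sandwich_hom[OF X sandwich_central[OF X x t]] 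
      add_hom_compose[OF sandwich_hom[OF AA_bimodule t] sandwich_hom[OF X x]] _ u])
     (auto simp: sandwich_pure[OF X sandwich_central[OF X x t]] sandwich_pure[OF AA_bimodule t]
       sandwich_r[OF X x] sandwich_l[OF X x] AA.lsmult_closed tc)
qed

lemma sandwich_one: 
  assumes X: "bimodule A A X" and x: "x \<in> centralizer_in X B"
  shows "sandwich X x (pure2 A B \<one> \<one>) = x"
proof -
  interpret X: bimodule A A X by fact
  have xc: "x \<in> carrier X" using x by (auto simp: centralizer_in_def)
  then show ?thesis using sandwich_pure[OF X x] by (simp add: X.lsmult_one X.rsmult_one)
qed

lemma sandwich_add: 
  assumes X: "bimodule A A X" and x: "x \<in> centralizer_in X B" and y: "y \<in> centralizer_in X B" 
   and s: "x \<oplus>\<^bsub>X\<^esub> y \<in> centralizer_in X B"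
   and u: "u \<in> carrier (AA A B)"
  shows "sandwich X (x \<oplus>\<^bsub>X\<^esub> y) u = sandwich X x u \<oplus>\<^bsub>X\<^esub> sandwich X y u"
proof -
  interpret X: bimodule A A X by fact
  have xc: "x \<in> carrier X" "y \<in> carrier X" using x y by (auto simp: centralizer_in_def)
  have h: "(\<lambda>u. sandwich X x u \<oplus>\<^bsub>X\<^esub> sandwich X y u) \<in> hom (add_monoid (AA A B)) (add_monoid X)"
    using sandwich_hom[OF X x] sandwich_hom[OF X y] by (auto simp: hom_def Pi_def X.M.a_ac)
  show ?thesis
    by (rule AA_eqI[OF X sandwich_hom[OF X s] h _ u])
     (use xc in \<open>auto simp: sandwich_pure[OF X] x y s X.lsmult_r_distr X.rsmult_l_distr X.lsmult_closed\<close>)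
qed

lemma centralizer_add:
  assumes X: "bimodule A A X" and x: "x \<in> centralizer_in X B" and y: "y \<in> centralizer_in X B"
  shows "x \<oplus>\<^bsub>X\<^esub> y \<in> centralizer_in X B"
proof -
  interpret X: bimodule A A X by fact
  show ?thesis using x y B_subset by (auto simp: centralizer_in_def X.lsmult_r_distr X.rsmult_l_distr subset_iff)
qed

lemma centralizer_subgroup:
  assumes X: "bimodule A A X" 
  shows "subgroup (centralizer_in X B) (add_monoid X)"
proof -
  interpret X: bimodule A A X by fact
  have lm: "a \<triangleright>\<^bsub>X\<^esub> (\<ominus>\<^bsub>X\<^esub> x) = \<ominus>\<^bsub>X\<^esub> (a \<triangleright>\<^bsub>X\<^esub> x)" "a \<triangleright>\<^bsub>X\<^esub> \<zero>\<^bsub>X\<^esub> = \<zero>\<^bsub>X\<^esub>" if "a \<in> carrier A" "x \<in> carrier X" for a x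
  proof -
    interpret h: abelian_group_hom X X "\<lambda>x. a \<triangleright>\<^bsub>X\<^esub> x"
      by (intro abelian_group_homI X.M.abelian_group_axioms group_hom.intro X.M.a_group group_hom_axioms.intro homI)
        (use that in \<open>auto simp: X.lsmult_closed X.lsmult_r_distr\<close>)
    show "a \<triangleright>\<^bsub>X\<^esub> (\<ominus>\<^bsub>X\<^esub> x) = \<ominus>\<^bsub>X\<^esub> (a \<triangleright>\<^bsub>X\<^esub> x)" "a \<triangleright>\<^bsub>X\<^esub> \<zero>\<^bsub>X\<^esub> = \<zero>\<^bsub>X\<^esub>" using that by auto
  qed
  have rm: "(\<ominus>\<^bsub>X\<^esub> x) \<triangleleft>\<^bsub>X\<^esub> a = \<ominus>\<^bsub>X\<^esub> (x \<triangleleft>\<^bsub>X\<^esub> a)" "\<zero>\<^bsub>X\<^esub> \<triangleleft>\<^bsub>X\<^esub> a = \<zero>\<^bsub>X\<^esub>" if "a \<in> carrier A" "x \<in> carrier X" for a x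
  proof -
    interpret h: abelian_group_hom X X "\<lambda>x. x \<triangleleft>\<^bsub>X\<^esub> a"
      by (intro abelian_group_homI X.M.abelian_group_axioms group_hom.intro X.M.a_group group_hom_axioms.intro homI)
        (use that in \<open>auto simp: X.rsmult_closed X.rsmult_l_distr\<close>)
    show "(\<ominus>\<^bsub>X\<^esub> x) \<triangleleft>\<^bsub>X\<^esub> a = \<ominus>\<^bsub>X\<^esub> (x \<triangleleft>\<^bsub>X\<^esub> a)" "\<zero>\<^bsub>X\<^esub> \<triangleleft>\<^bsub>X\<^esub> a = \<zero>\<^bsub>X\<^esub>" using that by auto
  qed
  show ?thesis
  proof (rule group.subgroupI[OF X.M.a_group])
    show "centralizer_in X B \<noteq> {}" using lm(2)[OF _ X.M.zero_closed] rm(2)[OF _ X.M.zero_closed] B_subset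
      by (auto simp: centralizer_in_def intro!: exI[of _ "\<zero>\<^bsub>X\<^esub>"])
    show "inv\<^bsub>add_monoid X\<^esub> x \<in> centralizer_in X B" if "x \<in> centralizer_in X B" for x
      using that lm(1) rm(1) B_subset by (auto simp: centralizer_in_def subset_iff simp flip: a_inv_def)
    show "x \<otimes>\<^bsub>add_monoid X\<^esub> y \<in> centralizer_in X B" if "x \<in> centralizer_in X B" "y \<in> centralizer_in X B" for x y
      using centralizer_add[OF X that] by simp
  qed (auto simp: centralizer_in_def)
qed

lemma centralizer_abelian_group:
  assumes X: "bimodule A A X" and "carrier H = centralizer_in X B" "ring.zero H = ring.zero X" "add H = add X"
  shows "abelian_group H"
proof (rule abelian_groupI)
  interpret X: bimodule A A X by fact
  note g = centralizer_subgroup[OF X]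
  have c: "x \<in> carrier X" if "x \<in> centralizer_in X B" for x using that by (auto simp: centralizer_in_def)
  fix x assume x: "x \<in> carrier H"
  show "\<zero>\<^bsub>H\<^esub> \<oplus>\<^bsub>H\<^esub> x = x" using x assms c by auto
  show "\<exists>y\<in>carrier H. y \<oplus>\<^bsub>H\<^esub> x = \<zero>\<^bsub>H\<^esub>"
    using subgroup.m_inv_closed[OF g, of x] x assms c[of x] X.M.l_neg[of x] by (auto simp flip: a_inv_def)
next
  interpret X: bimodule A A X by fact
  note g = centralizer_subgroup[OF X]
  show "\<zero>\<^bsub>H\<^esub> \<in> carrier H" using subgroup.one_closed[OF g] assms by simp
  have c: "x \<in> carrier X" if "x \<in> centralizer_in X B" for x using that by (auto simp: centralizer_in_def)
  fix x y assume "x \<in> carrier H" "y \<in> carrier H"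
  then show "x \<oplus>\<^bsub>H\<^esub> y \<in> carrier H" "x \<oplus>\<^bsub>H\<^esub> y = y \<oplus>\<^bsub>H\<^esub> x" using centralizer_add[OF X] assms c X.M.a_comm by auto
  fix z assume "x \<in> carrier H" "y \<in> carrier H" "z \<in> carrier H"
  then show "x \<oplus>\<^bsub>H\<^esub> y \<oplus>\<^bsub>H\<^esub> z = x \<oplus>\<^bsub>H\<^esub> (y \<oplus>\<^bsub>H\<^esub> z)" using assms c X.M.a_assoc by auto
qed

lemma pure2_one_central: "pure2 A B \<one> \<one> \<in> centralizer_in (AA A B) B"
proof -
  have "pure2 A B b \<one> = pure2 A B \<one> b" if "b \<in> B" for b
  proof -
    have "pure2 A B (\<one> \<otimes> b) \<one> = pure2 A B \<one> (b \<otimes> \<one>)"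
      using pure_balanced[OF tensor_setting_2] that unfolding balanced_def pure2_def by simp
    then show ?thesis using that B_subset by auto
  qed
  then show ?thesis using B_subset by (auto simp: centralizer_in_def pure2_closed pure2_l pure2_r subset_iff)
qed

lemma sandwich_add_right: "\<lbrakk>bimodule A A X; x \<in> centralizer_in X B; u \<in> carrier (AA A B); v \<in> carrier (AA A B)\<rbrakk> \<Longrightarrow> sandwich X x (u \<oplus>\<^bsub>AA A B\<^esub> v) = sandwich X x u \<oplus>\<^bsub>X\<^esub> sandwich X x v"
  using hom_mult[OF sandwich_hom] by fastforce

theorem T_is_ring: "ring (T_ring A B)"
proof -
  have c: "x \<in> carrier (AA A B)" if "x \<in> centralizer_in (AA A B) B" for x using that by (auto simp: centralizer_in_def)
  have cc: "x \<in> centralizer_in (AAA A B) B \<Longrightarrow> x \<in> carrier (AAA A B)" for x by (auto simp: centralizer_in_def)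
  have "abelian_group (T_ring A B)" by (rule centralizer_abelian_group[OF AA_bimodule]) (auto simp: T_ring_def)
  moreover have "sandwich (AA A B) (pure2 A B \<one> \<one>) t = t" if "t \<in> centralizer_in (AA A B) B" for t
    by (rule AA_eqI[OF AA_bimodule sandwich_hom[OF AA_bimodule pure2_one_central] _ _ c[OF that]])
      (auto simp: hom_def sandwich_pure[OF AA_bimodule pure2_one_central] pure2_l pure2_r)
  ultimately show ?thesis
    by (intro ringI monoidI)
       (auto simp: T_ring_def sandwich_central[OF AA_bimodule] pure2_one_central
         sandwich_assoc[OF AA_bimodule] sandwich_one[OF AA_bimodule] sandwich_add[OF AA_bimodule] centralizer_add[OF AA_bimodule] sandwich_add_right[OF AA_bimodule] c)
qed

theorem Q_is_right_module: "right_module (T_ring A B) (Q_module A B)"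
proof -
  have c: "x \<in> carrier (AA A B)" if "x \<in> centralizer_in (AA A B) B" for x using that by (auto simp: centralizer_in_def)
  have "abelian_group (Q_module A B)" by (rule centralizer_abelian_group[OF AAA_bimodule]) (auto simp: Q_module_def)
  then show ?thesis
    by (intro right_module.intro right_module_axioms.intro T_is_ring)
       (auto simp: Q_module_def T_ring_def sandwich_central[OF AAA_bimodule] pure2_one_central
         sandwich_assoc[OF AAA_bimodule] sandwich_one[OF AAA_bimodule] sandwich_add[OF AAA_bimodule] centralizer_add[OF AAA_bimodule] sandwich_add_right[OF AAA_bimodule] c)
qed

lemma tensor_setting_Q: "tensor_setting (Q_module A B) (AA_left_T A B) (carrier (T_ring A B))"
proof -
  interpret Q: right_module "T_ring A B" "Q_module A B" by (rule Q_is_right_module)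
  have "abelian_group (AA_left_T A B)"
    by (rule abelian_group_cong[OF AA.M.abelian_group_axioms]) (auto simp: AA_left_T_def)
  then show ?thesis
    by (intro tensor_setting.intro tensor_setting_axioms.intro Q.M.abelian_group_axioms Q.rsmult_closed)
      (auto simp: AA_left_T_def T_ring_def hom_in_carrier[OF sandwich_hom[OF AA_bimodule], simplified])
qed

lemma canonical_balanced: "balanced (carrier (T_ring A B)) (Q_module A B) (AA_left_T A B) (AAA A B) (sandwich (AAA A B))"
  unfolding balanced_def
  by (auto simp: Q_module_def T_ring_def AA_left_T_def sandwich_add[OF AAA_bimodule] centralizer_add[OF AAA_bimodule] sandwich_add_right[OF AAA_bimodule]
     sandwich_assoc[OF AAA_bimodule] hom_in_carrier[OF sandwich_hom[OF AAA_bimodule], simplified])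

theorem canonical_map_formula:
  assumes "q \<in> carrier (Q_module A B)" "a \<in> carrier A" "a' \<in> carrier A"
  shows "canonical_map A B (pure_tensor (carrier (T_ring A B)) (Q_module A B) (AA_left_T A B) q (pure2 A B a a'))
    = (a \<triangleright>\<^bsub>AAA A B\<^esub> q) \<triangleleft>\<^bsub>AAA A B\<^esub> a'"
proof -
  have "q \<in> centralizer_in (AAA A B) B" using assms by (simp add: Q_module_def)
  moreover have "pure2 A B a a' \<in> carrier (AA_left_T A B)" using assms pure2_closed by (simp add: AA_left_T_def)
  ultimately show ?thesis
    unfolding canonical_map_def 
    using tensor_lift_pure[OF tensor_setting_Q AAA.M.abelian_group_axioms canonical_balanced assms(1)] sandwich_pure[OF AAA_bimodule] assms
    by simp
qed

lemma Q_tensor_AA_balanced: 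
  assumes "c \<in> carrier A"
  defines "G \<equiv> tensor_group (carrier (T_ring A B)) (Q_module A B) (AA_left_T A B)"
  defines "p \<equiv> pure_tensor (carrier (T_ring A B)) (Q_module A B) (AA_left_T A B)"
  shows "balanced (carrier (T_ring A B)) (Q_module A B) (AA_left_T A B) G (\<lambda>q u. p q (u \<triangleleft>\<^bsub>AA A B\<^esub> c))"
    and "balanced (carrier (T_ring A B)) (Q_module A B) (AA_left_T A B) G (\<lambda>q u. p q (c \<triangleright>\<^bsub>AA A B\<^esub> u))"
proof -
  note b = pure_balanced[OF tensor_setting_Q, folded G_def p_def, unfolded balanced_def AA_left_T_def T_ring_def, simplified]
  show "balanced (carrier (T_ring A B)) (Q_module A B) (AA_left_T A B) G (\<lambda>q u. p q (u \<triangleleft>\<^bsub>AA A B\<^esub> c))"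
    and "balanced (carrier (T_ring A B)) (Q_module A B) (AA_left_T A B) G (\<lambda>q u. p q (c \<triangleright>\<^bsub>AA A B\<^esub> u))"
    unfolding balanced_def AA_left_T_def T_ring_def
    using b assms(1) by (auto simp: AA.rsmult_closed AA.lsmult_closed AA.rsmult_l_distr AA.lsmult_r_distr 
      simp flip: sandwich_r[OF AA_bimodule] sandwich_l[OF AA_bimodule])
qed

theorem Q_tensor_AA_actions:
  assumes "c \<in> carrier A" "q \<in> carrier (Q_module A B)" "u \<in> carrier (AA A B)"
  defines "p \<equiv> pure_tensor (carrier (T_ring A B)) (Q_module A B) (AA_left_T A B)"
  shows "p q u \<triangleleft>\<^bsub>Q_tensor_AA A B\<^esub> c = p q (u \<triangleleft>\<^bsub>AA A B\<^esub> c)"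
   "c \<triangleright>\<^bsub>Q_tensor_AA A B\<^esub> p q u = p q (c \<triangleright>\<^bsub>AA A B\<^esub> u)"
proof -
  interpret tensor_setting "Q_module A B" "AA_left_T A B" "carrier (T_ring A B)" by (rule tensor_setting_Q)
  have u: "u \<in> carrier (AA_left_T A B)" using assms by (simp add: AA_left_T_def)
  show "p q u \<triangleleft>\<^bsub>Q_tensor_AA A B\<^esub> c = p q (u \<triangleleft>\<^bsub>AA A B\<^esub> c)"
   "c \<triangleright>\<^bsub>Q_tensor_AA A B\<^esub> p q u = p q (c \<triangleright>\<^bsub>AA A B\<^esub> u)"
    using tensor_lift_pure[OF tensor_setting_Q tensor_abelian_group Q_tensor_AA_balanced(1)[OF assms(1)] assms(2) u]
     tensor_lift_pure[OF tensor_setting_Q tensor_abelian_group Q_tensor_AA_balanced(2)[OF assms(1)] assms(2) u]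
    by (simp_all add: Q_tensor_AA_def Let_def p_def)
qed

end

end

theory Submission
  imports Defs
begin

text \<open>
  Write \<open>q \<cdot> u\<close> for the element \<^term>\<open>sandwich (AAA A B) q u\<close>, where \<open>q \<in> Q\<close> and \<open>u \<in> A \<otimes>\<^sub>B A\<close>; thus
  \<open>q \<cdot> (a \<otimes> a') = a q a'\<close>. The proof reduces both sides of the equivalence to the existence of a finite
  dual basis.

  A bimodule homomorphism \<open>A \<otimes>\<^sub>B A \<rightarrow> A \<otimes>\<^sub>B A \<otimes>\<^sub>B A\<close> is determined by the image of \<open>1 \<otimes> 1\<close>, hence it is
  \<open>u \<mapsto> q \<cdot> u\<close> for a unique \<open>q \<in> Q\<close> (\<open>bimodule_hom_from_AA\<close>). Since a summand of a power is the same as a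
  factorization of the identity (\<open>iso_to_summand_of_power_iff\<close>), H-depth 3 means that there are finitely many
  elements \<open>q\<^sub>i \<in> Q\<close> and bimodule homomorphisms \<open>f\<^sub>i\<close> from \<open>A \<otimes>\<^sub>B A \<otimes>\<^sub>B A\<close> to \<open>A \<otimes>\<^sub>B A\<close> with
  \<open>x = \<Sum>\<^sub>i q\<^sub>i \<cdot> f\<^sub>i x\<close> for all \<open>x\<close> (\<open>H_depth_3_iff\<close>). On the other side, \<open>Q\<close> is finitely generated projective
  over \<open>T\<close> if and only if there are \<open>q\<^sub>i \<in> Q\<close> and \<open>T\<close>-linear maps \<open>\<phi>\<^sub>i : Q \<rightarrow> T\<close> with
  \<open>x = \<Sum>\<^sub>i q\<^sub>i \<cdot> \<phi>\<^sub>i x\<close> for all \<open>x \<in> Q\<close> (\<open>finite_projective_of_dual_basis\<close>,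
  \<open>dual_basis_of_finite_projective\<close>).

  Restricting the \<open>f\<^sub>i\<close> to the elements centralizing \<open>B\<close> turns the first kind of data into the second
  (\<open>dual_basis_of_depth_3\<close>), and \<open>x \<mapsto> \<Sum>\<^sub>i q\<^sub>i \<otimes> f\<^sub>i x\<close> inverts the canonical map
  (\<open>canonical_map_iso_of_depth_3\<close>). Conversely the \<open>\<phi>\<^sub>i\<close> induce maps
  \<open>q \<otimes> u \<mapsto> \<phi>\<^sub>i q \<cdot> u\<close> on \<open>Q \<otimes>\<^sub>T (A \<otimes>\<^sub>B A)\<close>, and if the canonical map is an isomorphism they can be
  transported to the required \<open>f\<^sub>i\<close> (\<open>depth_3_of_dual_basis\<close>).
\<close>

section \<open>Direct summands as retracts\<close>

lemma abelian_group_hom_of_hom: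
  assumes "abelian_group X" "abelian_group Y" "h \<in> hom (add_monoid X) (add_monoid Y)"
  shows "abelian_group_hom X Y h"
  using assms
  by (intro abelian_group_homI group_hom.intro group_hom_axioms.intro abelian_group.a_group)

lemma retract_internal_direct_sum:
  assumes X: "abelian_group X" and M: "abelian_group M"
    and F: "F \<in> hom (add_monoid X) (add_monoid M)" and P: "P \<in> hom (add_monoid M) (add_monoid X)"
    and PF: "\<And>x. x \<in> carrier X \<Longrightarrow> P (F x) = x"
  shows "subgroup (F ` carrier X) (add_monoid M)"
    and "subgroup {y \<in> carrier M. P y = \<zero>\<^bsub>X\<^esub>} (add_monoid M)"
    and "internal_direct_sum M (F ` carrier X) {y \<in> carrier M. P y = \<zero>\<^bsub>X\<^esub>}"
    and "bij_betw F (carrier X) (F ` carrier X)"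
proof -
  interpret X: abelian_group X by (rule X)
  interpret M: abelian_group M by (rule M)
  interpret F: abelian_group_hom X M F by (rule abelian_group_hom_of_hom[OF X M F])
  interpret P: abelian_group_hom M X P by (rule abelian_group_hom_of_hom[OF M X P])
  show "subgroup (F ` carrier X) (add_monoid M)"
    using F.a_group_hom group_hom.img_is_subgroup by fastforce
  show "subgroup {y \<in> carrier M. P y = \<zero>\<^bsub>X\<^esub>} (add_monoid M)"
    using group_hom.subgroup_kernel[OF P.a_group_hom] by (simp add: kernel_def)
  show "bij_betw F (carrier X) (F ` carrier X)"
    using PF by (auto intro: inj_on_inverseI simp: bij_betw_def)
  show "internal_direct_sum M (F ` carrier X) {y \<in> carrier M. P y = \<zero>\<^bsub>X\<^esub>}"
    unfolding internal_direct_sum_def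
  proof (intro conjI equalityI subsetI)
    fix y assume y: "y \<in> carrier M"
    have "y = F (P y) \<oplus>\<^bsub>M\<^esub> (y \<ominus>\<^bsub>M\<^esub> F (P y))"
      using y by (simp add: a_minus_def M.a_lcomm[of "F (P y)" y] M.r_neg)
    moreover have "P (y \<ominus>\<^bsub>M\<^esub> F (P y)) = \<zero>\<^bsub>X\<^esub>"
      using y by (simp add: a_minus_def PF X.r_neg)
    moreover have "y \<ominus>\<^bsub>M\<^esub> F (P y) \<in> carrier M" "P y \<in> carrier X" using y by simp_all
    ultimately show "y \<in> F ` carrier X <+>\<^bsub>M\<^esub> {y \<in> carrier M. P y = \<zero>\<^bsub>X\<^esub>}"
      unfolding set_add_def' by blast
  next
    fix y assume "y \<in> F ` carrier X <+>\<^bsub>M\<^esub> {y \<in> carrier M. P y = \<zero>\<^bsub>X\<^esub>}"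
    then show "y \<in> carrier M" by (auto simp: set_add_def')
  qed (auto simp: PF image_iff intro!: bexI[of _ "\<zero>\<^bsub>X\<^esub>"])
qed

text \<open>
  The projection commutes with every endomorphism that preserves both summands. Having this for all
  such endomorphisms at once is what makes the projection linear for any action under which the
  summands are stable, whether it comes from one side or from both.
\<close>

lemma internal_direct_sum_projection:
  assumes M: "abelian_group M"
    and N: "subgroup N (add_monoid M)" and N': "subgroup N' (add_monoid M)"
    and ds: "internal_direct_sum M N N'"
  shows "\<exists>p \<in> hom (add_monoid M) (add_monoid M).
    (\<forall>y\<in>carrier M. p y \<in> N) \<and> (\<forall>n\<in>N. p n = n) \<and>
    (\<forall>e \<in> hom (add_monoid M) (add_monoid M). e ` N \<subseteq> N \<and> e ` N' \<subseteq> N' \<longrightarrow>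
      (\<forall>y\<in>carrier M. p (e y) = e (p y)))"
proof -
  interpret M: abelian_group M by (rule M)
  have cl: "n \<in> carrier M" if "n \<in> N \<or> n \<in> N'" for n
    using that subgroup.subset[OF N] subgroup.subset[OF N'] by auto
  define p where "p y = (THE n. n \<in> N \<and> (\<exists>n'\<in>N'. y = n \<oplus>\<^bsub>M\<^esub> n'))" for y
  have unique: "n = k" if "n \<in> N" "n' \<in> N'" "k \<in> N" "k' \<in> N'" "n \<oplus>\<^bsub>M\<^esub> n' = k \<oplus>\<^bsub>M\<^esub> k'" for n n' k k'
  proof -
    note c = cl[of n] cl[of n'] cl[of k] cl[of k']
    have "n \<ominus>\<^bsub>M\<^esub> k = k' \<ominus>\<^bsub>M\<^esub> n'"
    proof -
      have "n \<ominus>\<^bsub>M\<^esub> k = (n \<oplus>\<^bsub>M\<^esub> n') \<ominus>\<^bsub>M\<^esub> n' \<ominus>\<^bsub>M\<^esub> k" using that(1-4) c by (simp add: a_minus_def M.a_assoc M.r_neg)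
      also have "\<dots> = k' \<ominus>\<^bsub>M\<^esub> n'"
            unfolding that(5) using that(1-4) c
        by (simp add: a_minus_def M.a_ac M.r_neg2 M.a_lcomm[of k] M.a_lcomm[of "\<ominus>\<^bsub>M\<^esub> k"])
      finally show ?thesis .
    qed
    moreover have "n \<ominus>\<^bsub>M\<^esub> k \<in> N" "k' \<ominus>\<^bsub>M\<^esub> n' \<in> N'"
      using that subgroup.m_closed[OF N, of n "\<ominus>\<^bsub>M\<^esub> k"] subgroup.m_inv_closed[OF N, of k]
        subgroup.m_closed[OF N', of k' "\<ominus>\<^bsub>M\<^esub> n'"] subgroup.m_inv_closed[OF N', of n']
      by (simp_all add: a_minus_def a_inv_def)
    ultimately have "n \<ominus>\<^bsub>M\<^esub> k = \<zero>\<^bsub>M\<^esub>" using ds by (auto simp: internal_direct_sum_def)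
    moreover have "n = (n \<ominus>\<^bsub>M\<^esub> k) \<oplus>\<^bsub>M\<^esub> k" using that(1-4) c by (simp add: a_minus_def M.a_assoc M.l_neg)
    ultimately show ?thesis using that(3) c by simp
  qed
  have p: "p (n \<oplus>\<^bsub>M\<^esub> n') = n" if "n \<in> N" "n' \<in> N'" for n n'
    unfolding p_def using that unique by (intro the_equality) blast+
  have decomp: "\<exists>n\<in>N. \<exists>n'\<in>N'. y = n \<oplus>\<^bsub>M\<^esub> n'" if "y \<in> carrier M" for y
    using that ds unfolding internal_direct_sum_def set_add_def' by blast
  show ?thesis
  proof (intro bexI[of _ p] conjI ballI impI)
    show pN: "p y \<in> N" if "y \<in> carrier M" for y using decomp[OF that] p by auto
    show "p n = n" if "n \<in> N" for n
      using p[OF that, of "\<zero>\<^bsub>M\<^esub>"] subgroup.one_closed[OF N'] that cl by simp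
    show "p \<in> hom (add_monoid M) (add_monoid M)"
    proof (rule homI; simp)
      fix x y assume "x \<in> carrier M" "y \<in> carrier M"
      then obtain n n' k k' where *: "n \<in> N" "n' \<in> N'" "x = n \<oplus>\<^bsub>M\<^esub> n'" "k \<in> N" "k' \<in> N'" "y = k \<oplus>\<^bsub>M\<^esub> k'"
        using decomp by meson
      then have "x \<oplus>\<^bsub>M\<^esub> y = (n \<oplus>\<^bsub>M\<^esub> k) \<oplus>\<^bsub>M\<^esub> (n' \<oplus>\<^bsub>M\<^esub> k')" using cl by (simp add: M.a_ac)
      moreover have "n \<oplus>\<^bsub>M\<^esub> k \<in> N" "n' \<oplus>\<^bsub>M\<^esub> k' \<in> N'"
        using * subgroup.m_closed[OF N] subgroup.m_closed[OF N'] by auto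
      ultimately show "p (x \<oplus>\<^bsub>M\<^esub> y) = p x \<oplus>\<^bsub>M\<^esub> p y" using * p by simp
    qed (use pN cl in auto)
    fix e y assume e: "e \<in> hom (add_monoid M) (add_monoid M)" "e ` N \<subseteq> N \<and> e ` N' \<subseteq> N'"
      and y: "y \<in> carrier M"
    obtain n n' where *: "n \<in> N" "n' \<in> N'" "y = n \<oplus>\<^bsub>M\<^esub> n'" using decomp[OF y] by blast
    then have "e y = e n \<oplus>\<^bsub>M\<^esub> e n'" using hom_mult[OF e(1), of n n'] cl by simp
    then show "p (e y) = e (p y)" using * e(2) p by (simp add: image_subset_iff)
  qed
qed

lemma (in right_module) rsmult_hom:
  "s \<in> carrier S \<Longrightarrow> (\<lambda>x. x \<triangleleft>\<^bsub>M\<^esub> s) \<in> hom (add_monoid M) (add_monoid M)"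
  by (auto simp: hom_def rsmult_closed rsmult_l_distr)

lemma (in right_module) rsmult_zero_left:
  assumes "s \<in> carrier S" shows "\<zero>\<^bsub>M\<^esub> \<triangleleft>\<^bsub>M\<^esub> s = \<zero>\<^bsub>M\<^esub>"
  using abelian_group_hom.hom_zero[OF abelian_group_hom_of_hom[OF _ _ rsmult_hom[OF assms]]]
    M.abelian_group_axioms by blast

lemma (in bimodule) lsmult_hom:
  "r \<in> carrier R \<Longrightarrow> (\<lambda>x. r \<triangleright>\<^bsub>M\<^esub> x) \<in> hom (add_monoid M) (add_monoid M)"
  by (auto simp: hom_def lsmult_closed lsmult_r_distr)

lemma (in bimodule) lsmult_zero_right:
  assumes "r \<in> carrier R" shows "r \<triangleright>\<^bsub>M\<^esub> \<zero>\<^bsub>M\<^esub> = \<zero>\<^bsub>M\<^esub>"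
  using abelian_group_hom.hom_zero[OF abelian_group_hom_of_hom[OF _ _ lsmult_hom[OF assms]]]
    M.abelian_group_axioms by blast

text \<open>
  Right modules and bimodules are both abelian groups with a family of operators: the scalars of the
  ring, respectively the disjoint union of the scalars acting on the left and on the right. Summands
  are compared with retracts in this common setting, for operators \<open>\<alpha> \<omega>\<close> on the source and
  \<open>\<beta> \<omega>\<close> on the target.
\<close>

definition equivariant_hom where
  "equivariant_hom \<Omega> \<alpha> \<beta> X M = {h \<in> hom (add_monoid X) (add_monoid M).
     \<forall>\<omega>\<in>\<Omega>. \<forall>x\<in>carrier X. h (\<alpha> \<omega> x) = \<beta> \<omega> (h x)}"

text \<open>
  From a retraction \<open>P \<circ> F = id\<close> the complement of the image of \<open>F\<close> is the kernel of \<open>P\<close>; from a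
  decomposition \<open>P\<close> is the projection followed by the inverse of the isomorphism onto the summand.
\<close>

lemma stable_summand_iff_retract:
  assumes X: "abelian_group X" and M: "abelian_group M"
    and \<alpha>: "\<And>\<omega>. \<omega> \<in> \<Omega> \<Longrightarrow> \<alpha> \<omega> \<in> hom (add_monoid X) (add_monoid X)"
    and \<beta>: "\<And>\<omega>. \<omega> \<in> \<Omega> \<Longrightarrow> \<beta> \<omega> \<in> hom (add_monoid M) (add_monoid M)"
  shows "(\<exists>N N'. subgroup N (add_monoid M) \<and> (\<forall>\<omega>\<in>\<Omega>. \<forall>y\<in>N. \<beta> \<omega> y \<in> N) \<and>
      subgroup N' (add_monoid M) \<and> (\<forall>\<omega>\<in>\<Omega>. \<forall>y\<in>N'. \<beta> \<omega> y \<in> N') \<and> internal_direct_sum M N N' \<and>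
      (\<exists>h\<in>equivariant_hom \<Omega> \<alpha> \<beta> X (M\<lparr>carrier := N\<rparr>). bij_betw h (carrier X) N)) \<longleftrightarrow>
    (\<exists>F\<in>equivariant_hom \<Omega> \<alpha> \<beta> X M. \<exists>P\<in>equivariant_hom \<Omega> \<beta> \<alpha> M X. \<forall>x\<in>carrier X. P (F x) = x)"
    (is "?summand \<longleftrightarrow> ?retract")
proof
  assume ?retract
  then obtain F P where F: "F \<in> equivariant_hom \<Omega> \<alpha> \<beta> X M" and P: "P \<in> equivariant_hom \<Omega> \<beta> \<alpha> M X"
    and PF: "\<And>x. x \<in> carrier X \<Longrightarrow> P (F x) = x" by blast
  have Fh: "F \<in> hom (add_monoid X) (add_monoid M)" and Ph: "P \<in> hom (add_monoid M) (add_monoid X)"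
    using F P by (auto simp: equivariant_hom_def)
  let ?N = "F ` carrier X" and ?N' = "{y \<in> carrier M. P y = \<zero>\<^bsub>X\<^esub>}"
  have closed: "\<alpha> \<omega> x \<in> carrier X" if "\<omega> \<in> \<Omega>" "x \<in> carrier X" for \<omega> x
    using hom_in_carrier[OF \<alpha>[OF that(1)]] that by simp
  have "\<beta> \<omega> (F x) \<in> ?N" if "\<omega> \<in> \<Omega>" "x \<in> carrier X" for \<omega> x
    using F that closed by (force simp: equivariant_hom_def)
  then have N: "\<forall>\<omega>\<in>\<Omega>. \<forall>y\<in>?N. \<beta> \<omega> y \<in> ?N" by blast
  have "\<alpha> \<omega> \<zero>\<^bsub>X\<^esub> = \<zero>\<^bsub>X\<^esub>" if "\<omega> \<in> \<Omega>" for \<omega>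
    by (rule abelian_group_hom.hom_zero[OF abelian_group_hom_of_hom[OF X X \<alpha>[OF that]]])
  then have N': "\<forall>\<omega>\<in>\<Omega>. \<forall>y\<in>?N'. \<beta> \<omega> y \<in> ?N'"
    using P hom_in_carrier[OF \<beta>] by (auto simp: equivariant_hom_def)
  note split = retract_internal_direct_sum[OF X M Fh Ph PF]
  have "F \<in> equivariant_hom \<Omega> \<alpha> \<beta> X (M\<lparr>carrier := ?N\<rparr>)"
    using F by (auto simp: equivariant_hom_def hom_def)
  with split(4) have "\<exists>h\<in>equivariant_hom \<Omega> \<alpha> \<beta> X (M\<lparr>carrier := ?N\<rparr>). bij_betw h (carrier X) ?N" ..
  with split(1) N split(2) N' split(3) show ?summand
    by (intro exI[of _ ?N] exI[of _ ?N'] conjI)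
next
  assume ?summand
  then obtain N N' h where N: "subgroup N (add_monoid M)" "\<forall>\<omega>\<in>\<Omega>. \<forall>y\<in>N. \<beta> \<omega> y \<in> N"
    and N': "subgroup N' (add_monoid M)" "\<forall>\<omega>\<in>\<Omega>. \<forall>y\<in>N'. \<beta> \<omega> y \<in> N'"
    and ds: "internal_direct_sum M N N'"
    and h: "h \<in> equivariant_hom \<Omega> \<alpha> \<beta> X (M\<lparr>carrier := N\<rparr>)" "bij_betw h (carrier X) N" by (elim exE conjE bexE)
  interpret X: abelian_group X by (rule X)
  interpret M: abelian_group M by (rule M)
  have NM: "N \<subseteq> carrier M" using subgroup.subset[OF N(1)] by simp
  obtain p where p: "p \<in> hom (add_monoid M) (add_monoid M)" "\<And>y. y \<in> carrier M \<Longrightarrow> p y \<in> N"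
      "\<And>n. n \<in> N \<Longrightarrow> p n = n"
    and pe: "\<forall>e \<in> hom (add_monoid M) (add_monoid M). e ` N \<subseteq> N \<and> e ` N' \<subseteq> N' \<longrightarrow>
      (\<forall>y\<in>carrier M. p (e y) = e (p y))"
    using internal_direct_sum_projection[OF M N(1) N'(1) ds] by blast
  have hN: "h x \<in> N" if "x \<in> carrier X" for x using h(2) that by (auto simp: bij_betw_def)
  have h_add: "h (x \<oplus>\<^bsub>X\<^esub> y) = h x \<oplus>\<^bsub>M\<^esub> h y" if "x \<in> carrier X" "y \<in> carrier X" for x y
    using h(1) that by (auto simp: equivariant_hom_def hom_def)
  have h_op: "h (\<alpha> \<omega> x) = \<beta> \<omega> (h x)" if "\<omega> \<in> \<Omega>" "x \<in> carrier X" for \<omega> x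
    using h(1) that by (auto simp: equivariant_hom_def)
  define P where "P y = inv_into (carrier X) h (p y)" for y
  have P: "P y \<in> carrier X" "h (P y) = p y" if "y \<in> carrier M" for y
    using p(2)[OF that] h(2) by (auto simp: P_def bij_betw_def f_inv_into_f inv_into_into)
  have PI: "P y = x" if "p y = h x" "x \<in> carrier X" for x y
    using that h(2) by (simp add: P_def bij_betw_def)
  show ?retract
  proof (intro bexI ballI)
    show "h \<in> equivariant_hom \<Omega> \<alpha> \<beta> X M" using hN h_add h_op NM by (auto simp: equivariant_hom_def hom_def)
    show "P (h x) = x" if "x \<in> carrier X" for x using PI that p hN by simp
    have "P (\<beta> \<omega> y) = \<alpha> \<omega> (P y)" if "y \<in> carrier M" "\<omega> \<in> \<Omega>" for y \<omega>
    proof (rule PI)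
      have "p (\<beta> \<omega> y) = \<beta> \<omega> (p y)" using bspec[OF pe \<beta>[OF that(2)]] N(2) N'(2) that by (simp add: image_subset_iff)
      then show "p (\<beta> \<omega> y) = h (\<alpha> \<omega> (P y))" using P that h_op by simp
    qed (use P that hom_in_carrier[OF \<alpha>] in auto)
    moreover have "P (y \<oplus>\<^bsub>M\<^esub> z) = P y \<oplus>\<^bsub>X\<^esub> P z" if "y \<in> carrier M" "z \<in> carrier M" for y z
      by (rule PI) (use P that h_add hom_mult[OF p(1), of y z] in auto)
    ultimately show "P \<in> equivariant_hom \<Omega> \<beta> \<alpha> M X"
      using P by (auto simp: equivariant_hom_def hom_def)
  qed
qed

lemma iso_to_right_direct_summand_iff_retract:
  assumes X: "right_module S X" and M: "right_module S M"
  shows "iso_to_right_direct_summand S X M \<longleftrightarrow>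
    (\<exists>F\<in>right_module_hom S X M. \<exists>P\<in>right_module_hom S M X. \<forall>x\<in>carrier X. P (F x) = x)"
proof -
  interpret X: right_module S X by (rule X)
  interpret M: right_module S M by (rule M)
  let ?\<alpha> = "\<lambda>s x. x \<triangleleft>\<^bsub>X\<^esub> s" and ?\<beta> = "\<lambda>s x. x \<triangleleft>\<^bsub>M\<^esub> s"
  have hom: "right_module_hom S X M = equivariant_hom (carrier S) ?\<alpha> ?\<beta> X M"
    "right_module_hom S M X = equivariant_hom (carrier S) ?\<beta> ?\<alpha> M X"
    by (auto simp: right_module_hom_def equivariant_hom_def)
  have sub: "right_submodule S N M \<longleftrightarrow> subgroup N (add_monoid M) \<and> (\<forall>s\<in>carrier S. \<forall>y\<in>N. ?\<beta> s y \<in> N)" for N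
    by (auto simp: right_submodule_def)
  have iso: "right_module_iso S X (M\<lparr>carrier := N\<rparr>) \<noteq> {} \<longleftrightarrow>
      (\<exists>h\<in>equivariant_hom (carrier S) ?\<alpha> ?\<beta> X (M\<lparr>carrier := N\<rparr>). bij_betw h (carrier X) N)" for N
    by (auto simp: right_module_iso_def right_module_hom_def equivariant_hom_def)
  show ?thesis
    unfolding hom iso_to_right_direct_summand_def sub iso conj_assoc
    by (rule stable_summand_iff_retract[OF X.M.abelian_group_axioms M.M.abelian_group_axioms
          X.rsmult_hom M.rsmult_hom])
qed

lemma iso_to_bimodule_direct_summand_iff_retract:
  assumes X: "bimodule R S X" and M: "bimodule R S M"
  shows "iso_to_bimodule_direct_summand R S X M \<longleftrightarrow>
    (\<exists>F\<in>bimodule_hom R S X M. \<exists>P\<in>bimodule_hom R S M X. \<forall>x\<in>carrier X. P (F x) = x)"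
proof -
  interpret X: bimodule R S X by (rule X)
  interpret M: bimodule R S M by (rule M)
  let ?\<Omega> = "carrier R <+> carrier S"
  define \<alpha> where "\<alpha> = case_sum (lsmult X) (\<lambda>s x. x \<triangleleft>\<^bsub>X\<^esub> s)"
  define \<beta> where "\<beta> = case_sum (lsmult M) (\<lambda>s x. x \<triangleleft>\<^bsub>M\<^esub> s)"
  have all_Plus: "(\<forall>\<omega>\<in>?\<Omega>. Q \<omega>) \<longleftrightarrow> (\<forall>r\<in>carrier R. Q (Inl r)) \<and> (\<forall>s\<in>carrier S. Q (Inr s))" for Q
    by (auto simp: Plus_def)
  have hom: "bimodule_hom R S X M = equivariant_hom ?\<Omega> \<alpha> \<beta> X M"
    "bimodule_hom R S M X = equivariant_hom ?\<Omega> \<beta> \<alpha> M X"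
    by (auto simp: bimodule_hom_def right_module_hom_def equivariant_hom_def all_Plus \<alpha>_def \<beta>_def)
  have sub: "sub_bimodule R S N M \<longleftrightarrow> subgroup N (add_monoid M) \<and> (\<forall>\<omega>\<in>?\<Omega>. \<forall>y\<in>N. \<beta> \<omega> y \<in> N)" for N
    by (auto simp: sub_bimodule_def right_submodule_def all_Plus \<beta>_def)
  have iso: "bimodule_iso R S X (M\<lparr>carrier := N\<rparr>) \<noteq> {} \<longleftrightarrow>
      (\<exists>h\<in>equivariant_hom ?\<Omega> \<alpha> \<beta> X (M\<lparr>carrier := N\<rparr>). bij_betw h (carrier X) N)" for N
    by (auto simp: bimodule_iso_def bimodule_hom_def right_module_hom_def equivariant_hom_def all_Plus \<alpha>_def \<beta>_def)
  show ?thesis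
    unfolding hom iso_to_bimodule_direct_summand_def sub iso conj_assoc
    by (rule stable_summand_iff_retract[OF X.M.abelian_group_axioms M.M.abelian_group_axioms])
      (auto simp: \<alpha>_def \<beta>_def X.rsmult_hom M.rsmult_hom X.lsmult_hom M.lsmult_hom)
qed

section \<open>Finite powers and free modules\<close>

lemma (in abelian_group_hom) hom_finsum:
  "f \<in> A \<rightarrow> carrier G \<Longrightarrow> h (\<Oplus>\<^bsub>G\<^esub>i\<in>A. f i) = (\<Oplus>\<^bsub>H\<^esub>i\<in>A. h (f i))"
  by (induction A rule: infinite_finite_induct) (auto simp: Pi_iff)

lemma finsum_of_hom:
  assumes "abelian_group X" "abelian_group Y" "h \<in> hom (add_monoid X) (add_monoid Y)" "f \<in> A \<rightarrow> carrier X"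
  shows "h (\<Oplus>\<^bsub>X\<^esub>i\<in>A. f i) = (\<Oplus>\<^bsub>Y\<^esub>i\<in>A. h (f i))"
  using abelian_group_hom.hom_finsum[OF abelian_group_hom_of_hom[OF assms(1-3)] assms(4)] .

lemma hom_of_finsum_of_homs:
  assumes X: "abelian_group X" and Y: "abelian_group Y"
    and h: "\<And>i. i \<in> J \<Longrightarrow> h i \<in> hom (add_monoid X) (add_monoid Y)"
  shows "(\<lambda>x. \<Oplus>\<^bsub>Y\<^esub>i\<in>J. h i x) \<in> hom (add_monoid X) (add_monoid Y)"
proof -
  interpret Y: abelian_group Y by (rule Y)
  have c: "h i x \<in> carrier Y" if "i \<in> J" "x \<in> carrier X" for i x
    using hom_in_carrier[OF h[OF that(1)]] that by simp
  have a: "h i (x \<oplus>\<^bsub>X\<^esub> y) = h i x \<oplus>\<^bsub>Y\<^esub> h i y" if "i \<in> J" "x \<in> carrier X" "y \<in> carrier X" for i x y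
    using hom_mult[OF h[OF that(1)]] that by simp
  show ?thesis
  proof (rule homI; simp)
    fix x y assume xy: "x \<in> carrier X" "y \<in> carrier X"
    have "(\<Oplus>\<^bsub>Y\<^esub>i\<in>J. h i (x \<oplus>\<^bsub>X\<^esub> y)) = (\<Oplus>\<^bsub>Y\<^esub>i\<in>J. h i x \<oplus>\<^bsub>Y\<^esub> h i y)"
      by (rule Y.finsum_cong') (use xy a c in auto)
    also have "\<dots> = (\<Oplus>\<^bsub>Y\<^esub>i\<in>J. h i x) \<oplus>\<^bsub>Y\<^esub> (\<Oplus>\<^bsub>Y\<^esub>i\<in>J. h i y)"
      by (rule Y.finsum_addf) (use xy c in auto)
    finally show "(\<Oplus>\<^bsub>Y\<^esub>i\<in>J. h i (x \<oplus>\<^bsub>X\<^esub> y)) = (\<Oplus>\<^bsub>Y\<^esub>i\<in>J. h i x) \<oplus>\<^bsub>Y\<^esub> (\<Oplus>\<^bsub>Y\<^esub>i\<in>J. h i y)" .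
  qed (use c in \<open>auto intro!: Y.finsum_closed\<close>)
qed

lemma bimodule_hom_iff:
  "h \<in> bimodule_hom R S X Y \<longleftrightarrow> (\<forall>x\<in>carrier X. h x \<in> carrier Y) \<and>
    (\<forall>x\<in>carrier X. \<forall>y\<in>carrier X. h (x \<oplus>\<^bsub>X\<^esub> y) = h x \<oplus>\<^bsub>Y\<^esub> h y) \<and>
    (\<forall>x\<in>carrier X. \<forall>s\<in>carrier S. h (x \<triangleleft>\<^bsub>X\<^esub> s) = h x \<triangleleft>\<^bsub>Y\<^esub> s) \<and>
    (\<forall>r\<in>carrier R. \<forall>x\<in>carrier X. h (r \<triangleright>\<^bsub>X\<^esub> x) = r \<triangleright>\<^bsub>Y\<^esub> h x)"
  by (auto simp: bimodule_hom_def right_module_hom_def hom_def)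

lemma bimodule_hom_compose:
  "\<lbrakk>f \<in> bimodule_hom R S X Y; g \<in> bimodule_hom R S Y Z\<rbrakk> \<Longrightarrow> (\<lambda>x. g (f x)) \<in> bimodule_hom R S X Z"
  by (simp add: bimodule_hom_iff)

lemma bimodule_hom_additive:
  "h \<in> bimodule_hom R S X Y \<Longrightarrow> h \<in> hom (add_monoid X) (add_monoid Y)"
  by (simp add: bimodule_hom_def right_module_hom_def)

lemma (in right_module) scalar_hom:
  "x \<in> carrier M \<Longrightarrow> (\<lambda>s. x \<triangleleft>\<^bsub>M\<^esub> s) \<in> hom (add_monoid S) (add_monoid M)"
  by (auto simp: hom_def rsmult_closed rsmult_r_distr)

text \<open>
  The inclusion of the \<open>i\<close>-th summand of a direct sum; for \<open>y = \<one>\<close> in a ring it gives the \<open>i\<close>-th vector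
  of the standard basis.
\<close>

definition coordinate_embedding :: "'i set \<Rightarrow> ('y, 'z) ring_scheme \<Rightarrow> 'i \<Rightarrow> 'y \<Rightarrow> 'i \<Rightarrow> 'y" where
  "coordinate_embedding I Y i y = (\<lambda>j\<in>I. if j = i then y else \<zero>\<^bsub>Y\<^esub>)"

text \<open>
  Stated for an arbitrary group of functions with pointwise addition, so that it serves the finite
  powers (\<open>J = I\<close>) as well as the free modules, whose elements have finite support but whose index set
  \<open>I\<close> may be infinite. The two sides agree because evaluation at each index is additive.
\<close>

lemma sum_of_coordinates:
  assumes P: "abelian_group P" and Y: "abelian_group Y"
    and add: "\<And>x y. x \<oplus>\<^bsub>P\<^esub> y = (\<lambda>i\<in>I. x i \<oplus>\<^bsub>Y\<^esub> y i)"
    and sub: "carrier P \<subseteq> I \<rightarrow>\<^sub>E carrier Y" and J: "finite J" "J \<subseteq> I"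
    and x: "x \<in> carrier P" "\<And>i. i \<in> I - J \<Longrightarrow> x i = \<zero>\<^bsub>Y\<^esub>"
    and emb: "\<And>i. i \<in> J \<Longrightarrow> coordinate_embedding I Y i (x i) \<in> carrier P"
  shows "(\<Oplus>\<^bsub>P\<^esub>i\<in>J. coordinate_embedding I Y i (x i)) = x"
proof
  interpret P: abelian_group P by (rule P)
  interpret Y: abelian_group Y by (rule Y)
  have xY: "x i \<in> carrier Y" if "i \<in> I" for i using that x sub by auto
  fix k
  have closed: "(\<Oplus>\<^bsub>P\<^esub>i\<in>J. coordinate_embedding I Y i (x i)) \<in> carrier P"
    using emb by (intro P.finsum_closed) auto
  show "(\<Oplus>\<^bsub>P\<^esub>i\<in>J. coordinate_embedding I Y i (x i)) k = x k"
  proof (cases "k \<in> I")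
    case True
    have "(\<lambda>z. z k) \<in> hom (add_monoid P) (add_monoid Y)"
      using sub True by (auto simp: hom_def add)
    then have "(\<Oplus>\<^bsub>P\<^esub>i\<in>J. coordinate_embedding I Y i (x i)) k = (\<Oplus>\<^bsub>Y\<^esub>i\<in>J. coordinate_embedding I Y i (x i) k)"
      using emb by (intro finsum_of_hom[OF P Y]) auto
    also have "\<dots> = (\<Oplus>\<^bsub>Y\<^esub>i\<in>J. if k = i then x i else \<zero>\<^bsub>Y\<^esub>)"
      using True J xY by (intro Y.finsum_cong') (auto simp: coordinate_embedding_def)
    also have "\<dots> = x k"
    proof (cases "k \<in> J")
      case True
      then show ?thesis using J xY by (intro Y.finsum_singleton) auto
    next
      case False
      then have "(\<Oplus>\<^bsub>Y\<^esub>i\<in>J. if k = i then x i else \<zero>\<^bsub>Y\<^esub>) = (\<Oplus>\<^bsub>Y\<^esub>i\<in>J. \<zero>\<^bsub>Y\<^esub>)"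
        by (intro Y.finsum_cong') auto
      then show ?thesis using False True x(2) by simp
    qed
    finally show ?thesis .
  next
    case False
    then show ?thesis
      using PiE_arb[OF subsetD[OF sub closed]] PiE_arb[OF subsetD[OF sub x(1)]] by simp
  qed
qed

lemma pointwise_abelian_group:
  assumes Y: "abelian_group Y" and sub: "carrier P \<subseteq> I \<rightarrow>\<^sub>E carrier Y"
    and add: "\<And>x y. x \<oplus>\<^bsub>P\<^esub> y = (\<lambda>i\<in>I. x i \<oplus>\<^bsub>Y\<^esub> y i)" and zero: "\<zero>\<^bsub>P\<^esub> = (\<lambda>i\<in>I. \<zero>\<^bsub>Y\<^esub>)"
    and closed: "\<zero>\<^bsub>P\<^esub> \<in> carrier P" "\<And>x y. \<lbrakk>x \<in> carrier P; y \<in> carrier P\<rbrakk> \<Longrightarrow> x \<oplus>\<^bsub>P\<^esub> y \<in> carrier P"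
      "\<And>x. x \<in> carrier P \<Longrightarrow> (\<lambda>i\<in>I. \<ominus>\<^bsub>Y\<^esub> x i) \<in> carrier P"
  shows "abelian_group P"
proof (rule abelian_groupI)
  interpret Y: abelian_group Y by (rule Y)
  have c: "x i \<in> carrier Y" if "x \<in> carrier P" "i \<in> I" for x i using sub that by (auto simp: PiE_iff)
  fix x assume x: "x \<in> carrier P"
  show "\<zero>\<^bsub>P\<^esub> \<oplus>\<^bsub>P\<^esub> x = x"
    by (rule PiE_ext[of _ I "\<lambda>_. carrier Y"]) (use x closed sub c in \<open>auto simp: add zero\<close>)
  show "\<exists>y\<in>carrier P. y \<oplus>\<^bsub>P\<^esub> x = \<zero>\<^bsub>P\<^esub>"
    using closed(3)[OF x] c[OF x] by (intro bexI) (auto simp: add zero Y.l_neg intro!: restrict_ext)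
  fix y assume y: "y \<in> carrier P"
  show "x \<oplus>\<^bsub>P\<^esub> y = y \<oplus>\<^bsub>P\<^esub> x"
    using c x y by (auto simp: add Y.a_comm intro!: restrict_ext)
  fix z assume z: "z \<in> carrier P"
  show "x \<oplus>\<^bsub>P\<^esub> y \<oplus>\<^bsub>P\<^esub> z = x \<oplus>\<^bsub>P\<^esub> (y \<oplus>\<^bsub>P\<^esub> z)"
    using c x y z by (auto simp: add Y.a_assoc intro!: restrict_ext)
qed (rule closed; assumption)+

lemma bimodule_power_simps [simp]:
  "carrier (bimodule_power Y m) = {..<m} \<rightarrow>\<^sub>E carrier Y"
  "x \<oplus>\<^bsub>bimodule_power Y m\<^esub> y = (\<lambda>i\<in>{..<m}. x i \<oplus>\<^bsub>Y\<^esub> y i)"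
  "\<zero>\<^bsub>bimodule_power Y m\<^esub> = (\<lambda>i\<in>{..<m}. \<zero>\<^bsub>Y\<^esub>)"
  "x \<triangleleft>\<^bsub>bimodule_power Y m\<^esub> s = (\<lambda>i\<in>{..<m}. x i \<triangleleft>\<^bsub>Y\<^esub> s)"
  "r \<triangleright>\<^bsub>bimodule_power Y m\<^esub> x = (\<lambda>i\<in>{..<m}. r \<triangleright>\<^bsub>Y\<^esub> x i)"
  by (simp_all add: bimodule_power_def)

lemma bimodule_power_is_bimodule:
  assumes "bimodule R S Y"
  shows "bimodule R S (bimodule_power Y m)"
proof -
  interpret Y: bimodule R S Y by fact
  let ?P = "bimodule_power Y m"
  have ab: "abelian_group ?P"
    by (rule pointwise_abelian_group[OF Y.M.abelian_group_axioms, of _ "{..<m}"]) (auto simp: PiE_iff)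
  have c: "x i \<in> carrier Y" if "x \<in> carrier ?P" "i < m" for x i using that by (simp add: PiE_iff)
  note acts = Y.rsmult_closed Y.lsmult_closed Y.rsmult_l_distr Y.rsmult_r_distr Y.rsmult_assoc
    Y.rsmult_one Y.lsmult_l_distr Y.lsmult_r_distr Y.lsmult_assoc Y.lsmult_one Y.lsmult_rsmult
  have one: "(\<lambda>i\<in>{..<m}. x i \<triangleleft>\<^bsub>Y\<^esub> \<one>\<^bsub>S\<^esub>) = x" "(\<lambda>i\<in>{..<m}. \<one>\<^bsub>R\<^esub> \<triangleright>\<^bsub>Y\<^esub> x i) = x" if "x \<in> carrier ?P" for x
    by (rule PiE_ext[of _ "{..<m}" "\<lambda>_. carrier Y"], use that c[OF that] in \<open>simp_all add: acts PiE_iff\<close>)+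
  show ?thesis
    by (intro bimodule.intro right_module.intro right_module_axioms.intro bimodule_axioms.intro
        Y.R.ring_axioms Y.S.ring_axioms ab, unfold bimodule_power_simps(2,4,5))
      (use c one in \<open>auto simp: acts intro!: restrict_ext\<close>)
qed

lemma free_right_module_simps [simp]:
  "carrier (free_right_module S I) = {x \<in> I \<rightarrow>\<^sub>E carrier S. finite {i \<in> I. x i \<noteq> \<zero>\<^bsub>S\<^esub>}}"
  "x \<oplus>\<^bsub>free_right_module S I\<^esub> y = (\<lambda>i\<in>I. x i \<oplus>\<^bsub>S\<^esub> y i)"
  "\<zero>\<^bsub>free_right_module S I\<^esub> = (\<lambda>i\<in>I. \<zero>\<^bsub>S\<^esub>)"
  "x \<triangleleft>\<^bsub>free_right_module S I\<^esub> s = (\<lambda>i\<in>I. x i \<otimes>\<^bsub>S\<^esub> s)"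
  by (simp_all add: free_right_module_def)

lemma free_right_module_is_right_module:
  assumes "ring S"
  shows "right_module S (free_right_module S I)"
proof -
  interpret S: ring S by fact
  have add: "finite {i \<in> I. x i \<oplus>\<^bsub>S\<^esub> y i \<noteq> \<zero>\<^bsub>S\<^esub>}"
    if "finite {i \<in> I. x i \<noteq> \<zero>\<^bsub>S\<^esub>}" "finite {i \<in> I. y i \<noteq> \<zero>\<^bsub>S\<^esub>}" for x y
    by (rule finite_subset[OF _ finite_UnI[OF that]]) auto
  have neg: "finite {i \<in> I. \<ominus>\<^bsub>S\<^esub> x i \<noteq> \<zero>\<^bsub>S\<^esub>}" if "finite {i \<in> I. x i \<noteq> \<zero>\<^bsub>S\<^esub>}" for x
    by (rule finite_subset[OF _ that]) auto
  have act: "finite {i \<in> I. x i \<otimes>\<^bsub>S\<^esub> s \<noteq> \<zero>\<^bsub>S\<^esub>}" if "finite {i \<in> I. x i \<noteq> \<zero>\<^bsub>S\<^esub>}" "s \<in> carrier S" for x s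
    by (rule finite_subset[OF _ that(1)]) (use that in auto)
  let ?F = "free_right_module S I"
  have c: "x i \<in> carrier S" if "x \<in> carrier ?F" "i \<in> I" for x i using that by (simp add: PiE_iff)
  have ab: "abelian_group ?F"
  proof (rule pointwise_abelian_group[OF S.abelian_group_axioms, of _ I])
    show "(\<lambda>i\<in>I. \<ominus>\<^bsub>S\<^esub> x i) \<in> carrier ?F" if "x \<in> carrier ?F" for x
      using neg[of x] that by (simp add: PiE_iff cong: conj_cong)
    show "x \<oplus>\<^bsub>?F\<^esub> y \<in> carrier ?F" if "x \<in> carrier ?F" "y \<in> carrier ?F" for x y
      using add[of x y] that by (simp add: PiE_iff cong: conj_cong)
  qed (auto cong: conj_cong)
  have closed: "x \<triangleleft>\<^bsub>?F\<^esub> s \<in> carrier ?F" if "x \<in> carrier ?F" "s \<in> carrier S" for x s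
    using act[of x s] that by (simp add: PiE_iff cong: conj_cong)
  have one: "(\<lambda>i\<in>I. x i \<otimes>\<^bsub>S\<^esub> \<one>\<^bsub>S\<^esub>) = x" if "x \<in> carrier ?F" for x
    by (rule PiE_ext[of _ I "\<lambda>_. carrier S"]) (use that c[OF that] in \<open>simp_all add: PiE_iff\<close>)
  show ?thesis
  proof (intro right_module.intro right_module_axioms.intro S.ring_axioms ab closed)
    fix x s t assume x: "x \<in> carrier ?F" and s: "s \<in> carrier S" and t: "t \<in> carrier S"
    note xc = c[OF x]
    show "x \<triangleleft>\<^bsub>?F\<^esub> (s \<oplus>\<^bsub>S\<^esub> t) = x \<triangleleft>\<^bsub>?F\<^esub> s \<oplus>\<^bsub>?F\<^esub> x \<triangleleft>\<^bsub>?F\<^esub> t"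
      "x \<triangleleft>\<^bsub>?F\<^esub> (s \<otimes>\<^bsub>S\<^esub> t) = x \<triangleleft>\<^bsub>?F\<^esub> s \<triangleleft>\<^bsub>?F\<^esub> t"
      using xc s t by (auto simp: S.r_distr S.m_assoc intro!: restrict_ext)
  next
    fix x y s assume x: "x \<in> carrier ?F" and y: "y \<in> carrier ?F" and s: "s \<in> carrier S"
    show "(x \<oplus>\<^bsub>?F\<^esub> y) \<triangleleft>\<^bsub>?F\<^esub> s = x \<triangleleft>\<^bsub>?F\<^esub> s \<oplus>\<^bsub>?F\<^esub> y \<triangleleft>\<^bsub>?F\<^esub> s"
      using c[OF x] c[OF y] s by (auto simp: S.l_distr intro!: restrict_ext)
  next
    show "x \<triangleleft>\<^bsub>?F\<^esub> \<one>\<^bsub>S\<^esub> = x" if "x \<in> carrier ?F" for x using one[OF that] by simp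
  qed
qed

text \<open>
  A homomorphism into \<open>Y\<^sup>m\<close> is a family of \<open>m\<close> homomorphisms into \<open>Y\<close>, one out of \<open>Y\<^sup>m\<close> is a
  family of \<open>m\<close> homomorphisms out of \<open>Y\<close>, and composition becomes a sum of composites. A retraction
  through \<open>Y\<^sup>m\<close> is therefore a way to write the identity of \<open>X\<close> as a sum of \<open>m\<close> maps factoring
  through \<open>Y\<close>.
\<close>

lemma iso_to_summand_of_power_iff:
  assumes X: "bimodule R S X" and Y: "bimodule R S Y"
  shows "iso_to_bimodule_direct_summand R S X (bimodule_power Y m) \<longleftrightarrow>
    (\<exists>f g. (\<forall>i<m. f i \<in> bimodule_hom R S X Y \<and> g i \<in> bimodule_hom R S Y X) \<and>
      (\<forall>x\<in>carrier X. (\<Oplus>\<^bsub>X\<^esub>i\<in>{..<m}. g i (f i x)) = x))"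
proof -
  interpret X: bimodule R S X by (rule X)
  interpret Y: bimodule R S Y by (rule Y)
  let ?P = "bimodule_power Y m"
  interpret P: bimodule R S ?P by (rule bimodule_power_is_bimodule[OF Y])
  show ?thesis
    unfolding iso_to_bimodule_direct_summand_iff_retract[OF X P.bimodule_axioms]
  proof
    assume "\<exists>F\<in>bimodule_hom R S X ?P. \<exists>H\<in>bimodule_hom R S ?P X. \<forall>x\<in>carrier X. H (F x) = x"
    then obtain F H where F: "F \<in> bimodule_hom R S X ?P" and H: "H \<in> bimodule_hom R S ?P X"
      and HF: "\<forall>x\<in>carrier X. H (F x) = x" by blast
    let ?e = "coordinate_embedding {..<m} Y"
    have Fc: "F x \<in> carrier ?P" if "x \<in> carrier X" for x
      using F that by (simp add: bimodule_hom_iff)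
    have e: "?e i \<in> bimodule_hom R S Y ?P" if "i < m" for i
      using that by (auto simp: bimodule_hom_def right_module_hom_def hom_def coordinate_embedding_def
          fun_eq_iff Y.rsmult_zero_left Y.lsmult_zero_right)
    have "(\<lambda>x. F x i) \<in> bimodule_hom R S X Y" if "i < m" for i
      using F that by (auto simp: bimodule_hom_def right_module_hom_def hom_def)
    moreover have "(\<lambda>y. H (?e i y)) \<in> bimodule_hom R S Y X" if "i < m" for i
      by (rule bimodule_hom_compose[OF e[OF that] H])
    moreover have "(\<Oplus>\<^bsub>X\<^esub>i\<in>{..<m}. H (?e i (F x i))) = x" if x: "x \<in> carrier X" for x
    proof -
      have "F x i \<in> carrier Y" if "i < m" for i using Fc[OF x] that by (simp add: PiE_iff)
      then have eF: "?e i (F x i) \<in> carrier ?P" if "i < m" for i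
        using e[OF that] that unfolding bimodule_hom_iff by blast
      have "(\<Oplus>\<^bsub>X\<^esub>i\<in>{..<m}. H (?e i (F x i))) = H (\<Oplus>\<^bsub>?P\<^esub>i\<in>{..<m}. ?e i (F x i))"
        by (rule finsum_of_hom[OF P.M.abelian_group_axioms X.M.abelian_group_axioms
            bimodule_hom_additive[OF H], symmetric]) (use eF in blast)
      also have "(\<Oplus>\<^bsub>?P\<^esub>i\<in>{..<m}. ?e i (F x i)) = F x"
        by (rule sum_of_coordinates[OF P.M.abelian_group_axioms Y.M.abelian_group_axioms])
          (use Fc[OF x] eF in auto)
      finally show ?thesis using HF x by simp
    qed
    ultimately show "\<exists>f g. (\<forall>i<m. f i \<in> bimodule_hom R S X Y \<and> g i \<in> bimodule_hom R S Y X) \<and>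
        (\<forall>x\<in>carrier X. (\<Oplus>\<^bsub>X\<^esub>i\<in>{..<m}. g i (f i x)) = x)"
      by (intro exI[of _ "\<lambda>i x. F x i"] exI[of _ "\<lambda>i y. H (?e i y)"]) simp
  next
    assume "\<exists>f g. (\<forall>i<m. f i \<in> bimodule_hom R S X Y \<and> g i \<in> bimodule_hom R S Y X) \<and>
        (\<forall>x\<in>carrier X. (\<Oplus>\<^bsub>X\<^esub>i\<in>{..<m}. g i (f i x)) = x)"
    then obtain f g where f: "\<And>i. i < m \<Longrightarrow> f i \<in> bimodule_hom R S X Y"
      and g: "\<And>i. i < m \<Longrightarrow> g i \<in> bimodule_hom R S Y X"
      and gf: "\<And>x. x \<in> carrier X \<Longrightarrow> (\<Oplus>\<^bsub>X\<^esub>i\<in>{..<m}. g i (f i x)) = x" by blast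
    define F where "F x = (\<lambda>i\<in>{..<m}. f i x)" for x
    define H where "H z = (\<Oplus>\<^bsub>X\<^esub>i\<in>{..<m}. g i (z i))" for z
    have F: "F \<in> bimodule_hom R S X ?P"
      using f unfolding bimodule_hom_iff by (auto simp: F_def intro!: restrict_ext)
    have gz: "g i (z i) \<in> carrier X" if "i < m" "z \<in> carrier ?P" for i z
      using g[OF that(1)] that by (auto simp: bimodule_hom_def right_module_hom_def hom_def)
    have "H \<in> hom (add_monoid ?P) (add_monoid X)"
      unfolding H_def
    proof (rule hom_of_finsum_of_homs[OF P.M.abelian_group_axioms X.M.abelian_group_axioms])
      fix i assume "i \<in> {..<m}"
      then show "(\<lambda>z. g i (z i)) \<in> hom (add_monoid ?P) (add_monoid X)"
        using g[of i] by (auto simp: bimodule_hom_def right_module_hom_def hom_def PiE_iff)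
    qed
    moreover have "H (z \<triangleleft>\<^bsub>?P\<^esub> s) = H z \<triangleleft>\<^bsub>X\<^esub> s" if "s \<in> carrier S" "z \<in> carrier ?P" for s z
    proof -
      have "H z \<triangleleft>\<^bsub>X\<^esub> s = (\<Oplus>\<^bsub>X\<^esub>i\<in>{..<m}. g i (z i) \<triangleleft>\<^bsub>X\<^esub> s)"
        unfolding H_def using that gz
        by (intro finsum_of_hom[OF X.M.abelian_group_axioms X.M.abelian_group_axioms X.rsmult_hom]) auto
      also have "\<dots> = (\<Oplus>\<^bsub>X\<^esub>i\<in>{..<m}. g i ((z \<triangleleft>\<^bsub>?P\<^esub> s) i))"
        using that gz[OF _ P.rsmult_closed[OF that(2,1)]] g
        by (intro X.M.finsum_cong') (auto simp: bimodule_hom_iff PiE_iff)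
      finally show ?thesis by (simp add: H_def)
    qed
    moreover have "H (r \<triangleright>\<^bsub>?P\<^esub> z) = r \<triangleright>\<^bsub>X\<^esub> H z" if "r \<in> carrier R" "z \<in> carrier ?P" for r z
    proof -
      have "r \<triangleright>\<^bsub>X\<^esub> H z = (\<Oplus>\<^bsub>X\<^esub>i\<in>{..<m}. r \<triangleright>\<^bsub>X\<^esub> g i (z i))"
        unfolding H_def using that gz
        by (intro finsum_of_hom[OF X.M.abelian_group_axioms X.M.abelian_group_axioms X.lsmult_hom]) auto
      also have "\<dots> = (\<Oplus>\<^bsub>X\<^esub>i\<in>{..<m}. g i ((r \<triangleright>\<^bsub>?P\<^esub> z) i))"
        using that gz[OF _ P.lsmult_closed[OF that]] g
        by (intro X.M.finsum_cong') (auto simp: bimodule_hom_iff PiE_iff)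
      finally show ?thesis by (simp add: H_def)
    qed
    ultimately have "H \<in> bimodule_hom R S ?P X" by (simp add: bimodule_hom_def right_module_hom_def)
    moreover have "H (F x) = x" if x: "x \<in> carrier X" for x
    proof -
      have "H (F x) = (\<Oplus>\<^bsub>X\<^esub>i\<in>{..<m}. g i (f i x))"
        unfolding H_def
        by (intro X.M.finsum_cong') (use f g x in \<open>auto simp: F_def bimodule_hom_iff\<close>)
      then show ?thesis using gf x by simp
    qed
    ultimately show "\<exists>F\<in>bimodule_hom R S X ?P. \<exists>H\<in>bimodule_hom R S ?P X. \<forall>x\<in>carrier X. H (F x) = x"
      using F by blast
  qed
qed

section \<open>Dual bases of finitely generated projective modules\<close>

lemma right_module_hom_iff:
  "h \<in> right_module_hom S X Y \<longleftrightarrow> (\<forall>x\<in>carrier X. h x \<in> carrier Y) \<and>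
    (\<forall>x\<in>carrier X. \<forall>y\<in>carrier X. h (x \<oplus>\<^bsub>X\<^esub> y) = h x \<oplus>\<^bsub>Y\<^esub> h y) \<and>
    (\<forall>x\<in>carrier X. \<forall>s\<in>carrier S. h (x \<triangleleft>\<^bsub>X\<^esub> s) = h x \<triangleleft>\<^bsub>Y\<^esub> s)"
  by (auto simp: right_module_hom_def hom_def)

lemma right_module_hom_additive:
  "h \<in> right_module_hom S X Y \<Longrightarrow> h \<in> hom (add_monoid X) (add_monoid Y)"
  by (simp add: right_module_hom_def)

lemma (in right_module) finsum_rsmult:
  assumes "f \<in> A \<rightarrow> carrier M" "s \<in> carrier S"
  shows "(\<Oplus>\<^bsub>M\<^esub>i\<in>A. f i) \<triangleleft>\<^bsub>M\<^esub> s = (\<Oplus>\<^bsub>M\<^esub>i\<in>A. f i \<triangleleft>\<^bsub>M\<^esub> s)"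
  using finsum_of_hom[OF M.abelian_group_axioms M.abelian_group_axioms rsmult_hom[OF assms(2)] assms(1)] .

lemma (in right_module) rsmult_finsum:
  assumes "f \<in> A \<rightarrow> carrier S" "x \<in> carrier M"
  shows "x \<triangleleft>\<^bsub>M\<^esub> (\<Oplus>\<^bsub>S\<^esub>i\<in>A. f i) = (\<Oplus>\<^bsub>M\<^esub>i\<in>A. x \<triangleleft>\<^bsub>M\<^esub> f i)"
  using finsum_of_hom[OF S.abelian_group_axioms M.abelian_group_axioms scalar_hom[OF assms(2)] assms(1)] .

text \<open>
  Adding up the functionals that belong to the same element turns a dual basis indexed by numbers,
  possibly with repetitions, into one indexed by its own elements. This is needed because finite
  generation asks for a set of generators, and projectivity for a free module whose basis lies in the
  type of the elements of \<open>M\<close>.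
\<close>

lemma dual_basis_distinct:
  assumes M: "right_module S M"
    and q: "\<And>i. i < m \<Longrightarrow> q i \<in> carrier M"
    and \<phi>: "\<And>i. i < (m::nat) \<Longrightarrow> \<phi> i \<in> right_module_hom S M (regular_bimodule S)"
    and sum: "\<And>x. x \<in> carrier M \<Longrightarrow> (\<Oplus>\<^bsub>M\<^esub>i\<in>{..<m}. q i \<triangleleft>\<^bsub>M\<^esub> \<phi> i x) = x"
  obtains G \<psi> where "finite G" "G \<subseteq> carrier M"
    and "\<And>g. g \<in> G \<Longrightarrow> \<psi> g \<in> right_module_hom S M (regular_bimodule S)"
    and "\<And>x. x \<in> carrier M \<Longrightarrow> (\<Oplus>\<^bsub>M\<^esub>g\<in>G. g \<triangleleft>\<^bsub>M\<^esub> \<psi> g x) = x"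
proof -
  interpret M: right_module S M by (rule M)
  define G where "G = q ` {..<m}"
  define fib where "fib g = {i. i < m \<and> q i = g}" for g
  define \<psi> where "\<psi> g x = (\<Oplus>\<^bsub>S\<^esub>i\<in>fib g. \<phi> i x)" for g x
  have \<phi>c: "\<phi> i x \<in> carrier S" if "i < m" "x \<in> carrier M" for i x
    using \<phi>[OF that(1)] that(2) by (simp add: right_module_hom_iff)
  have \<phi>h: "\<phi> i \<in> hom (add_monoid M) (add_monoid S)" if "i < m" for i
    using \<phi>[OF that] by (simp add: right_module_hom_iff hom_def)
  have "\<psi> g \<in> right_module_hom S M (regular_bimodule S)" for g
  proof -
    have "\<psi> g \<in> hom (add_monoid M) (add_monoid S)"
      unfolding \<psi>_def
      by (rule hom_of_finsum_of_homs[OF M.M.abelian_group_axioms M.S.abelian_group_axioms])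
        (use \<phi>h in \<open>auto simp: fib_def\<close>)
    moreover have "\<psi> g (x \<triangleleft>\<^bsub>M\<^esub> s) = \<psi> g x \<otimes>\<^bsub>S\<^esub> s" if "x \<in> carrier M" "s \<in> carrier S" for x s
    proof -
      have "\<psi> g (x \<triangleleft>\<^bsub>M\<^esub> s) = (\<Oplus>\<^bsub>S\<^esub>i\<in>fib g. \<phi> i x \<otimes>\<^bsub>S\<^esub> s)"
        unfolding \<psi>_def using \<phi> that \<phi>c
        by (intro M.S.finsum_cong') (auto simp: fib_def right_module_hom_iff)
      also have "\<dots> = \<psi> g x \<otimes>\<^bsub>S\<^esub> s"
        unfolding \<psi>_def using that \<phi>c
        by (intro M.S.finsum_ldistr[symmetric]) (auto simp: fib_def)
      finally show ?thesis .
    qed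
    ultimately show ?thesis by (simp add: right_module_hom_def hom_def)
  qed
  moreover have "(\<Oplus>\<^bsub>M\<^esub>g\<in>G. g \<triangleleft>\<^bsub>M\<^esub> \<psi> g x) = x" if x: "x \<in> carrier M" for x
  proof -
    have c: "q i \<triangleleft>\<^bsub>M\<^esub> \<phi> i x \<in> carrier M" if "i < m" for i
      using M.rsmult_closed q \<phi>c x that by simp
    have "g \<triangleleft>\<^bsub>M\<^esub> \<psi> g x = (\<Oplus>\<^bsub>M\<^esub>i\<in>fib g. q i \<triangleleft>\<^bsub>M\<^esub> \<phi> i x)" if "g \<in> G" for g
    proof -
      have "g \<triangleleft>\<^bsub>M\<^esub> \<psi> g x = (\<Oplus>\<^bsub>M\<^esub>i\<in>fib g. g \<triangleleft>\<^bsub>M\<^esub> \<phi> i x)"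
        unfolding \<psi>_def using that q \<phi>c x by (intro M.rsmult_finsum) (auto simp: fib_def G_def)
      also have "\<dots> = (\<Oplus>\<^bsub>M\<^esub>i\<in>fib g. q i \<triangleleft>\<^bsub>M\<^esub> \<phi> i x)"
        using c by (intro M.M.finsum_cong') (auto simp: fib_def)
      finally show ?thesis .
    qed
    then have "(\<Oplus>\<^bsub>M\<^esub>g\<in>G. g \<triangleleft>\<^bsub>M\<^esub> \<psi> g x) = (\<Oplus>\<^bsub>M\<^esub>g\<in>G. \<Oplus>\<^bsub>M\<^esub>i\<in>fib g. q i \<triangleleft>\<^bsub>M\<^esub> \<phi> i x)"
      using c by (intro M.M.finsum_cong') (auto simp: fib_def intro!: M.M.finsum_closed)
    also have "\<dots> = (\<Oplus>\<^bsub>M\<^esub>i\<in>\<Union>(fib ` G). q i \<triangleleft>\<^bsub>M\<^esub> \<phi> i x)"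
      using c by (intro M.M.add.finprod_UN_disjoint[symmetric])
        (auto simp: fib_def G_def pairwise_def disjnt_def)
    also have "\<Union>(fib ` G) = {..<m}" by (auto simp: fib_def G_def)
    finally show ?thesis using sum[OF x] by simp
  qed
  ultimately show ?thesis using that[of G \<psi>] q by (auto simp: G_def)
qed

text \<open>
  The elements of the dual basis generate, and the functionals give a section
  \<open>x \<mapsto> (\<psi> g x)\<^sub>g\<close> of the map from the free module on them.
\<close>

lemma finite_projective_of_dual_basis:
  assumes M: "right_module S M"
    and q: "\<And>i. i < m \<Longrightarrow> q i \<in> carrier M"
    and \<phi>: "\<And>i. i < (m::nat) \<Longrightarrow> \<phi> i \<in> right_module_hom S M (regular_bimodule S)"
    and sum: "\<And>x. x \<in> carrier M \<Longrightarrow> (\<Oplus>\<^bsub>M\<^esub>i\<in>{..<m}. q i \<triangleleft>\<^bsub>M\<^esub> \<phi> i x) = x"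
  shows "fin_gen_right_module S M" "projective_right_module S M"
proof -
  interpret M: right_module S M by (rule M)
  obtain G \<psi> where G: "finite G" "G \<subseteq> carrier M"
    and \<psi>: "\<And>g. g \<in> G \<Longrightarrow> \<psi> g \<in> right_module_hom S M (regular_bimodule S)"
    and eq: "\<And>x. x \<in> carrier M \<Longrightarrow> (\<Oplus>\<^bsub>M\<^esub>g\<in>G. g \<triangleleft>\<^bsub>M\<^esub> \<psi> g x) = x"
    using dual_basis_distinct[OF M q \<phi> sum] by blast
  have \<psi>c: "\<psi> g x \<in> carrier S" if "g \<in> G" "x \<in> carrier M" for g x
    using \<psi> that by (simp add: right_module_hom_iff)
  show "fin_gen_right_module S M"
    unfolding fin_gen_right_module_def
  proof (intro exI[of _ G] conjI ballI G)
    fix x assume x: "x \<in> carrier M"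
    show "\<exists>c\<in>G \<rightarrow> carrier S. x = (\<Oplus>\<^bsub>M\<^esub>g\<in>G. g \<triangleleft>\<^bsub>M\<^esub> c g)"
      using \<psi>c[OF _ x] eq[OF x] by (intro bexI[of _ "\<lambda>g. \<psi> g x"]) auto
  qed
  let ?F = "free_right_module S G"
  have free: "right_module S ?F" by (rule free_right_module_is_right_module[OF M.S.ring_axioms])
  interpret F: right_module S ?F by (rule free)
  define H where "H z = (\<Oplus>\<^bsub>M\<^esub>g\<in>G. g \<triangleleft>\<^bsub>M\<^esub> z g)" for z
  have "(\<lambda>x. \<lambda>g\<in>G. \<psi> g x) \<in> right_module_hom S M ?F"
    using \<psi> G(1) unfolding right_module_hom_iff by (auto intro!: restrict_ext)
  moreover have "H \<in> right_module_hom S ?F M"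
  proof -
    have "H \<in> hom (add_monoid ?F) (add_monoid M)"
      unfolding H_def
    proof (rule hom_of_finsum_of_homs[OF F.M.abelian_group_axioms M.M.abelian_group_axioms])
      fix g assume "g \<in> G"
      then show "(\<lambda>z. g \<triangleleft>\<^bsub>M\<^esub> z g) \<in> hom (add_monoid ?F) (add_monoid M)"
        using G(2) by (auto simp: hom_def PiE_iff M.rsmult_closed M.rsmult_r_distr subset_iff)
    qed
    moreover have "H (z \<triangleleft>\<^bsub>?F\<^esub> s) = H z \<triangleleft>\<^bsub>M\<^esub> s" if "z \<in> carrier ?F" "s \<in> carrier S" for z s
    proof -
      have zc: "g \<in> carrier M" "z g \<in> carrier S" if "g \<in> G" for g
        using \<open>z \<in> carrier ?F\<close> that G(2) by auto
      have "H z \<triangleleft>\<^bsub>M\<^esub> s = (\<Oplus>\<^bsub>M\<^esub>g\<in>G. (g \<triangleleft>\<^bsub>M\<^esub> z g) \<triangleleft>\<^bsub>M\<^esub> s)"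
        unfolding H_def by (rule M.finsum_rsmult) (use zc that M.rsmult_closed in auto)
      also have "\<dots> = (\<Oplus>\<^bsub>M\<^esub>g\<in>G. g \<triangleleft>\<^bsub>M\<^esub> (z \<triangleleft>\<^bsub>?F\<^esub> s) g)"
        by (intro M.M.finsum_cong') (use zc that M.rsmult_closed in \<open>auto simp: M.rsmult_assoc\<close>)
      finally show ?thesis by (simp add: H_def)
    qed
    ultimately show ?thesis by (simp add: right_module_hom_def)
  qed
  moreover have "\<forall>x\<in>carrier M. H (\<lambda>g\<in>G. \<psi> g x) = x"
  proof
    fix x assume x: "x \<in> carrier M"
    have "H (\<lambda>g\<in>G. \<psi> g x) = (\<Oplus>\<^bsub>M\<^esub>g\<in>G. g \<triangleleft>\<^bsub>M\<^esub> \<psi> g x)"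
      unfolding H_def by (intro M.M.finsum_cong') (use \<psi>c x G(2) M.rsmult_closed in auto)
    then show "H (\<lambda>g\<in>G. \<psi> g x) = x" using eq x by simp
  qed
  ultimately show "projective_right_module S M"
    unfolding projective_right_module_def iso_to_right_direct_summand_iff_retract[OF M free_right_module_is_right_module[OF M.S.ring_axioms]]
    by (intro exI[of _ G] bexI)
qed

text \<open>
  Embed \<open>M\<close> by \<open>F\<close> as a summand of a free module with projection \<open>H\<close>. The images of the basis vectors
  under \<open>H\<close>, paired with the coordinates of \<open>F\<close>, form a dual basis indexed by \<open>I\<close>. Since \<open>M\<close> is
  finitely generated, only the finitely many indices \<open>J\<close> in the supports of the images of the
  generators matter, as every other coordinate of \<open>F\<close> vanishes on all of \<open>M\<close>.
\<close>

lemma dual_basis_of_finite_projective: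
  fixes S :: "('s, 'x) ring_scheme" and M :: "('s, 'm, 'y) right_module_scheme"
  assumes M: "right_module S M"
    and fg: "fin_gen_right_module S M" and proj: "projective_right_module S M"
  obtains m :: nat and q \<phi> where "\<And>i. i < m \<Longrightarrow> q i \<in> carrier M"
    and "\<And>i. i < m \<Longrightarrow> \<phi> i \<in> right_module_hom S M (regular_bimodule S)"
    and "\<And>x. x \<in> carrier M \<Longrightarrow> (\<Oplus>\<^bsub>M\<^esub>i\<in>{..<m}. q i \<triangleleft>\<^bsub>M\<^esub> \<phi> i x) = x"
proof -
  interpret M: right_module S M by (rule M)
  obtain I :: "'m set" and F H where F: "F \<in> right_module_hom S M (free_right_module S I)"
    and H: "H \<in> right_module_hom S (free_right_module S I) M"
    and HF: "\<And>x. x \<in> carrier M \<Longrightarrow> H (F x) = x"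
    using proj unfolding projective_right_module_def
      iso_to_right_direct_summand_iff_retract[OF M free_right_module_is_right_module[OF M.S.ring_axioms]]
    by blast
  let ?P = "free_right_module S I"
  interpret P: right_module S ?P by (rule free_right_module_is_right_module[OF M.S.ring_axioms])
  obtain G where G: "finite G" "G \<subseteq> carrier M"
    and gen: "\<And>x. x \<in> carrier M \<Longrightarrow> \<exists>c\<in>G \<rightarrow> carrier S. x = (\<Oplus>\<^bsub>M\<^esub>g\<in>G. g \<triangleleft>\<^bsub>M\<^esub> c g)"
    using fg unfolding fin_gen_right_module_def by blast
  have Fc: "F x \<in> carrier ?P" if "x \<in> carrier M" for x using F that unfolding right_module_hom_iff by blast
  have coord: "(\<lambda>x. F x i) \<in> right_module_hom S M (regular_bimodule S)" if "i \<in> I" for i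
    using F that unfolding right_module_hom_iff by (auto simp: PiE_iff)
  have coord_closed: "F x i \<in> carrier S" if "i \<in> I" "x \<in> carrier M" for i x
    using coord[OF that(1)] that(2) by (simp add: right_module_hom_iff)
  define J where "J = (\<Union>g\<in>G. {i \<in> I. F g i \<noteq> \<zero>\<^bsub>S\<^esub>})"
  have J: "finite J" "J \<subseteq> I" using G Fc unfolding J_def by auto
  have outside: "F x i = \<zero>\<^bsub>S\<^esub>" if x: "x \<in> carrier M" and i: "i \<in> I - J" for x i
  proof -
    obtain c where c: "c \<in> G \<rightarrow> carrier S" "x = (\<Oplus>\<^bsub>M\<^esub>g\<in>G. g \<triangleleft>\<^bsub>M\<^esub> c g)" using gen[OF x] by blast
    have "(\<lambda>x. F x i) \<in> hom (add_monoid M) (add_monoid S)"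
      using coord[of i] i by (simp add: right_module_hom_iff hom_def)
    then have "F (\<Oplus>\<^bsub>M\<^esub>g\<in>G. g \<triangleleft>\<^bsub>M\<^esub> c g) i = (\<Oplus>\<^bsub>S\<^esub>g\<in>G. F (g \<triangleleft>\<^bsub>M\<^esub> c g) i)"
      by (rule finsum_of_hom[OF M.M.abelian_group_axioms M.S.abelian_group_axioms])
        (use G c M.rsmult_closed in auto)
    also have "\<dots> = (\<Oplus>\<^bsub>S\<^esub>g\<in>G. \<zero>\<^bsub>S\<^esub>)"
    proof (rule M.S.finsum_cong')
      fix g assume g: "g \<in> G"
      then have "F (g \<triangleleft>\<^bsub>M\<^esub> c g) i = F g i \<otimes>\<^bsub>S\<^esub> c g"
        using coord[of i] i subsetD[OF G(2) g] funcset_mem[OF c(1) g] by (simp add: right_module_hom_iff)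
      also have "F g i = \<zero>\<^bsub>S\<^esub>" using i g unfolding J_def by blast
      finally show "F (g \<triangleleft>\<^bsub>M\<^esub> c g) i = \<zero>\<^bsub>S\<^esub>" using funcset_mem[OF c(1) g] by simp
    qed auto
    finally show ?thesis using c(2) by simp
  qed
  let ?e = "\<lambda>i. coordinate_embedding I S i \<one>\<^bsub>S\<^esub>"
  have emb: "coordinate_embedding I S i s \<in> carrier ?P" if "s \<in> carrier S" for i s
  proof -
    have "finite {j \<in> I. coordinate_embedding I S i s j \<noteq> \<zero>\<^bsub>S\<^esub>}"
      by (rule finite_subset[of _ "{i}"]) (auto simp: coordinate_embedding_def)
    then show ?thesis using that by (auto simp: coordinate_embedding_def)
  qed
  have q: "H (?e i) \<in> carrier M" for i
    using H emb[of "\<one>\<^bsub>S\<^esub>" i] unfolding right_module_hom_iff by blast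
  have q_act: "H (coordinate_embedding I S i s) = H (?e i) \<triangleleft>\<^bsub>M\<^esub> s" if "s \<in> carrier S" for i s
  proof -
    have "?e i \<triangleleft>\<^bsub>?P\<^esub> s = coordinate_embedding I S i s"
      using that by (auto simp: coordinate_embedding_def)
    moreover have "H (?e i \<triangleleft>\<^bsub>?P\<^esub> s) = H (?e i) \<triangleleft>\<^bsub>M\<^esub> s"
      using H emb[of "\<one>\<^bsub>S\<^esub>" i] that unfolding right_module_hom_iff by blast
    ultimately show ?thesis by simp
  qed
  have expand: "(\<Oplus>\<^bsub>M\<^esub>i\<in>J. H (?e i) \<triangleleft>\<^bsub>M\<^esub> F x i) = x" if x: "x \<in> carrier M" for x
  proof -
    have Fx: "F x i \<in> carrier S" if "i \<in> J" for i using coord_closed[OF _ x] J that by blast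
    have "(\<Oplus>\<^bsub>M\<^esub>i\<in>J. H (?e i) \<triangleleft>\<^bsub>M\<^esub> F x i) = (\<Oplus>\<^bsub>M\<^esub>i\<in>J. H (coordinate_embedding I S i (F x i)))"
      by (rule M.M.finsum_cong'[OF refl _ q_act[OF Fx], symmetric]) (auto intro: M.rsmult_closed q Fx)
    also have "\<dots> = H (\<Oplus>\<^bsub>?P\<^esub>i\<in>J. coordinate_embedding I S i (F x i))"
      by (rule finsum_of_hom[OF P.M.abelian_group_axioms M.M.abelian_group_axioms
          right_module_hom_additive[OF H], symmetric]) (use emb Fx in blast)
    also have "(\<Oplus>\<^bsub>?P\<^esub>i\<in>J. coordinate_embedding I S i (F x i)) = F x"
      by (rule sum_of_coordinates[OF P.M.abelian_group_axioms M.S.abelian_group_axioms _ _ J Fc[OF x] outside[OF x] emb[OF Fx]])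
        auto
    finally show ?thesis using HF[OF x] by simp
  qed
  obtain k where k: "bij_betw k {..<card J} J"
    using ex_bij_betw_nat_finite[OF J(1)] by (auto simp: atLeast0LessThan)
  show ?thesis
  proof (rule that[of "card J" "\<lambda>i. H (?e (k i))" "\<lambda>i x. F x (k i)"])
    have kI: "k i \<in> I" if "i < card J" for i using k J(2) that by (auto simp: bij_betw_def)
    show "H (?e (k i)) \<in> carrier M" if "i < card J" for i by (rule q)
    show "(\<lambda>x. F x (k i)) \<in> right_module_hom S M (regular_bimodule S)" if "i < card J" for i
      by (rule coord[OF kI[OF that]])
    fix x assume x: "x \<in> carrier M"
    have "(\<Oplus>\<^bsub>M\<^esub>i\<in>k ` {..<card J}. H (?e i) \<triangleleft>\<^bsub>M\<^esub> F x i) = (\<Oplus>\<^bsub>M\<^esub>i\<in>{..<card J}. H (?e (k i)) \<triangleleft>\<^bsub>M\<^esub> F x (k i))"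
      by (rule M.M.finsum_reindex)
        (use k J(2) in \<open>auto simp: bij_betw_def intro!: M.rsmult_closed q coord_closed[OF _ x]\<close>)
    then show "(\<Oplus>\<^bsub>M\<^esub>i\<in>{..<card J}. H (?e (k i)) \<triangleleft>\<^bsub>M\<^esub> F x (k i)) = x"
      using expand[OF x] k by (simp add: bij_betw_def)
  qed
qed

section \<open>Bimodule homomorphisms from tensor products\<close>

lemma bimodule_iso_inverse:
  assumes h: "h \<in> bimodule_iso R S X Y"
    and closed: "\<And>x y. \<lbrakk>x \<in> carrier X; y \<in> carrier X\<rbrakk> \<Longrightarrow> x \<oplus>\<^bsub>X\<^esub> y \<in> carrier X"
      "\<And>x s. \<lbrakk>x \<in> carrier X; s \<in> carrier S\<rbrakk> \<Longrightarrow> x \<triangleleft>\<^bsub>X\<^esub> s \<in> carrier X"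
      "\<And>r x. \<lbrakk>r \<in> carrier R; x \<in> carrier X\<rbrakk> \<Longrightarrow> r \<triangleright>\<^bsub>X\<^esub> x \<in> carrier X"
  shows "inv_into (carrier X) h \<in> bimodule_hom R S Y X"
proof -
  have hh: "h \<in> bimodule_hom R S X Y" and bij: "bij_betw h (carrier X) (carrier Y)"
    using h by (auto simp: bimodule_iso_def)
  have inv: "inv_into (carrier X) h y \<in> carrier X" "h (inv_into (carrier X) h y) = y" if "y \<in> carrier Y" for y
    using bij that by (auto simp: bij_betw_def inv_into_into f_inv_into_f)
  have eq: "inv_into (carrier X) h y = x" if "x \<in> carrier X" "y = h x" for x y
    using bij that by (simp add: bij_betw_def)
  show ?thesis
    unfolding bimodule_hom_iff
    using hh inv closed by (intro conjI ballI eq) (simp_all add: bimodule_hom_iff)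
qed

context ring_extension
begin

abbreviation "T \<equiv> T_ring A B"
abbreviation "Q \<equiv> Q_module A B"
abbreviation "QT \<equiv> tensor_group (carrier T) Q (AA_left_T A B)"
abbreviation "qt \<equiv> pure_tensor (carrier T) Q (AA_left_T A B)"

lemma Q_simps [simp]:
  "carrier Q = centralizer_in (AAA A B) B" "q \<oplus>\<^bsub>Q\<^esub> q' = q \<oplus>\<^bsub>AAA A B\<^esub> q'"
  "\<zero>\<^bsub>Q\<^esub> = \<zero>\<^bsub>AAA A B\<^esub>" "q \<triangleleft>\<^bsub>Q\<^esub> t = sandwich (AAA A B) q t"
  by (simp_all add: Q_module_def)

lemma T_simps [simp]:
  "t \<in> carrier T \<longleftrightarrow> t \<in> centralizer_in (AA A B) B" "s \<oplus>\<^bsub>T\<^esub> t = s \<oplus>\<^bsub>AA A B\<^esub> t"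
  "s \<otimes>\<^bsub>T\<^esub> t = sandwich (AA A B) s t"
  by (simp_all add: T_ring_def)

lemma AA_left_T_simps [simp]:
  "carrier (AA_left_T A B) = carrier (AA A B)" "u \<oplus>\<^bsub>AA_left_T A B\<^esub> v = u \<oplus>\<^bsub>AA A B\<^esub> v"
  "t \<odot>\<^bsub>AA_left_T A B\<^esub> u = sandwich (AA A B) t u"
  by (simp_all add: AA_left_T_def)

lemma Q_tensor_AA_simps [simp]:
  "carrier (Q_tensor_AA A B) = carrier QT" "w \<oplus>\<^bsub>Q_tensor_AA A B\<^esub> w' = w \<oplus>\<^bsub>QT\<^esub> w'"
  by (simp_all add: Q_tensor_AA_def Let_def)

lemma centralizer_carrier: "x \<in> centralizer_in X B \<Longrightarrow> x \<in> carrier X"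
  by (simp add: centralizer_in_def)

lemma sandwich_bimodule_hom:
  assumes "bimodule A A X" "x \<in> centralizer_in X B"
  shows "sandwich X x \<in> bimodule_hom A A (AA A B) X"
  using sandwich_hom[OF assms] sandwich_l[OF assms] sandwich_r[OF assms]
  by (auto simp: bimodule_hom_iff hom_def)

lemma bimodule_hom_centralizer:
  assumes "h \<in> bimodule_hom A A X Y" "x \<in> centralizer_in X B"
  shows "h x \<in> centralizer_in Y B"
proof -
  have x: "x \<in> carrier X" using assms(2) by (rule centralizer_carrier)
  have "b \<triangleright>\<^bsub>Y\<^esub> h x = h x \<triangleleft>\<^bsub>Y\<^esub> b" if b: "b \<in> B" for b
  proof -
    have bA: "b \<in> carrier A" using b B_subset by blast
    have "b \<triangleright>\<^bsub>Y\<^esub> h x = h (b \<triangleright>\<^bsub>X\<^esub> x)" using assms(1) bA x by (simp add: bimodule_hom_iff)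
    also have "\<dots> = h (x \<triangleleft>\<^bsub>X\<^esub> b)" using assms(2) b by (simp add: centralizer_in_def)
    also have "\<dots> = h x \<triangleleft>\<^bsub>Y\<^esub> b" using assms(1) bA x by (simp add: bimodule_hom_iff)
    finally show ?thesis .
  qed
  then show ?thesis using assms(1) x by (simp add: centralizer_in_def bimodule_hom_iff)
qed

text \<open>
  Both sides are additive in \<open>u\<close> and send \<open>a \<otimes> a'\<close> to \<open>a (h x) a'\<close>. For \<open>u\<close> in \<open>T\<close> this says that
  \<open>h\<close> is right \<open>T\<close>-linear on the elements centralizing \<open>B\<close>.
\<close>

lemma bimodule_hom_sandwich:
  assumes X: "bimodule A A X" and Y: "bimodule A A Y"
    and h: "h \<in> bimodule_hom A A X Y" and x: "x \<in> centralizer_in X B" and u: "u \<in> carrier (AA A B)"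
  shows "h (sandwich X x u) = sandwich Y (h x) u"
proof (rule AA_eqI[OF Y _ _ _ u])
  interpret X: bimodule A A X by (rule X)
  note hx = bimodule_hom_centralizer[OF h x]
  show "(\<lambda>u. h (sandwich X x u)) \<in> hom (add_monoid (AA A B)) (add_monoid Y)"
    by (rule add_hom_compose[OF sandwich_hom[OF X x] bimodule_hom_additive[OF h]])
  show "sandwich Y (h x) \<in> hom (add_monoid (AA A B)) (add_monoid Y)" by (rule sandwich_hom[OF Y hx])
  fix a a' assume "a \<in> carrier A" "a' \<in> carrier A"
  then show "h (sandwich X x (pure2 A B a a')) = sandwich Y (h x) (pure2 A B a a')"
    using h centralizer_carrier[OF x] X.lsmult_closed
    by (simp add: sandwich_pure[OF X x] sandwich_pure[OF Y hx] bimodule_hom_iff)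
qed

lemma sandwich_pure2_one:
  assumes u: "u \<in> carrier (AA A B)"
  shows "sandwich (AA A B) (pure2 A B \<one> \<one>) u = u"
  by (rule AA_eqI[OF AA_bimodule sandwich_hom[OF AA_bimodule pure2_one_central] _ _ u])
    (auto simp: hom_def sandwich_pure[OF AA_bimodule pure2_one_central] pure2_l pure2_r)

text \<open>
  As an \<open>A\<close>-\<open>A\<close>-bimodule \<open>A \<otimes>\<^sub>B A\<close> is generated by \<open>1 \<otimes> 1\<close>, which centralizes \<open>B\<close>; so
  \<open>g \<mapsto> g (1 \<otimes> 1)\<close> identifies the homomorphisms \<open>A \<otimes>\<^sub>B A \<rightarrow> X\<close> with \<open>X\<^sup>B\<close>. In particular those into
  the threefold tensor product are the elements of \<open>Q\<close>.
\<close>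

lemma bimodule_hom_from_AA:
  assumes X: "bimodule A A X" and g: "g \<in> bimodule_hom A A (AA A B) X" and u: "u \<in> carrier (AA A B)"
  shows "g u = sandwich X (g (pure2 A B \<one> \<one>)) u"
  using bimodule_hom_sandwich[OF AA_bimodule X g pure2_one_central u] sandwich_pure2_one[OF u] by simp

text \<open>
  The equation says that the \<open>q i\<close> and \<open>f i\<close> form a dual basis in which the functionals take values in
  \<open>A \<otimes>\<^sub>B A\<close> and are defined on the whole of \<open>A \<otimes>\<^sub>B A \<otimes>\<^sub>B A\<close>, not only on \<open>Q\<close>.
\<close>

lemma H_depth_3_iff:
  "H_depth_3 A B \<longleftrightarrow> (\<exists>(m::nat) q f.
    (\<forall>i<m. q i \<in> centralizer_in (AAA A B) B \<and> f i \<in> bimodule_hom A A (AAA A B) (AA A B)) \<and>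
    (\<forall>x\<in>carrier (AAA A B). (\<Oplus>\<^bsub>AAA A B\<^esub>i\<in>{..<m}. sandwich (AAA A B) (q i) (f i x)) = x))"
  unfolding H_depth_3_def iso_to_summand_of_power_iff[OF AAA_bimodule AA_bimodule]
proof
  assume "\<exists>m>0::nat. \<exists>f g. (\<forall>i<m. f i \<in> bimodule_hom A A (AAA A B) (AA A B) \<and> g i \<in> bimodule_hom A A (AA A B) (AAA A B)) \<and>
    (\<forall>x\<in>carrier (AAA A B). (\<Oplus>\<^bsub>AAA A B\<^esub>i\<in>{..<m}. g i (f i x)) = x)"
  then obtain m :: nat and f g
    where fg: "\<forall>i<m. f i \<in> bimodule_hom A A (AAA A B) (AA A B) \<and> g i \<in> bimodule_hom A A (AA A B) (AAA A B)"
      and gf: "\<forall>x\<in>carrier (AAA A B). (\<Oplus>\<^bsub>AAA A B\<^esub>i\<in>{..<m}. g i (f i x)) = x"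
    by (elim exE conjE) (rule that)
  have f: "f i \<in> bimodule_hom A A (AAA A B) (AA A B)" and g: "g i \<in> bimodule_hom A A (AA A B) (AAA A B)"
    if "i < m" for i using fg that by auto
  let ?q = "\<lambda>i. g i (pure2 A B \<one> \<one>)"
  have "(\<Oplus>\<^bsub>AAA A B\<^esub>i\<in>{..<m}. sandwich (AAA A B) (?q i) (f i x)) = x" if x: "x \<in> carrier (AAA A B)" for x
  proof -
    have c: "f i x \<in> carrier (AA A B)" if "i < m" for i using f[OF that] x by (simp add: bimodule_hom_iff)
    have c': "g i (f i x) \<in> carrier (AAA A B)" if "i < m" for i
      using g[OF that] c[OF that] by (simp add: bimodule_hom_iff)
    have "(\<Oplus>\<^bsub>AAA A B\<^esub>i\<in>{..<m}. sandwich (AAA A B) (?q i) (f i x)) = (\<Oplus>\<^bsub>AAA A B\<^esub>i\<in>{..<m}. g i (f i x))"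
      by (rule AAA.M.finsum_cong') (use c' bimodule_hom_from_AA[OF AAA_bimodule g c, symmetric] in auto)
    then show ?thesis using gf x by simp
  qed
  then show "\<exists>(m::nat) q f. (\<forall>i<m. q i \<in> centralizer_in (AAA A B) B \<and> f i \<in> bimodule_hom A A (AAA A B) (AA A B)) \<and>
    (\<forall>x\<in>carrier (AAA A B). (\<Oplus>\<^bsub>AAA A B\<^esub>i\<in>{..<m}. sandwich (AAA A B) (q i) (f i x)) = x)"
    using f bimodule_hom_centralizer[OF g pure2_one_central]
    by (intro exI[of _ m] exI[of _ ?q] exI[of _ f]) auto
next
  assume "\<exists>(m::nat) q f. (\<forall>i<m. q i \<in> centralizer_in (AAA A B) B \<and> f i \<in> bimodule_hom A A (AAA A B) (AA A B)) \<and>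
    (\<forall>x\<in>carrier (AAA A B). (\<Oplus>\<^bsub>AAA A B\<^esub>i\<in>{..<m}. sandwich (AAA A B) (q i) (f i x)) = x)"
  then obtain m :: nat and q f
    where qf: "\<forall>i<m. q i \<in> centralizer_in (AAA A B) B \<and> f i \<in> bimodule_hom A A (AAA A B) (AA A B)"
      and sum: "\<forall>x\<in>carrier (AAA A B). (\<Oplus>\<^bsub>AAA A B\<^esub>i\<in>{..<m}. sandwich (AAA A B) (q i) (f i x)) = x"
    by (elim exE conjE) (rule that)
  have q: "q i \<in> centralizer_in (AAA A B) B" and f: "f i \<in> bimodule_hom A A (AAA A B) (AA A B)"
    if "i < m" for i using qf that by auto
  \<comment> \<open>One zero summand is added, since the right-hand side admits \<open>m = 0\<close> while H-depth 3 asks for a positive power.\<close>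
  let ?f = "\<lambda>i. if i < m then f i else (\<lambda>_. \<zero>\<^bsub>AA A B\<^esub>)"
  let ?g = "\<lambda>i. if i < m then sandwich (AAA A B) (q i) else (\<lambda>_. \<zero>\<^bsub>AAA A B\<^esub>)"
  have "(\<lambda>_. \<zero>\<^bsub>AA A B\<^esub>) \<in> bimodule_hom A A (AAA A B) (AA A B)"
    by (simp add: bimodule_hom_iff AA.rsmult_zero_left AA.lsmult_zero_right)
  then have f': "?f i \<in> bimodule_hom A A (AAA A B) (AA A B)" for i using f by simp
  have "(\<lambda>_. \<zero>\<^bsub>AAA A B\<^esub>) \<in> bimodule_hom A A (AA A B) (AAA A B)"
    by (simp add: bimodule_hom_iff AAA.rsmult_zero_left AAA.lsmult_zero_right)
  then have g': "?g i \<in> bimodule_hom A A (AA A B) (AAA A B)" for i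
    using sandwich_bimodule_hom[OF AAA_bimodule q] by simp
  have "(\<Oplus>\<^bsub>AAA A B\<^esub>i\<in>{..<Suc m}. ?g i (?f i x)) = x" if x: "x \<in> carrier (AAA A B)" for x
  proof -
    have c: "?g i (?f i x) \<in> carrier (AAA A B)" for i
      using bimodule_hom_compose[OF f' g'] x unfolding bimodule_hom_iff by blast
    have "(\<Oplus>\<^bsub>AAA A B\<^esub>i\<in>{..<Suc m}. ?g i (?f i x)) = ?g m (?f m x) \<oplus>\<^bsub>AAA A B\<^esub> (\<Oplus>\<^bsub>AAA A B\<^esub>i\<in>{..<m}. ?g i (?f i x))"
      unfolding lessThan_Suc by (rule AAA.M.finsum_insert) (use c in auto)
    also have "(\<Oplus>\<^bsub>AAA A B\<^esub>i\<in>{..<m}. ?g i (?f i x)) = (\<Oplus>\<^bsub>AAA A B\<^esub>i\<in>{..<m}. sandwich (AAA A B) (q i) (f i x))"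
    proof (rule AAA.M.finsum_cong'[OF refl])
      show "(\<lambda>i. sandwich (AAA A B) (q i) (f i x)) \<in> {..<m} \<rightarrow> carrier (AAA A B)"
      proof
        fix i assume "i \<in> {..<m}"
        then show "sandwich (AAA A B) (q i) (f i x) \<in> carrier (AAA A B)" using c[of i] by simp
      qed
    qed simp
    finally show ?thesis using sum x by simp
  qed
  then show "\<exists>m>0::nat. \<exists>f g. (\<forall>i<m. f i \<in> bimodule_hom A A (AAA A B) (AA A B) \<and> g i \<in> bimodule_hom A A (AA A B) (AAA A B)) \<and>
    (\<forall>x\<in>carrier (AAA A B). (\<Oplus>\<^bsub>AAA A B\<^esub>i\<in>{..<m}. g i (f i x)) = x)"
    using f' g' by (intro exI[of _ "Suc m"] conjI exI[of _ ?f] exI[of _ ?g]) auto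
qed

lemma QT_abelian_group: "abelian_group QT"
  by (rule tensor_setting.tensor_abelian_group[OF tensor_setting_Q])

lemma Q_tensor_AA_action_homs:
  assumes "c \<in> carrier A"
  shows "(\<lambda>w. w \<triangleleft>\<^bsub>Q_tensor_AA A B\<^esub> c) \<in> hom (add_monoid QT) (add_monoid QT)"
    and "(\<lambda>w. c \<triangleright>\<^bsub>Q_tensor_AA A B\<^esub> w) \<in> hom (add_monoid QT) (add_monoid QT)"
  using tensor_lift_hom[OF tensor_setting_Q QT_abelian_group Q_tensor_AA_balanced(1)[OF assms]]
    tensor_lift_hom[OF tensor_setting_Q QT_abelian_group Q_tensor_AA_balanced(2)[OF assms]]
  by (simp_all add: Q_tensor_AA_def Let_def)

text \<open>
  A right \<open>T\<close>-linear map \<open>\<psi> : Q \<rightarrow> X\<^sup>B\<close> extends to \<open>q \<otimes> u \<mapsto> \<psi> q \<cdot> u\<close>. The canonical map is the case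
  where \<open>\<psi>\<close> is the identity; functionals \<open>Q \<rightarrow> T\<close> give the maps to \<open>A \<otimes>\<^sub>B A\<close> from which H-depth 3 is
  recovered.
\<close>

lemma induced_bimodule_hom:
  assumes X: "bimodule A A X"
    and \<psi>: "\<And>q. q \<in> carrier Q \<Longrightarrow> \<psi> q \<in> centralizer_in X B"
    and \<psi>_add: "\<And>q q'. \<lbrakk>q \<in> carrier Q; q' \<in> carrier Q\<rbrakk> \<Longrightarrow> \<psi> (q \<oplus>\<^bsub>Q\<^esub> q') = \<psi> q \<oplus>\<^bsub>X\<^esub> \<psi> q'"
    and \<psi>_act: "\<And>q t. \<lbrakk>q \<in> carrier Q; t \<in> carrier T\<rbrakk> \<Longrightarrow> \<psi> (q \<triangleleft>\<^bsub>Q\<^esub> t) = sandwich X (\<psi> q) t"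
  defines "L \<equiv> tensor_lift X (\<lambda>q u. sandwich X (\<psi> q) u)"
  shows "L \<in> bimodule_hom A A (Q_tensor_AA A B) X"
    and "\<And>q u. \<lbrakk>q \<in> carrier Q; u \<in> carrier (AA A B)\<rbrakk> \<Longrightarrow> L (qt q u) = sandwich X (\<psi> q) u"
proof -
  interpret X: bimodule A A X by (rule X)
  have closed: "sandwich X (\<psi> q) u \<in> carrier X" if "q \<in> carrier Q" "u \<in> carrier (AA A B)" for q u
    using hom_in_carrier[OF sandwich_hom[OF X \<psi>[OF that(1)]]] that(2) by simp
  have bal: "balanced (carrier T) Q (AA_left_T A B) X (\<lambda>q u. sandwich X (\<psi> q) u)"
    unfolding balanced_def
  proof (intro conjI ballI)
    fix q q' u assume "q \<in> carrier Q" "q' \<in> carrier Q" "u \<in> carrier (AA_left_T A B)"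
    then show "sandwich X (\<psi> (q \<oplus>\<^bsub>Q\<^esub> q')) u = sandwich X (\<psi> q) u \<oplus>\<^bsub>X\<^esub> sandwich X (\<psi> q') u"
      using \<psi>_add \<psi> centralizer_add[OF X \<psi> \<psi>] by (simp add: sandwich_add[OF X])
  next
    fix q t u assume "q \<in> carrier Q" "t \<in> carrier T" "u \<in> carrier (AA_left_T A B)"
    then show "sandwich X (\<psi> (q \<triangleleft>\<^bsub>Q\<^esub> t)) u = sandwich X (\<psi> q) (t \<odot>\<^bsub>AA_left_T A B\<^esub> u)"
      using \<psi>_act[of q t] sandwich_assoc[OF X \<psi>[of q], of t u] by simp
  qed (use closed sandwich_add_right[OF X \<psi>] in simp_all)
  show pure: "L (qt q u) = sandwich X (\<psi> q) u" if "q \<in> carrier Q" "u \<in> carrier (AA A B)" for q u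
    unfolding L_def using that
    by (intro tensor_lift_pure[OF tensor_setting_Q X.M.abelian_group_axioms bal]) simp_all
  have L: "L \<in> hom (add_monoid QT) (add_monoid X)"
    unfolding L_def by (rule tensor_lift_hom[OF tensor_setting_Q X.M.abelian_group_axioms bal])
  note eqI = tensor_hom_eqI[OF tensor_setting_Q X.M.abelian_group_axioms]
  have r: "L (w \<triangleleft>\<^bsub>Q_tensor_AA A B\<^esub> c) = L w \<triangleleft>\<^bsub>X\<^esub> c" if c: "c \<in> carrier A" and w: "w \<in> carrier QT" for c w
    by (rule eqI[OF add_hom_compose[OF Q_tensor_AA_action_homs(1)[OF c] L] add_hom_compose[OF L X.rsmult_hom[OF c]] _ w])
      (use c in \<open>simp add: Q_tensor_AA_actions pure AA.rsmult_closed sandwich_r[OF X \<psi>]\<close>)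
  have l: "L (c \<triangleright>\<^bsub>Q_tensor_AA A B\<^esub> w) = c \<triangleright>\<^bsub>X\<^esub> L w" if c: "c \<in> carrier A" and w: "w \<in> carrier QT" for c w
    by (rule eqI[OF add_hom_compose[OF Q_tensor_AA_action_homs(2)[OF c] L] add_hom_compose[OF L X.lsmult_hom[OF c]] _ w])
      (use c in \<open>simp add: Q_tensor_AA_actions pure AA.lsmult_closed sandwich_l[OF X \<psi>]\<close>)
  show "L \<in> bimodule_hom A A (Q_tensor_AA A B) X"
    using L r l by (auto simp: bimodule_hom_iff hom_def)
qed

lemma canonical_map_hom: "canonical_map A B \<in> bimodule_hom A A (Q_tensor_AA A B) (AAA A B)"
  and canonical_map_pure: "\<lbrakk>q \<in> carrier Q; u \<in> carrier (AA A B)\<rbrakk> \<Longrightarrow> canonical_map A B (qt q u) = sandwich (AAA A B) q u"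
  unfolding canonical_map_def
  by (rule induced_bimodule_hom[OF AAA_bimodule, of "\<lambda>q. q"]; simp)+

text \<open>
  A sum in \<open>Q\<close> is formed over a smaller carrier than the same sum in \<open>A \<otimes>\<^sub>B A \<otimes>\<^sub>B A\<close>, so the two have to
  be identified along the inclusion.
\<close>

lemma finsum_Q:
  assumes "f \<in> I \<rightarrow> carrier Q"
  shows "(\<Oplus>\<^bsub>Q\<^esub>i\<in>I. f i) = (\<Oplus>\<^bsub>AAA A B\<^esub>i\<in>I. f i)"
proof -
  interpret Q: right_module T Q by (rule Q_is_right_module)
  have "(\<lambda>x. x) \<in> hom (add_monoid Q) (add_monoid (AAA A B))"
    by (auto simp: hom_def centralizer_carrier)
  then show ?thesis by (rule finsum_of_hom[OF Q.M.abelian_group_axioms AAA.M.abelian_group_axioms _ assms])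
qed

end

section \<open>H-depth 3, dual bases of \<open>Q\<close> and the canonical map\<close>

context ring_extension
begin

text \<open>
  A bimodule homomorphism maps elements centralizing \<open>B\<close> to such elements, so \<open>f i\<close> restricts to a map
  \<open>Q \<rightarrow> T\<close>, which is \<open>T\<close>-linear by \<open>bimodule_hom_sandwich\<close>; the expansion of the identity restricts to \<open>Q\<close>.
\<close>

lemma dual_basis_of_depth_3:
  assumes q: "\<And>i. i < m \<Longrightarrow> q i \<in> centralizer_in (AAA A B) B"
    and f: "\<And>i. i < (m::nat) \<Longrightarrow> f i \<in> bimodule_hom A A (AAA A B) (AA A B)"
    and sum: "\<And>x. x \<in> carrier (AAA A B) \<Longrightarrow>
      (\<Oplus>\<^bsub>AAA A B\<^esub>i\<in>{..<m}. sandwich (AAA A B) (q i) (f i x)) = x"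
  shows "\<And>i. i < m \<Longrightarrow> f i \<in> right_module_hom T Q (regular_bimodule T)"
    and "\<And>x. x \<in> carrier Q \<Longrightarrow> (\<Oplus>\<^bsub>Q\<^esub>i\<in>{..<m}. q i \<triangleleft>\<^bsub>Q\<^esub> f i x) = x"
proof -
  have fQ: "f i x \<in> centralizer_in (AA A B) B" if "i < m" "x \<in> centralizer_in (AAA A B) B" for i x
    by (rule bimodule_hom_centralizer[OF f[OF that(1)] that(2)])
  show "f i \<in> right_module_hom T Q (regular_bimodule T)" if i: "i < m" for i
    unfolding right_module_hom_iff
  proof (intro conjI ballI)
    fix x y assume "x \<in> carrier Q" "y \<in> carrier Q"
    then show "f i (x \<oplus>\<^bsub>Q\<^esub> y) = f i x \<oplus>\<^bsub>regular_bimodule T\<^esub> f i y"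
      using f[OF i] by (simp add: bimodule_hom_iff centralizer_carrier)
  next
    fix x t assume "x \<in> carrier Q" "t \<in> carrier T"
    then show "f i (x \<triangleleft>\<^bsub>Q\<^esub> t) = f i x \<triangleleft>\<^bsub>regular_bimodule T\<^esub> t"
      using bimodule_hom_sandwich[OF AAA_bimodule AA_bimodule f[OF i]] by (simp add: centralizer_carrier)
  qed (use fQ[OF i] in simp)
  show "(\<Oplus>\<^bsub>Q\<^esub>i\<in>{..<m}. q i \<triangleleft>\<^bsub>Q\<^esub> f i x) = x" if x: "x \<in> carrier Q" for x
  proof -
    have "(\<Oplus>\<^bsub>Q\<^esub>i\<in>{..<m}. q i \<triangleleft>\<^bsub>Q\<^esub> f i x) = (\<Oplus>\<^bsub>AAA A B\<^esub>i\<in>{..<m}. q i \<triangleleft>\<^bsub>Q\<^esub> f i x)"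
      by (rule finsum_Q) (use sandwich_central[OF AAA_bimodule q fQ] x in auto)
    then show ?thesis using sum[of x] x by (simp add: centralizer_carrier)
  qed
qed

lemma qt_closed:
  "\<lbrakk>q \<in> centralizer_in (AAA A B) B; u \<in> carrier (AA A B)\<rbrakk> \<Longrightarrow> qt q u \<in> carrier QT"
  using tensor_setting.pure_closed[OF tensor_setting_Q] by simp

lemma qt_hom_left:
  assumes "u \<in> carrier (AA A B)"
  shows "(\<lambda>q. qt q u) \<in> hom (add_monoid Q) (add_monoid QT)"
  using pure_balanced[OF tensor_setting_Q] assms by (simp add: balanced_def hom_def)

lemma qt_hom_right:
  assumes "q \<in> centralizer_in (AAA A B) B"
  shows "qt q \<in> hom (add_monoid (AA A B)) (add_monoid QT)"
  using pure_balanced[OF tensor_setting_Q] assms by (simp add: balanced_def hom_def)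

text \<open>
  The inverse is \<open>x \<mapsto> \<Sum>\<^sub>i q\<^sub>i \<otimes> f\<^sub>i x\<close>. That it is a right inverse is the expansion of the identity. It is a
  left inverse because \<open>f\<^sub>i (x\<cdot>u) = f\<^sub>i x \<cdot> u\<close> for \<open>x\<close> in \<open>Q\<close>, where \<open>f\<^sub>i x\<close> lies in \<open>T\<close> and can be moved across
  the tensor sign: \<open>\<Sum>\<^sub>i q\<^sub>i \<otimes> f\<^sub>i x \<cdot> u = (\<Sum>\<^sub>i q\<^sub>i \<cdot> f\<^sub>i x) \<otimes> u = x \<otimes> u\<close>.
\<close>

lemma canonical_map_iso_of_depth_3:
  assumes q: "\<And>i. i < m \<Longrightarrow> q i \<in> centralizer_in (AAA A B) B"
    and f: "\<And>i. i < (m::nat) \<Longrightarrow> f i \<in> bimodule_hom A A (AAA A B) (AA A B)"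
    and sum: "\<And>x. x \<in> carrier (AAA A B) \<Longrightarrow>
      (\<Oplus>\<^bsub>AAA A B\<^esub>i\<in>{..<m}. sandwich (AAA A B) (q i) (f i x)) = x"
  shows "canonical_map A B \<in> bimodule_iso A A (Q_tensor_AA A B) (AAA A B)"
proof -
  interpret Q: right_module T Q by (rule Q_is_right_module)
  interpret QT: abelian_group QT by (rule QT_abelian_group)
  let ?c = "canonical_map A B"
  define v where "v x = (\<Oplus>\<^bsub>QT\<^esub>i\<in>{..<m}. qt (q i) (f i x))" for x
  have can: "?c \<in> hom (add_monoid QT) (add_monoid (AAA A B))"
    using canonical_map_hom by (auto simp: bimodule_hom_iff hom_def)
  have fc: "f i x \<in> carrier (AA A B)" if "i < m" "x \<in> carrier (AAA A B)" for i x
    using f[OF that(1)] that(2) by (simp add: bimodule_hom_iff)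
  have v: "v \<in> hom (add_monoid (AAA A B)) (add_monoid QT)"
    unfolding v_def
    by (rule hom_of_finsum_of_homs[OF AAA.M.abelian_group_axioms QT_abelian_group])
      (use add_hom_compose[OF bimodule_hom_additive[OF f] qt_hom_right[OF q]] in simp)
  have can_v: "?c (v x) = x" if x: "x \<in> carrier (AAA A B)" for x
  proof -
    have "?c (v x) = (\<Oplus>\<^bsub>AAA A B\<^esub>i\<in>{..<m}. ?c (qt (q i) (f i x)))"
      unfolding v_def using qt_closed[OF q fc] x
      by (intro finsum_of_hom[OF QT_abelian_group AAA.M.abelian_group_axioms can]) auto
    also have "\<dots> = (\<Oplus>\<^bsub>AAA A B\<^esub>i\<in>{..<m}. sandwich (AAA A B) (q i) (f i x))"
      using hom_in_carrier[OF sandwich_hom[OF AAA_bimodule q]] fc[OF _ x] q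
      by (intro AAA.M.finsum_cong') (auto simp: canonical_map_pure)
    finally show ?thesis using sum[OF x] by simp
  qed
  have v_can: "v (?c w) = w" if w: "w \<in> carrier QT" for w
  proof (rule tensor_hom_eqI[OF tensor_setting_Q QT_abelian_group add_hom_compose[OF can v] _ _ w])
    show "(\<lambda>w. w) \<in> hom (add_monoid QT) (add_monoid QT)" by (simp add: hom_def)
    fix x u assume "x \<in> carrier Q" "u \<in> carrier (AA_left_T A B)"
    then have x: "x \<in> centralizer_in (AAA A B) B" and u: "u \<in> carrier (AA A B)" by simp_all
    have fx: "f i x \<in> centralizer_in (AA A B) B" if "i < m" for i
      by (rule bimodule_hom_centralizer[OF f[OF that] x])
    have qf: "q i \<triangleleft>\<^bsub>Q\<^esub> f i x \<in> carrier Q" if "i < m" for i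
      using Q.rsmult_closed q[OF that] fx[OF that] by simp
    have step: "qt (q i) (f i (?c (qt x u))) = qt (q i \<triangleleft>\<^bsub>Q\<^esub> f i x) u" if i: "i < m" for i
    proof -
      have "f i (?c (qt x u)) = sandwich (AA A B) (f i x) u"
        using canonical_map_pure[of x u] x u bimodule_hom_sandwich[OF AAA_bimodule AA_bimodule f[OF i] x u] by simp
      moreover have "qt (q i \<triangleleft>\<^bsub>Q\<^esub> f i x) u = qt (q i) (f i x \<odot>\<^bsub>AA_left_T A B\<^esub> u)"
        using pure_balanced[OF tensor_setting_Q] q[OF i] fx[OF i] u unfolding balanced_def by simp
      ultimately show ?thesis by simp
    qed
    have "v (?c (qt x u)) = (\<Oplus>\<^bsub>QT\<^esub>i\<in>{..<m}. qt (q i \<triangleleft>\<^bsub>Q\<^esub> f i x) u)"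
      unfolding v_def by (rule QT.finsum_cong') (use step qt_closed qf u in auto)
    also have "\<dots> = qt (\<Oplus>\<^bsub>Q\<^esub>i\<in>{..<m}. q i \<triangleleft>\<^bsub>Q\<^esub> f i x) u"
      by (rule finsum_of_hom[OF Q.M.abelian_group_axioms QT_abelian_group qt_hom_left[OF u], symmetric])
        (use qf in blast)
    also have "(\<Oplus>\<^bsub>Q\<^esub>i\<in>{..<m}. q i \<triangleleft>\<^bsub>Q\<^esub> f i x) = x"
      using dual_basis_of_depth_3(2)[OF q f sum, of x] x by simp
    finally show "v (?c (qt x u)) = qt x u" .
  qed
  have "bij_betw ?c (carrier QT) (carrier (AAA A B))"
    by (rule bij_betw_byWitness[of _ v])
      (use can_v v_can hom_in_carrier[OF can] hom_in_carrier[OF v] in auto)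
  then show ?thesis using canonical_map_hom by (simp add: bimodule_iso_def)
qed

text \<open>
  Each functional \<open>\<phi> i : Q \<rightarrow> T\<close> induces a bimodule homomorphism \<open>L i\<close> from \<open>Q \<otimes>\<^sub>T (A \<otimes>\<^sub>B A)\<close> to
  \<open>A \<otimes>\<^sub>B A\<close>. Along the canonical isomorphism it becomes a bimodule homomorphism on
  \<open>A \<otimes>\<^sub>B A \<otimes>\<^sub>B A\<close>. Applying \<open>\<Sum>\<^sub>i q\<^sub>i \<cdot> _\<close> to \<open>L i (x \<otimes> u) = \<phi> i x \<cdot> u\<close> gives \<open>x \<cdot> u\<close>, the image of
  \<open>x \<otimes> u\<close> under the canonical map, and such elements generate.
\<close>

lemma depth_3_of_dual_basis:
  assumes q: "\<And>i. i < m \<Longrightarrow> q i \<in> carrier Q"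
    and \<phi>: "\<And>i. i < (m::nat) \<Longrightarrow> \<phi> i \<in> right_module_hom T Q (regular_bimodule T)"
    and sum: "\<And>x. x \<in> carrier Q \<Longrightarrow> (\<Oplus>\<^bsub>Q\<^esub>i\<in>{..<m}. q i \<triangleleft>\<^bsub>Q\<^esub> \<phi> i x) = x"
    and iso: "canonical_map A B \<in> bimodule_iso A A (Q_tensor_AA A B) (AAA A B)"
  shows "H_depth_3 A B"
proof -
  interpret Q: right_module T Q by (rule Q_is_right_module)
  interpret QT: abelian_group QT by (rule QT_abelian_group)
  let ?c = "canonical_map A B"
  let ?inv = "inv_into (carrier (Q_tensor_AA A B)) ?c"
  define L where "L i = tensor_lift (AA A B) (\<lambda>x u. sandwich (AA A B) (\<phi> i x) u)" for i
  have \<phi>T: "\<phi> i x \<in> centralizer_in (AA A B) B" if "i < m" "x \<in> carrier Q" for i x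
    using \<phi>[OF that(1)] that(2) by (simp add: right_module_hom_iff)
  have L: "L i \<in> bimodule_hom A A (Q_tensor_AA A B) (AA A B)"
    and L_pure: "\<And>x u. \<lbrakk>x \<in> carrier Q; u \<in> carrier (AA A B)\<rbrakk> \<Longrightarrow> L i (qt x u) = sandwich (AA A B) (\<phi> i x) u"
    if i: "i < m" for i
    unfolding L_def
    by (rule induced_bimodule_hom[OF AA_bimodule], use \<phi>[OF i] in \<open>simp_all add: right_module_hom_iff\<close>)+
  have inv: "?inv \<in> bimodule_hom A A (AAA A B) (Q_tensor_AA A B)"
    by (rule bimodule_iso_inverse[OF iso])
      (use hom_in_carrier[OF Q_tensor_AA_action_homs(1)] hom_in_carrier[OF Q_tensor_AA_action_homs(2)] in simp_all)
  have key: "(\<Oplus>\<^bsub>AAA A B\<^esub>i\<in>{..<m}. sandwich (AAA A B) (q i) (L i w)) = ?c w" if w: "w \<in> carrier QT" for w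
  proof (rule tensor_hom_eqI[OF tensor_setting_Q AAA.M.abelian_group_axioms _ _ _ w])
    show "(\<lambda>w. \<Oplus>\<^bsub>AAA A B\<^esub>i\<in>{..<m}. sandwich (AAA A B) (q i) (L i w)) \<in> hom (add_monoid QT) (add_monoid (AAA A B))"
    proof (rule hom_of_finsum_of_homs[OF QT_abelian_group AAA.M.abelian_group_axioms])
      fix i assume "i \<in> {..<m}"
      then have i: "i < m" by simp
      then show "(\<lambda>w. sandwich (AAA A B) (q i) (L i w)) \<in> hom (add_monoid QT) (add_monoid (AAA A B))"
        using L[OF i] sandwich_bimodule_hom[OF AAA_bimodule] q[OF i]
        by (auto simp: bimodule_hom_iff hom_def)
    qed
    show "?c \<in> hom (add_monoid QT) (add_monoid (AAA A B))"
      using canonical_map_hom by (auto simp: bimodule_hom_iff hom_def)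
    fix x u assume x: "x \<in> carrier Q" and "u \<in> carrier (AA_left_T A B)"
    then have u: "u \<in> carrier (AA A B)" by simp
    have c: "q i \<triangleleft>\<^bsub>Q\<^esub> \<phi> i x \<in> carrier Q" if "i < m" for i
      using Q.rsmult_closed[OF q[OF that]] \<phi>T[OF that x] by simp
    have su: "(\<lambda>y. sandwich (AAA A B) y u) \<in> hom (add_monoid Q) (add_monoid (AAA A B))"
      using hom_in_carrier[OF sandwich_hom[OF AAA_bimodule]] u sandwich_add[OF AAA_bimodule] centralizer_add[OF AAA_bimodule]
      by (simp add: hom_def)
    have "(\<Oplus>\<^bsub>AAA A B\<^esub>i\<in>{..<m}. sandwich (AAA A B) (q i) (L i (qt x u))) =
        (\<Oplus>\<^bsub>AAA A B\<^esub>i\<in>{..<m}. sandwich (AAA A B) (q i \<triangleleft>\<^bsub>Q\<^esub> \<phi> i x) u)"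
    proof (rule AAA.M.finsum_cong'[OF refl])
      show "(\<lambda>i. sandwich (AAA A B) (q i \<triangleleft>\<^bsub>Q\<^esub> \<phi> i x) u) \<in> {..<m} \<rightarrow> carrier (AAA A B)"
        using hom_in_carrier[OF su] c by (intro Pi_I) simp
      fix i assume "i \<in> {..<m}"
      then have i: "i < m" by simp
      show "sandwich (AAA A B) (q i) (L i (qt x u)) = sandwich (AAA A B) (q i \<triangleleft>\<^bsub>Q\<^esub> \<phi> i x) u"
        using q[OF i] sandwich_assoc[OF AAA_bimodule _ \<phi>T[OF i x] u, of "q i"] by (simp add: L_pure[OF i x u])
    qed
    also have "\<dots> = sandwich (AAA A B) (\<Oplus>\<^bsub>Q\<^esub>i\<in>{..<m}. q i \<triangleleft>\<^bsub>Q\<^esub> \<phi> i x) u"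
      by (rule finsum_of_hom[OF Q.M.abelian_group_axioms AAA.M.abelian_group_axioms su, symmetric])
        (use c in blast)
    also have "\<dots> = ?c (qt x u)" using sum[OF x] canonical_map_pure[OF x u] by simp
    finally show "(\<Oplus>\<^bsub>AAA A B\<^esub>i\<in>{..<m}. sandwich (AAA A B) (q i) (L i (qt x u))) = ?c (qt x u)" .
  qed
  have "\<forall>x\<in>carrier (AAA A B). (\<Oplus>\<^bsub>AAA A B\<^esub>i\<in>{..<m}. sandwich (AAA A B) (q i) (L i (?inv x))) = x"
  proof
    fix x assume x: "x \<in> carrier (AAA A B)"
    have surj: "?c ` carrier (Q_tensor_AA A B) = carrier (AAA A B)"
      using iso by (simp add: bimodule_iso_def bij_betw_def)
    have "?inv x \<in> carrier QT" using inv x by (simp add: bimodule_hom_iff)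
    then show "(\<Oplus>\<^bsub>AAA A B\<^esub>i\<in>{..<m}. sandwich (AAA A B) (q i) (L i (?inv x))) = x"
      using key f_inv_into_f[of x ?c "carrier (Q_tensor_AA A B)"] x surj by simp
  qed
  then show ?thesis
    unfolding H_depth_3_iff using q bimodule_hom_compose[OF inv L]
    by (intro exI[of _ m] exI[of _ q] exI[of _ "\<lambda>i x. L i (?inv x)"]) simp
qed

end

theorem theorem2p9:
  fixes A :: "('a, 'x) ring_scheme" and B :: "'a set"
  assumes "ring A" and "subring B A"
  shows "H_depth_3 A B \<longleftrightarrow>
    fin_gen_right_module (T_ring A B) (Q_module A B) \<and>
    projective_right_module (T_ring A B) (Q_module A B) \<and>
    canonical_map A B \<in> bimodule_iso A A (Q_tensor_AA A B) (AAA A B)"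
proof -
  interpret ring_extension A B using assms by (intro ring_extension.intro ring_extension_axioms.intro)
  show ?thesis
  proof (intro iffI; (elim conjE)?)
    assume "H_depth_3 A B"
    then obtain m :: nat and q f
      where qf: "\<forall>i<m. q i \<in> centralizer_in (AAA A B) B \<and> f i \<in> bimodule_hom A A (AAA A B) (AA A B)"
        and sum: "\<forall>x\<in>carrier (AAA A B). (\<Oplus>\<^bsub>AAA A B\<^esub>i\<in>{..<m}. sandwich (AAA A B) (q i) (f i x)) = x"
      unfolding H_depth_3_iff by blast
    have q: "q i \<in> centralizer_in (AAA A B) B" and f: "f i \<in> bimodule_hom A A (AAA A B) (AA A B)"
      if "i < m" for i using qf that by auto
    note s = bspec[OF sum]
    have "q i \<in> carrier Q" if "i < m" for i using q[OF that] by simp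
    note this dual_basis_of_depth_3[OF q f s]
    then show "fin_gen_right_module T Q \<and> projective_right_module T Q \<and>
        canonical_map A B \<in> bimodule_iso A A (Q_tensor_AA A B) (AAA A B)"
      using finite_projective_of_dual_basis[OF Q_is_right_module, of m q f] canonical_map_iso_of_depth_3[OF q f s]
      by blast
  next
    assume fin: "fin_gen_right_module T Q" "projective_right_module T Q"
      and iso: "canonical_map A B \<in> bimodule_iso A A (Q_tensor_AA A B) (AAA A B)"
    show "H_depth_3 A B"
      by (rule dual_basis_of_finite_projective[OF Q_is_right_module fin])
        (rule depth_3_of_dual_basis[OF _ _ _ iso])
  qed
qed

end
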